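(* Let $T>0$ and consider the Cauchy problem $$u_{tt}(t,x)-\sum_{j=1}^{d}\partial_{x_j}\left(h_j(x)\partial_{x_j}u(t,x)\right)=0,\quad (t,x)\in[0,T]\times\mathbb{R}^d,\qquad u(0,x)=u_0(x),\quad u_t(0,x)=u_1(x),\quad x\in\mathbb{R}^d,$$ with (possibly singular, distributional) positive coefficients and initial data, in the case when very weak solutions exist. Suppose that $h_i(x)=h(x)$ for all $i=1,\dots,d$. Assume that the regularisations of the coefficients $h_i$, $i=1,\dots,d$, and of the Cauchy data $u_0$ and $u_1$ satisfy: there exist $N_0,N_1,N_2\in\mathbb{N}_0$ such that $$\|h_{i,\varepsilon}\|_{W^{1,\infty}}\lesssim\varepsilon^{-N_0}\ \ (i=1,\dots,d),\qquad \|u_{0,\varepsilon}\|_{H^2}\lesssim\varepsilon^{-N_1},\qquad \|u_{1,\varepsilon}\|_{H^1}\lesssim\varepsilon^{-N_2}.$$ Then the very weak solution to the Cauchy problem is unique.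
   Context: Regularisations: these are nets of smooth functions, indexed by $\varepsilon\in(0,1]$, obtained by convolution with mollifiers: $h_{i,\varepsilon}=h_i*\psi_\varepsilon$, $u_{0,\varepsilon}=u_0*\psi_\varepsilon$, $u_{1,\varepsilon}=u_1*\psi_\varepsilon$, where $\psi_\varepsilon(x)=\varepsilon^{-d}\psi(x/\varepsilon)$ and $\psi\in C_0^\infty(\mathbb{R}^d)$, $\psi\ge0$, $\int\psi=1$. The coefficients are positive in the sense that all their regularisations are: for each family of regularisations considered there is $c_0>0$ with $h_{i,\varepsilon}\ge c_0$ for all $i$ and all $\varepsilon\in(0,1]$. Notation: $a\lesssim b$ means $a\le cb$ for some constant $c>0$; in estimates for nets, $c$ is independent of $\varepsilon\in(0,1]$ (and of $t\in[0,T]$). $W^{1,\infty}(\mathbb{R}^d)$ is the space of measurable $f$ with $\|f\|_{W^{1,\infty}}:=\|f\|_{L^\infty}+\|\nabla f\|_{L^\infty}<\infty$. Write $\|u(t,\cdot)\|:=\|u(t,\cdot)\|_{L^2}+\|\sum_{j=1}^d\partial_{x_j}u(t,\cdot)\|_{L^2}+\|\Delta u(t,\cdot)\|_{L^2}$, used as the $H^2$-norm. Moderateness: a net $(f_\varepsilon)_\varepsilon$ is $X$-moderate, for $X\in\{H^1,H^2,W^{1,\infty}\}$, if there is $N\in\mathbb{N}_0$ with $\|f_\varepsilon\|_X\lesssim\varepsilon^{-N}$. A net $(u_\varepsilon)_\varepsilon$ from $C([0,T];H^2(\mathbb{R}^d))\cap C^1([0,T];H^1(\mathbb{R}^d))$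 is $C^1$-moderate if there is $N\in\mathbb{N}_0$ with $\|u_\varepsilon(t,\cdot)\|\lesssim\varepsilon^{-N}$ for all $t\in[0,T]$. Very weak solution: a net $(u_\varepsilon)_\varepsilon$ in $C([0,T];H^1(\mathbb{R}^d))\cap C^1([0,T];L^2(\mathbb{R}^d))$ is a very weak solution if there exist $W^{1,\infty}$-moderate regularisations $h_{i,\varepsilon}$ of $h_i$, an $H^2$-moderate regularisation $u_{0,\varepsilon}$ of $u_0$ and an $H^1$-moderate regularisation $u_{1,\varepsilon}$ of $u_1$ such that, for all $\varepsilon\in(0,1]$, $u_\varepsilon$ solves the regularised problem $$\partial_t^2u_\varepsilon-\sum_{j=1}^{d}\partial_{x_j}\left(h_{j,\varepsilon}(x)\partial_{x_j}u_\varepsilon\right)=0\ \text{ on }[0,T]\times\mathbb{R}^d,\qquad u_\varepsilon(0,x)=u_{0,\varepsilon}(x),\quad \partial_tu_\varepsilon(0,x)=u_{1,\varepsilon}(x),$$ and $(u_\varepsilon)_\varepsilon$ is $C^1$-moderate. Uniqueness: the Cauchy problem has a unique very weak solution if for all families of regularisations $(h_{i,\varepsilon})_\varepsilon,(\tilde h_{i,\varepsilon})_\varepsilon$ of $h_i$ ($i=1,\dots,d$), $(u_{0,\varepsilon})_\varepsilon,(\tilde u_{0,\varepsilon})_\varepsilon$ of $u_0$ and $(u_{1,\varepsilon})_\varepsilon,(\tilde u_{1,\varepsilon})_\varepsilon$ of $u_1$ satisfying $$\|h_{i,\varepsilon}-\tilde h_{i,\varepsilon}\|_{W^{1,\infty}}\le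 C_k\varepsilon^k\ \text{ for all }k>0,\qquad \|u_{0,\varepsilon}-\tilde u_{0,\varepsilon}\|_{H^1}\le C_m\varepsilon^m\ \text{ for all }m>0,\qquad \|u_{1,\varepsilon}-\tilde u_{1,\varepsilon}\|_{L^2}\le C_n\varepsilon^n\ \text{ for all }n>0$$ (constants independent of $\varepsilon$), one has, for all $N>0$, $$\|u_\varepsilon(t,\cdot)-\tilde u_\varepsilon(t,\cdot)\|_{L^2}\le C_N\varepsilon^N$$ for all $t\in[0,T]$ and $\varepsilon\in(0,1]$, with $C_N$ independent of $\varepsilon$ and $t$, where $(u_\varepsilon)_\varepsilon$ and $(\tilde u_\varepsilon)_\varepsilon$ are the families of solutions to the regularised Cauchy problems associated with $(h_{i,\varepsilon},u_{0,\varepsilon},u_{1,\varepsilon})$ and $(\tilde h_{i,\varepsilon},\tilde u_{0,\varepsilon},\tilde u_{1,\varepsilon})$ respectively. The moderateness bounds assumed in the theorem apply to both families of regularisations. *)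

theory Defs
  imports "HOL-Analysis.Analysis" "HOL-Probability.Essential_Supremum"
begin

section \<open>Test functions, distributions and mollification\<close>

definition dir_deriv :: "'a::euclidean_space \<Rightarrow> ('a \<Rightarrow> real) \<Rightarrow> 'a \<Rightarrow> real" where
  "dir_deriv v f x = frechet_derivative f (at x) v"

fun iter_deriv :: "'a::euclidean_space list \<Rightarrow> ('a \<Rightarrow> real) \<Rightarrow> 'a \<Rightarrow> real" where
  "iter_deriv [] f = f"
| "iter_deriv (v # vs) f = dir_deriv v (iter_deriv vs f)"

definition smooth :: "('a::euclidean_space \<Rightarrow> real) \<Rightarrow> bool" where
  "smooth f \<longleftrightarrow> (\<forall>vs\<in>lists Basis. \<forall>x. iter_deriv vs f differentiable (at x))"

definition test_functions :: "('a::euclidean_space \<Rightarrow> real) set" where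
  "test_functions = {\<phi>. smooth \<phi> \<and> compact (closure {x. \<phi> x \<noteq> 0})}"

text \<open>A distribution is a linear functional on the test functions which, on the test functions
  supported in a fixed compact set, is bounded by finitely many derivatives. Its values outside
  \<^const>\<open>test_functions\<close> are irrelevant.\<close>

definition distribution :: "(('a::euclidean_space \<Rightarrow> real) \<Rightarrow> real) \<Rightarrow> bool" where
  "distribution D \<longleftrightarrow>
     (\<forall>\<phi>\<in>test_functions. \<forall>\<eta>\<in>test_functions. \<forall>a b.
        D (\<lambda>x. a * \<phi> x + b * \<eta> x) = a * D \<phi> + b * D \<eta>) \<and>
     (\<forall>K. compact K \<longrightarrow> (\<exists>C m. \<forall>\<phi>\<in>test_functions. \<forall>B.
        {x. \<phi> x \<noteq> 0} \<subseteq> K \<longrightarrow>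
        (\<forall>vs\<in>lists Basis. length vs \<le> m \<longrightarrow> (\<forall>x. \<bar>iter_deriv vs \<phi> x\<bar> \<le> B)) \<longrightarrow>
        \<bar>D \<phi>\<bar> \<le> C * B))"

definition mollifier :: "('a::euclidean_space \<Rightarrow> real) \<Rightarrow> bool" where
  "mollifier \<psi> \<longleftrightarrow>
     \<psi> \<in> test_functions \<and> (\<forall>x. 0 \<le> \<psi> x) \<and> (\<integral>x. \<psi> x \<partial>lborel) = 1"

definition scaled :: "real \<Rightarrow> ('a::euclidean_space \<Rightarrow> real) \<Rightarrow> 'a \<Rightarrow> real" where
  "scaled \<epsilon> \<psi> x = \<psi> (x /\<^sub>R \<epsilon>) / \<epsilon> ^ DIM('a)"

definition convolve ::
    "(('a::euclidean_space \<Rightarrow> real) \<Rightarrow> real) \<Rightarrow> ('a \<Rightarrow> real) \<Rightarrow> 'a \<Rightarrow> real" where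
  "convolve D \<psi> x = D (\<lambda>y. \<psi> (x - y))"

definition regularises ::
    "(real \<Rightarrow> 'a \<Rightarrow> real) \<Rightarrow> (('a::euclidean_space \<Rightarrow> real) \<Rightarrow> real) \<Rightarrow> bool" where
  "regularises f D \<longleftrightarrow>
     (\<exists>\<psi>. mollifier \<psi> \<and> (\<forall>\<epsilon>\<in>{0<..1}. f \<epsilon> = convolve D (scaled \<epsilon> \<psi>)))"


section \<open>Lebesgue and Sobolev spaces\<close>

text \<open>Elements of the spaces are represented by Borel functions; two representatives of the same
  element agree almost everywhere.\<close>

definition L2_space :: "('a::euclidean_space \<Rightarrow> real) set" where
  "L2_space = {f \<in> borel_measurable lborel. integrable lborel (\<lambda>x. (f x)\<^sup>2)}"

definition L2_norm :: "('a::euclidean_space \<Rightarrow> real) \<Rightarrow> real" where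
  "L2_norm f = sqrt (\<integral>x. (f x)\<^sup>2 \<partial>lborel)"

definition Linf_space :: "('a::euclidean_space \<Rightarrow> real) set" where
  "Linf_space = {f \<in> borel_measurable lborel. esssup lborel (\<lambda>x. ereal \<bar>f x\<bar>) < \<infinity>}"

definition Linf_norm :: "('a::euclidean_space \<Rightarrow> real) \<Rightarrow> real" where
  "Linf_norm f = real_of_ereal (esssup lborel (\<lambda>x. ereal \<bar>f x\<bar>))"

definition locally_integrable :: "('a::euclidean_space \<Rightarrow> real) \<Rightarrow> bool" where
  "locally_integrable f \<longleftrightarrow> (\<forall>K. compact K \<longrightarrow> set_integrable lborel K f)"

definition has_weak_deriv ::
    "'a::euclidean_space \<Rightarrow> ('a \<Rightarrow> real) \<Rightarrow> ('a \<Rightarrow> real) \<Rightarrow> bool" where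
  "has_weak_deriv v f g \<longleftrightarrow>
     locally_integrable f \<and> locally_integrable g \<and>
     (\<forall>\<phi>\<in>test_functions.
        (\<integral>x. f x * dir_deriv v \<phi> x \<partial>lborel) = - (\<integral>x. g x * \<phi> x \<partial>lborel))"

definition weakly_differentiable :: "('a::euclidean_space \<Rightarrow> real) \<Rightarrow> bool" where
  "weakly_differentiable f \<longleftrightarrow> (\<forall>b\<in>Basis. \<exists>g. has_weak_deriv b f g)"

text \<open>A representative of the weak derivative, which is unique up to null sets.\<close>

definition weak_deriv :: "'a::euclidean_space \<Rightarrow> ('a \<Rightarrow> real) \<Rightarrow> 'a \<Rightarrow> real" where
  "weak_deriv v f = (SOME g. has_weak_deriv v f g)"

definition weak_grad :: "('a::euclidean_space \<Rightarrow> real) \<Rightarrow> 'a \<Rightarrow> 'a" where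
  "weak_grad f x = (\<Sum>b\<in>Basis. weak_deriv b f x *\<^sub>R b)"

definition W1inf_space :: "('a::euclidean_space \<Rightarrow> real) set" where
  "W1inf_space =
     {f \<in> Linf_space. weakly_differentiable f \<and> (\<lambda>x. norm (weak_grad f x)) \<in> Linf_space}"

definition W1inf_norm :: "('a::euclidean_space \<Rightarrow> real) \<Rightarrow> real" where
  "W1inf_norm f = Linf_norm f + Linf_norm (\<lambda>x. norm (weak_grad f x))"

definition H1_space :: "('a::euclidean_space \<Rightarrow> real) set" where
  "H1_space =
     {f \<in> L2_space. weakly_differentiable f \<and> (\<forall>b\<in>Basis. weak_deriv b f \<in> L2_space)}"

definition H1_norm :: "('a::euclidean_space \<Rightarrow> real) \<Rightarrow> real" where
  "H1_norm f = sqrt ((L2_norm f)\<^sup>2 + (\<Sum>b\<in>Basis. (L2_norm (weak_deriv b f))\<^sup>2))"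

definition H2_space :: "('a::euclidean_space \<Rightarrow> real) set" where
  "H2_space = {f \<in> H1_space. \<forall>b\<in>Basis. weak_deriv b f \<in> H1_space}"

text \<open>The middle term is the norm of the sum of the first-order derivatives, not of the gradient.
  On \<^const>\<open>H2_space\<close> this is nevertheless equivalent to the usual norm, because the first and the
  last term alone already control all derivatives up to order two.\<close>

definition H2_norm :: "('a::euclidean_space \<Rightarrow> real) \<Rightarrow> real" where
  "H2_norm f = L2_norm f + L2_norm (\<lambda>x. \<Sum>b\<in>Basis. weak_deriv b f x)
     + L2_norm (\<lambda>x. \<Sum>b\<in>Basis. weak_deriv b (weak_deriv b f) x)"


section \<open>Continuous and continuously differentiable curves\<close>

text \<open>Here \<open>X\<close> is a function space with norm \<open>nrm\<close>; \<open>C0_curve\<close> and \<open>C1_curve\<close> express membership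
  in $C([0,T];X)$ and $C^1([0,T];X)$.\<close>

definition C0_curve ::
    "real \<Rightarrow> ('a \<Rightarrow> real) set \<Rightarrow> (('a \<Rightarrow> real) \<Rightarrow> real) \<Rightarrow> (real \<Rightarrow> 'a \<Rightarrow> real) \<Rightarrow> bool" where
  "C0_curve T X nrm u \<longleftrightarrow>
     (\<forall>t\<in>{0..T}. u t \<in> X \<and> ((\<lambda>s. nrm (\<lambda>x. u s x - u t x)) \<longlongrightarrow> 0) (at t within {0..T}))"

definition curve_deriv ::
    "real \<Rightarrow> (('a \<Rightarrow> real) \<Rightarrow> real) \<Rightarrow> (real \<Rightarrow> 'a \<Rightarrow> real) \<Rightarrow> (real \<Rightarrow> 'a \<Rightarrow> real) \<Rightarrow> bool" where
  "curve_deriv T nrm u v \<longleftrightarrow>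
     (\<forall>t\<in>{0..T}. ((\<lambda>s. nrm (\<lambda>x. (u s x - u t x) / (s - t) - v t x)) \<longlongrightarrow> 0)
        (at t within {0..T}))"

definition C1_curve ::
    "real \<Rightarrow> ('a \<Rightarrow> real) set \<Rightarrow> (('a \<Rightarrow> real) \<Rightarrow> real) \<Rightarrow> (real \<Rightarrow> 'a \<Rightarrow> real) \<Rightarrow> bool" where
  "C1_curve T X nrm u \<longleftrightarrow>
     C0_curve T X nrm u \<and> (\<exists>v. C0_curve T X nrm v \<and> curve_deriv T nrm u v)"


section \<open>Moderate and negligible nets\<close>

definition moderate_of_order ::
    "nat \<Rightarrow> ('a \<Rightarrow> real) set \<Rightarrow> (('a \<Rightarrow> real) \<Rightarrow> real) \<Rightarrow> (real \<Rightarrow> 'a \<Rightarrow> real) \<Rightarrow> bool" where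
  "moderate_of_order N X nrm f \<longleftrightarrow>
     (\<exists>c>0. \<forall>\<epsilon>\<in>{0<..1}. f \<epsilon> \<in> X \<and> nrm (f \<epsilon>) \<le> c / \<epsilon> ^ N)"

definition moderate ::
    "('a \<Rightarrow> real) set \<Rightarrow> (('a \<Rightarrow> real) \<Rightarrow> real) \<Rightarrow> (real \<Rightarrow> 'a \<Rightarrow> real) \<Rightarrow> bool" where
  "moderate X nrm f \<longleftrightarrow> (\<exists>N. moderate_of_order N X nrm f)"

definition negligible_net ::
    "('a \<Rightarrow> real) set \<Rightarrow> (('a \<Rightarrow> real) \<Rightarrow> real) \<Rightarrow> (real \<Rightarrow> 'a \<Rightarrow> real) \<Rightarrow> bool" where
  "negligible_net X nrm f \<longleftrightarrow>
     (\<forall>k>0. \<exists>C. \<forall>\<epsilon>\<in>{0<..1}. f \<epsilon> \<in> X \<and> nrm (f \<epsilon>) \<le> C * \<epsilon> ^ k)"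

definition C1_moderate :: "real \<Rightarrow> (real \<Rightarrow> real \<Rightarrow> 'a::euclidean_space \<Rightarrow> real) \<Rightarrow> bool" where
  "C1_moderate T u \<longleftrightarrow>
     (\<forall>\<epsilon>\<in>{0<..1}. C0_curve T H2_space H2_norm (u \<epsilon>) \<and> C1_curve T H1_space H1_norm (u \<epsilon>)) \<and>
     (\<exists>N::nat. \<exists>c>0. \<forall>\<epsilon>\<in>{0<..1}. \<forall>t\<in>{0..T}. H2_norm (u \<epsilon> t) \<le> c / \<epsilon> ^ N)"


section \<open>The wave equation\<close>

text \<open>\<open>solves_wave T h v0 v1 u\<close>: the curve \<open>u\<close> in $C([0,T];H^1)\cap C^1([0,T];L^2)$, with derivative
  \<open>u'\<close>, solves $\partial_t^2 u = \sum_j \partial_{x_j}(h_j\,\partial_{x_j}u)$ with initial data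
  \<open>v0\<close>, \<open>v1\<close>. As $\partial_t u$ is only $L^2$-valued, at each time both sides are distributions
  in the space variable: the equation is tested against every \<open>\<phi>\<close>, with the outer space derivative
  moved to \<open>\<phi>\<close>.\<close>

definition solves_wave ::
    "real \<Rightarrow> ('n \<Rightarrow> real^'n::finite \<Rightarrow> real) \<Rightarrow> (real^'n \<Rightarrow> real) \<Rightarrow> (real^'n \<Rightarrow> real)
      \<Rightarrow> (real \<Rightarrow> real^'n \<Rightarrow> real) \<Rightarrow> bool" where
  "solves_wave T h v0 v1 u \<longleftrightarrow>
     C0_curve T H1_space H1_norm u \<and>
     C0_curve T L2_space L2_norm u \<and>
     (\<exists>u'. C0_curve T L2_space L2_norm u' \<and> curve_deriv T L2_norm u u' \<and>
        (\<forall>\<phi>\<in>test_functions. \<forall>t\<in>{0..T}.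
           ((\<lambda>s. \<integral>x. u' s x * \<phi> x \<partial>lborel) has_real_derivative
              - (\<Sum>j\<in>UNIV. \<integral>x. h j x * weak_deriv (axis j 1) (u t) x
                     * dir_deriv (axis j 1) \<phi> x \<partial>lborel)) (at t within {0..T})) \<and>
        (AE x in lborel. u 0 x = v0 x) \<and>
        (AE x in lborel. u' 0 x = v1 x))"


section \<open>Very weak solutions\<close>

type_synonym 'n functional = "(real^'n \<Rightarrow> real) \<Rightarrow> real"
type_synonym 'n net = "real \<Rightarrow> real^'n \<Rightarrow> real"

text \<open>Triples consisting of regularisations of the coefficients and of the two initial data. Each
  of these distributions may be regularised with a mollifier of its own. The coefficients being
  positive means that their regularisations are bounded below, uniformly in \<open>\<epsilon>\<close>.\<close>

definition regularisations ::
    "('n \<Rightarrow> 'n functional) \<Rightarrow> 'n functional \<Rightarrow> 'n functional \<Rightarrow> (('n::finite \<Rightarrow> 'n net) \<times> 'n net \<times> 'n net) set" where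
  "regularisations h u0 u1 = {(h\<epsilon>, u0\<epsilon>, u1\<epsilon>).
     (\<forall>i. regularises (h\<epsilon> i) (h i)) \<and> regularises u0\<epsilon> u0 \<and> regularises u1\<epsilon> u1 \<and>
     (\<exists>c0>0. \<forall>i. \<forall>\<epsilon>\<in>{0<..1}. \<forall>x. c0 \<le> h\<epsilon> i \<epsilon> x)}"

definition solution_family ::
    "real \<Rightarrow> (('n::finite \<Rightarrow> 'n net) \<times> 'n net \<times> 'n net) \<Rightarrow> (real \<Rightarrow> real \<Rightarrow> real^'n \<Rightarrow> real)
      \<Rightarrow> bool" where
  "solution_family T = (\<lambda>(h\<epsilon>, u0\<epsilon>, u1\<epsilon>) u.
     \<forall>\<epsilon>\<in>{0<..1}. solves_wave T (\<lambda>i. h\<epsilon> i \<epsilon>) (u0\<epsilon> \<epsilon>) (u1\<epsilon> \<epsilon>) (u \<epsilon>))"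

definition very_weak_solution ::
    "real \<Rightarrow> ('n::finite \<Rightarrow> 'n functional) \<Rightarrow> 'n functional \<Rightarrow> 'n functional \<Rightarrow> (real \<Rightarrow> real \<Rightarrow> real^'n \<Rightarrow> real)
      \<Rightarrow> bool" where
  "very_weak_solution T h u0 u1 u \<longleftrightarrow>
     (\<exists>h\<epsilon> u0\<epsilon> u1\<epsilon>. (h\<epsilon>, u0\<epsilon>, u1\<epsilon>) \<in> regularisations h u0 u1 \<and>
        (\<forall>i. moderate W1inf_space W1inf_norm (h\<epsilon> i)) \<and>
        moderate H2_space H2_norm u0\<epsilon> \<and>
        moderate H1_space H1_norm u1\<epsilon> \<and>
        solution_family T (h\<epsilon>, u0\<epsilon>, u1\<epsilon>) u \<and> C1_moderate T u)"

text \<open>\<open>\<R>\<close> collects the families of regularisations that are taken into consideration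
  (\<open>\<R> = UNIV\<close> admits all of them).\<close>

definition unique_very_weak_solution ::
    "(('n::finite \<Rightarrow> 'n net) \<times> 'n net \<times> 'n net) set \<Rightarrow>
      real \<Rightarrow> ('n \<Rightarrow> 'n functional) \<Rightarrow> 'n functional \<Rightarrow> 'n functional \<Rightarrow> bool" where
  "unique_very_weak_solution \<R> T h u0 u1 \<longleftrightarrow>
     (\<forall>h\<epsilon> u0\<epsilon> u1\<epsilon> h\<epsilon>' u0\<epsilon>' u1\<epsilon>'.
        (h\<epsilon>, u0\<epsilon>, u1\<epsilon>) \<in> regularisations h u0 u1 \<inter> \<R> \<longrightarrow>
        (h\<epsilon>', u0\<epsilon>', u1\<epsilon>') \<in> regularisations h u0 u1 \<inter> \<R> \<longrightarrow>
        (\<forall>i. negligible_net W1inf_space W1inf_norm (\<lambda>\<epsilon> x. h\<epsilon> i \<epsilon> x - h\<epsilon>' i \<epsilon> x)) \<longrightarrow>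
        negligible_net H1_space H1_norm (\<lambda>\<epsilon> x. u0\<epsilon> \<epsilon> x - u0\<epsilon>' \<epsilon> x) \<longrightarrow>
        negligible_net L2_space L2_norm (\<lambda>\<epsilon> x. u1\<epsilon> \<epsilon> x - u1\<epsilon>' \<epsilon> x) \<longrightarrow>
        (\<forall>u u'. solution_family T (h\<epsilon>, u0\<epsilon>, u1\<epsilon>) u \<longrightarrow>
           solution_family T (h\<epsilon>', u0\<epsilon>', u1\<epsilon>') u' \<longrightarrow>
           (\<forall>N::nat. N > 0 \<longrightarrow> (\<exists>C. \<forall>\<epsilon>\<in>{0<..1}. \<forall>t\<in>{0..T}.
              L2_norm (\<lambda>x. u \<epsilon> t x - u' \<epsilon> t x) \<le> C * \<epsilon> ^ N))))"

end

theory Submission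
  imports Defs
begin

text \<open>For a difference \<open>w = u - v\<close> of weak solutions the numbers \<open>L(s,t) = \<langle>w(s), w(t)\<rangle>\<close>,
  \<open>A(s,t) = a(w(s), w(t))\<close> form scalar kernels on \<open>[0,T]\<^sup>2\<close>, so the energy method can be carried out
  with functions of two real variables and without integrating curves with values in function spaces.
  For a single solution the equation says that \<open>A(s,t) + \<langle>u'(s), u'(t)\<rangle>\<close> is constant on the diagonal,
  which is conservation of energy and bounds the solutions by powers of \<open>1/\<epsilon>\<close>. For the difference,
  whose source \<open>div ((h - k) \<nabla>v)\<close> is only in \<open>H\<^sup>-\<^sup>1\<close>, Ladyzhenskaya's trick of testing with the
  time integral of \<open>w\<close> becomes the statement that \<open>\<parallel>w(t)\<parallel>\<^sup>2 + \<integral>\<^sub>0\<^sup>t \<integral>\<^sub>0\<^sup>t A\<close> has derivative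
  \<open>2 \<langle>w'(0), w(t)\<rangle> - 2 \<integral>\<^sub>0\<^sup>t \<langle>(h - k) \<nabla>v(s), \<nabla>w(t)\<rangle> ds\<close>; the double integral is nonnegative, and the right-hand side
  is a negligible factor times moderate ones. The equation, given for test functions only, may be tested
  with solutions because test functions are dense in \<open>H\<^sup>1\<close>.\<close>

section \<open>Kernels on a square\<close>

text \<open>The velocity need not lie in H^1, so the equation cannot be tested with it, and t ->
  A(t,t) is not known to be differentiable. What is available are the two partial derivatives of
  F(s,t) = <u'(s), u(t)>: the equation gives one, the definition of u' the other. Freezing one time
  while differentiating in the other is what kernels of two variables make possible; constancy on
  the diagonal is then recovered from averages over small squares. The families compared are
  arbitrary solutions of the regularised problems, so their growth in 1/\<epsilon> has to be derived
  from the data alone. A second obstacle is that \<open>weak_deriv\<close> is a choice of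
  representative: even its additivity holds only almost everywhere and rests on uniqueness of weak
  derivatives. Both this uniqueness and the density of test functions are derived from an
  approximate identity, which is built from the mollifier that a family of regularisations carries
  with it.\<close>

lemma tendsto_zero_within:
  fixes f g :: "'a::topological_space \<Rightarrow> real"
  assumes "(g \<longlongrightarrow> 0) (at t within S)" "\<And>s. s \<in> S \<Longrightarrow> \<bar>f s\<bar> \<le> g s"
  shows "(f \<longlongrightarrow> 0) (at t within S)"
  by (rule Lim_null_comparison[OF _ assms(1)]) (simp add: eventually_at_filter assms(2))

lemma tendsto_zero_sequentially:
  fixes f g :: "nat \<Rightarrow> real"
  assumes "g \<longlonglongrightarrow> 0" "\<And>k. \<bar>f k\<bar> \<le> g k"
  shows "f \<longlonglongrightarrow> 0"
  by (rule Lim_null_comparison[OF _ assms(1)]) (simp add: assms(2))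

lemma continuous_on_section:
  assumes "continuous_on (S \<times> U) (\<lambda>(p, q). A p q)"
  shows "p \<in> S \<Longrightarrow> continuous_on U (A p)" and "q \<in> U \<Longrightarrow> continuous_on S (\<lambda>p. A p q)"
proof -
  assume "p \<in> S"
  then show "continuous_on U (A p)"
    using continuous_on_compose2[OF assms, of U "\<lambda>q. (p, q)"] by (force intro: continuous_on_Pair continuous_on_const continuous_on_id)
next
  assume "q \<in> U"
  then show "continuous_on S (\<lambda>p. A p q)"
    using continuous_on_compose2[OF assms, of S "\<lambda>p. (p, q)"] by (force intro: continuous_on_Pair continuous_on_const continuous_on_id)
qed

lemma continuous_on_section_integral:
  fixes A :: "real \<Rightarrow> real \<Rightarrow> real"
  assumes "continuous_on ({a..b} \<times> {c..d}) (\<lambda>(p, q). A p q)" "{y..z} \<subseteq> {c..d}"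
  shows "continuous_on {a..b} (\<lambda>p. integral {y..z} (A p))"
proof -
  have "continuous_on ({a..b} \<times> cbox y z) (\<lambda>(p, q). A p q)"
    using assms by (auto elim!: continuous_on_subset)
  then show ?thesis using integral_continuous_on_param[of "{a..b}" y z A] by simp
qed

text \<open>Lipschitz dependence on the upper limit, uniform in \<open>y\<close>, combined with
  continuity in \<open>y\<close> for a fixed upper limit. The integral is a partial derivative of
  the double integral below, and its joint continuity yields total differentiability.\<close>

lemma continuous_on_triangle_integral:
  fixes A :: "real \<Rightarrow> real \<Rightarrow> real"
  assumes cont: "continuous_on ({0..T} \<times> {0..T}) (\<lambda>(p, q). A p q)"
  shows "continuous_on ({0..T} \<times> {0..T}) (\<lambda>(x, y). integral {0..x} (\<lambda>p. A p y))"
proof (clarsimp simp: continuous_on_def)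
  fix x y assume xy: "0 \<le> x" "x \<le> T" "0 \<le> y" "y \<le> T"
  have "compact ((\<lambda>(p, q). A p q) ` ({0..T} \<times> {0..T}))"
    using cont by (intro compact_continuous_image compact_Times) auto
  then obtain M where M: "\<And>p q. p \<in> {0..T} \<Longrightarrow> q \<in> {0..T} \<Longrightarrow> \<bar>A p q\<bar> \<le> M"
    by (fastforce dest!: compact_imp_bounded simp: bounded_iff)
  have "0 \<le> M" using M[of x y] xy by auto
  have int: "(\<lambda>p. A p q) integrable_on {u..v}" if "q \<in> {0..T}" "{u..v} \<subseteq> {0..T}" for q u v
    using continuous_on_section(2)[OF cont that(1)] that(2)
    by (meson continuous_on_subset integrable_continuous_real)
  have bnd: "\<bar>integral {u..v} (\<lambda>p. A p q)\<bar> \<le> M * \<bar>v - u\<bar>"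
    if "q \<in> {0..T}" "{u..v} \<subseteq> {0..T}" for q u v
  \<comment> \<open>A reversed interval \<open>{u..v}\<close> is empty and its integral is 0, so
    only \<open>0 \<le> M\<close> matters in the other case.\<close>
  proof (cases "u \<le> v")
    case True
    then show ?thesis
      using integral_bound[of u v "\<lambda>p. A p q" M] that M continuous_on_section(2)[OF cont that(1)]
      by (auto simp: continuous_on_subset subset_iff)
  qed (use \<open>0 \<le> M\<close> in auto)
  have diff: "\<bar>integral {0..x'} (\<lambda>p. A p q) - integral {0..x} (\<lambda>p. A p q)\<bar> \<le> M * \<bar>x' - x\<bar>"
    if "q \<in> {0..T}" "x' \<in> {0..T}" for x' q
  proof (cases "x \<le> x'")
    case True
    then have "integral {0..x} (\<lambda>p. A p q) + integral {x..x'} (\<lambda>p. A p q) = integral {0..x'} (\<lambda>p. A p q)"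
      using that xy by (intro Henstock_Kurzweil_Integration.integral_combine int) auto
    then show ?thesis using bnd[of q x x'] that xy True by auto
  next
    case False
    then have "integral {0..x'} (\<lambda>p. A p q) + integral {x'..x} (\<lambda>p. A p q) = integral {0..x} (\<lambda>p. A p q)"
      using that xy by (intro Henstock_Kurzweil_Integration.integral_combine int) auto
    then show ?thesis using bnd[of q x' x] that xy False by auto
  qed
  let ?F = "at (x, y) within {0..T} \<times> {0..T}"
  have "((\<lambda>z. M * \<bar>fst z - x\<bar>) \<longlongrightarrow> M * \<bar>fst (x, y) - x\<bar>) ?F"
    by (intro tendsto_mult_left tendsto_rabs tendsto_diff tendsto_fst tendsto_ident_at tendsto_const)
  then have "((\<lambda>z. M * \<bar>fst z - x\<bar>) \<longlongrightarrow> 0) ?F" by simp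
  then have "((\<lambda>z. integral {0..fst z} (\<lambda>p. A p (snd z)) - integral {0..x} (\<lambda>p. A p (snd z))) \<longlongrightarrow> 0) ?F"
    by (rule tendsto_zero_within) (use diff in auto)
  moreover have "continuous_on ({0..T} \<times> {0..T}) (\<lambda>z. integral {0..x} (\<lambda>p. A p (snd z)))"
  proof -
    have "continuous_on {0..T} (\<lambda>y. integral {0..x} (\<lambda>p. A p y))"
      using continuous_on_section_integral[OF continuous_on_swap_args[OF cont], of 0 x] xy by auto
    then show ?thesis
      by (rule continuous_on_compose2) (auto intro!: continuous_intros)
  qed
  then have "((\<lambda>z. integral {0..x} (\<lambda>p. A p (snd z))) \<longlongrightarrow> integral {0..x} (\<lambda>p. A p y)) ?F"
    using xy by (auto simp: continuous_on_def)
  ultimately have "((\<lambda>z. integral {0..fst z} (\<lambda>p. A p (snd z))) \<longlongrightarrow> integral {0..x} (\<lambda>p. A p y)) ?F"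
    using tendsto_add by fastforce
  then show "((\<lambda>(x, y). integral {0..x} (\<lambda>p. A p y)) \<longlongrightarrow> integral {0..x} (\<lambda>p. A p y)) ?F"
    by (simp add: case_prod_unfold)
qed

text \<open>For \<open>A p q\<close> = a(w(p), w(q)) this stands for a(W(x), W(y)), where W is the
  primitive of w; the vector-valued integral W itself is never formed.\<close>

definition kernel_integral :: "(real \<Rightarrow> real \<Rightarrow> real) \<Rightarrow> real \<Rightarrow> real \<Rightarrow> real" where
  "kernel_integral A x y = integral {0..x} (\<lambda>p. integral {0..y} (A p))"

lemma kernel_integral_has_derivative:
  assumes cont: "continuous_on ({0..T} \<times> {0..T}) (\<lambda>(p, q). A p q)"
    and x: "x \<in> {0..T}" and y: "y \<in> {0..T}"
  shows "((\<lambda>(x, y). kernel_integral A x y) has_derivative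
           (\<lambda>(h, k). h * integral {0..y} (A x) + k * integral {0..x} (\<lambda>p. A p y)))
         (at (x, y) within {0..T} \<times> {0..T})"
proof -
  \<comment> \<open>The second partial derivative is written as a bounded linear map because
    \<open>has_derivative_partialsI\<close> asks for its continuity in operator norm; the first one
    is needed only at the point itself.\<close>
  define fy where "fy x y = blinfun_scaleR_left (integral {0..x} (\<lambda>p. A p y))" for x y :: real
  have "((\<lambda>(x, y). kernel_integral A x y) has_derivative
           (\<lambda>(h, k). h * integral {0..y} (A x) + blinfun_apply (fy x y) k))
         (at (x, y) within {0..T} \<times> {0..T})"
  proof (rule has_derivative_partialsI)
    have "continuous_on {0..T} (\<lambda>p. integral {0..y} (A p))"
      by (rule continuous_on_section_integral[OF cont]) (use y in auto)
    from integral_has_real_derivative[OF this x]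
    show "((\<lambda>x. kernel_integral A x y) has_derivative (\<lambda>h. h * integral {0..y} (A x))) (at x within {0..T})"
      by (simp add: has_field_derivative_def kernel_integral_def mult_commute_abs)
  next
    fix x y assume xy: "x \<in> {0..T}" "y \<in> {0..T}"
    \<comment> \<open>The outer integral runs over the first variable. Exchanging the order lets the
      fundamental theorem act on the second.\<close>
    have swap: "kernel_integral A x y = integral {0..y} (\<lambda>q. integral {0..x} (\<lambda>p. A p q))"
      if "y \<in> {0..T}" for y
    proof -
      have "continuous_on (cbox (0, 0) (x, y)) (\<lambda>(p, q). A p q)"
        by (rule continuous_on_subset[OF cont]) (use xy that in auto)
      from integral_swap_continuous[OF this] show ?thesis by (simp add: kernel_integral_def)
    qed
    have "continuous_on {0..T} (\<lambda>q. integral {0..x} (\<lambda>p. A p q))"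
      by (rule continuous_on_section_integral[OF continuous_on_swap_args[OF cont]]) (use xy in auto)
    from integral_has_real_derivative[OF this xy(2)]
    have "((\<lambda>y. integral {0..y} (\<lambda>q. integral {0..x} (\<lambda>p. A p q))) has_derivative blinfun_apply (fy x y)) (at y within {0..T})"
      by (simp add: has_field_derivative_def fy_def mult.commute mult_commute_abs)
    then show "(kernel_integral A x has_derivative blinfun_apply (fy x y)) (at y within {0..T})"
      by (rule has_derivative_transform[rotated 2]) (use xy swap in auto)
  next
    have "continuous_on ({0..T} \<times> {0..T}) (\<lambda>z. blinfun_scaleR_left (integral {0..fst z} (\<lambda>p. A p (snd z))) :: real \<Rightarrow>\<^sub>L real)"
      using continuous_on_triangle_integral[OF cont]
      by (intro bounded_linear.continuous_on[OF bounded_linear_blinfun_scaleR_left]) (simp add: case_prod_unfold)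
    then show "continuous (at (x, y) within {0..T} \<times> {0..T}) (\<lambda>(x, y). fy x y)"
      using x y by (auto simp: continuous_on_eq_continuous_within fy_def case_prod_unfold)
  qed (use y in auto)
  then show ?thesis by (simp add: fy_def)
qed

text \<open>Both arguments move with unit speed, so the partial derivatives simply add. The shifts
  \<open>a\<close> and \<open>b\<close> let all four corners of a square sliding along the diagonal
  be treated alike.\<close>

lemma kernel_integral_path_derivative:
  assumes cont: "continuous_on ({0..T} \<times> {0..T}) (\<lambda>(p, q). A p q)"
    and "\<And>t. t \<in> S \<Longrightarrow> t + a \<in> {0..T}" "\<And>t. t \<in> S \<Longrightarrow> t + b \<in> {0..T}" "t \<in> S"
  shows "((\<lambda>t. kernel_integral A (t + a) (t + b)) has_real_derivative
           integral {0..t + b} (A (t + a)) + integral {0..t + a} (\<lambda>p. A p (t + b))) (at t within S)"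
proof -
  have "((\<lambda>t. (t + a, t + b)) has_derivative (\<lambda>h. (h, h))) (at t within S)"
    by (auto intro!: derivative_eq_intros)
  moreover have "((\<lambda>(x, y). kernel_integral A x y) has_derivative
           (\<lambda>(h, k). h * integral {0..t + b} (A (t + a)) + k * integral {0..t + a} (\<lambda>p. A p (t + b))))
         (at (t + a, t + b) within (\<lambda>t. (t + a, t + b)) ` S)"
    by (rule has_derivative_subset[OF kernel_integral_has_derivative[OF cont]]) (use assms in auto)
  ultimately have "((\<lambda>t. kernel_integral A (t + a) (t + b)) has_derivative
      (\<lambda>h. h * integral {0..t + b} (A (t + a)) + h * integral {0..t + a} (\<lambda>p. A p (t + b)))) (at t within S)"
    by (auto dest: has_derivative_in_compose simp: case_prod_unfold)
  then show ?thesis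
    by (simp add: has_field_derivative_def mult_commute_abs flip: distrib_left)
qed


section \<open>Conservation laws: kernels that are constant on the diagonal\<close>

lemma integral_near_const:
  fixes f :: "real \<Rightarrow> real"
  assumes "a \<le> b" "continuous_on {a..b} f" "\<And>x. x \<in> {a..b} \<Longrightarrow> \<bar>f x - c\<bar> \<le> e"
  shows "\<bar>integral {a..b} f - (b - a) * c\<bar> \<le> e * (b - a)"
proof -
  have "integral {a..b} (\<lambda>x. f x - c) = integral {a..b} f - (b - a) * c"
    using assms by (subst integral_diff) (auto intro: integrable_continuous_real)
  moreover have "\<bar>integral {a..b} (\<lambda>x. f x - c)\<bar> \<le> e * (b - a)"
    using integral_bound[of a b "\<lambda>x. f x - c" e] continuous_on_diff[OF assms(2) continuous_on_const[of _ c]] assms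
    by simp
  ultimately show ?thesis by simp
qed

text \<open>Inclusion-exclusion over the four rectangles anchored at the origin. It turns the
  integral over a moving square into terms whose derivative along the diagonal is known.\<close>

lemma kernel_integral_square:
  assumes cont: "continuous_on ({0..T} \<times> {0..T}) (\<lambda>(p, q). A p q)" and ab: "0 \<le> a" "a \<le> b" "b \<le> T"
  shows "kernel_integral A b b - kernel_integral A a b - kernel_integral A b a + kernel_integral A a a
    = integral {a..b} (\<lambda>p. integral {a..b} (A p))"
proof -
  have ci: "continuous_on {a..b} (\<lambda>p. integral {u..v} (A p))" if "{u..v} \<subseteq> {0..T}" for u v
    by (rule continuous_on_subset[OF continuous_on_section_integral[OF cont that]]) (use ab in auto)
  have K: "kernel_integral A b y - kernel_integral A a y = integral {a..b} (\<lambda>p. integral {0..y} (A p))"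
    if "y \<in> {0..T}" for y
  proof -
    have "continuous_on {0..b} (\<lambda>p. integral {0..y} (A p))"
      by (rule continuous_on_subset[OF continuous_on_section_integral[OF cont]]) (use that ab in auto)
    from Henstock_Kurzweil_Integration.integral_combine[OF ab(1,2) integrable_continuous_real[OF this]]
    show ?thesis by (simp add: kernel_integral_def)
  qed
  have "integral {0..b} (A p) - integral {0..a} (A p) = integral {a..b} (A p)" if "p \<in> {a..b}" for p
  proof -
    have "continuous_on {0..b} (A p)"
      by (rule continuous_on_subset[OF continuous_on_section(1)[OF cont]]) (use that ab in auto)
    from Henstock_Kurzweil_Integration.integral_combine[OF ab(1,2) integrable_continuous_real[OF this]]
    show ?thesis by simp
  qed
  then have "integral {a..b} (\<lambda>p. integral {a..b} (A p))
    = integral {a..b} (\<lambda>p. integral {0..b} (A p) - integral {0..a} (A p))"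
    by (intro integral_cong) simp
  also have "\<dots> = integral {a..b} (\<lambda>p. integral {0..b} (A p)) - integral {a..b} (\<lambda>p. integral {0..a} (A p))"
    using ab by (intro integral_diff integrable_continuous_real ci) auto
  finally show ?thesis using K[of b] K[of a] ab by simp
qed

text \<open>\<open>S\<close> is merely continuous, so its diagonal cannot be differentiated
  directly. The hypothesis \<open>zero\<close> is the substitute: when a square slides along the
  diagonal, what it gains along its leading sides equals what it loses along the trailing
  ones.\<close>

lemma kernel_diagonal_constant:
  fixes S :: "real \<Rightarrow> real \<Rightarrow> real"
  assumes cont: "continuous_on ({0..T} \<times> {0..T}) (\<lambda>(p, q). S p q)"
    and sym: "\<And>p q. p \<in> {0..T} \<Longrightarrow> q \<in> {0..T} \<Longrightarrow> S p q = S q p"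
    and zero: "\<And>a b. 0 \<le> a \<Longrightarrow> a \<le> b \<Longrightarrow> b \<le> T \<Longrightarrow> integral {a..b} (\<lambda>p. S p b) = integral {a..b} (\<lambda>p. S p a)"
    and t: "t \<in> {0..T}"
  shows "S t t = S 0 0"
proof -
  \<comment> \<open>\<open>Q \<delta> \<tau>\<close> does not depend on \<open>\<tau>\<close> by the hypothesis \<open>zero\<close>, and \<open>Q \<delta> \<tau> / \<delta>\<^sup>2\<close> tends to \<open>S \<tau> \<tau>\<close>.\<close>
  define Q where "Q \<delta> \<tau> = integral {\<tau>..\<tau> + \<delta>} (\<lambda>p. integral {\<tau>..\<tau> + \<delta>} (S p))" for \<delta> \<tau>
  have Q_const: "Q \<delta> \<tau> = Q \<delta> 0" if "0 \<le> \<tau>" "\<tau> + \<delta> \<le> T" "0 < \<delta>" for \<tau> \<delta>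
  proof -
    \<comment> \<open>Corner form of \<open>Q \<delta>\<close>. The shifts \<open>+ 0\<close> are
      written out so that every corner has the shape of the path derivative.\<close>
    define N where "N \<tau> = kernel_integral S (\<tau> + \<delta>) (\<tau> + \<delta>) - kernel_integral S (\<tau> + 0) (\<tau> + \<delta>)
        - kernel_integral S (\<tau> + \<delta>) (\<tau> + 0) + kernel_integral S (\<tau> + 0) (\<tau> + 0)" for \<tau>
    have "(N has_real_derivative 0) (at \<tau> within {0..T - \<delta>})" if \<tau>: "\<tau> \<in> {0..T - \<delta>}" for \<tau>
    proof -
      let ?a = "\<tau>" and ?b = "\<tau> + \<delta>"
      have ab: "0 \<le> ?a" "?a \<le> ?b" "?b \<le> T" using \<tau> \<open>0 < \<delta>\<close> by auto
      have D: "((\<lambda>t. kernel_integral S (t + a) (t + b)) has_real_derivative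
           integral {0..\<tau> + b} (S (\<tau> + a)) + integral {0..\<tau> + a} (\<lambda>p. S p (\<tau> + b))) (at \<tau> within {0..T - \<delta>})"
        if "a \<in> {0, \<delta>}" "b \<in> {0, \<delta>}" for a b
        by (rule kernel_integral_path_derivative[OF cont]) (use that \<tau> \<open>0 < \<delta>\<close> in auto)
      have S: "integral {0..y} (S x) = integral {0..y} (\<lambda>p. S p x)" if "x \<in> {0..T}" "y \<in> {0..T}" for x y
        using that sym by (intro integral_cong) auto
      have comb: "integral {0..?b} (\<lambda>p. S p x) - integral {0..?a} (\<lambda>p. S p x) = integral {?a..?b} (\<lambda>p. S p x)"
        if "x \<in> {0..T}" for x
      proof -
        have "continuous_on {0..?b} (\<lambda>p. S p x)"
          by (rule continuous_on_subset[OF continuous_on_section(2)[OF cont that]]) (use ab in auto)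
        from Henstock_Kurzweil_Integration.integral_combine[OF ab(1,2) integrable_continuous_real[OF this]]
        show ?thesis by simp
      qed
      \<comment> \<open>By symmetry the four brackets reduce to twice the difference of the
        integrals of \<open>S p ?b\<close> and \<open>S p ?a\<close> over \<open>{?a..?b}\<close>,
        which is zero by hypothesis.\<close>
      have "(N has_real_derivative
          (integral {0..?b} (S ?b) + integral {0..?b} (\<lambda>p. S p ?b))
          - (integral {0..?b} (S ?a) + integral {0..?a} (\<lambda>p. S p ?b))
          - (integral {0..?a} (S ?b) + integral {0..?b} (\<lambda>p. S p ?a))
          + (integral {0..?a} (S ?a) + integral {0..?a} (\<lambda>p. S p ?a))) (at \<tau> within {0..T - \<delta>})"
        unfolding N_def using D[of \<delta> \<delta>] D[of 0 \<delta>] D[of \<delta> 0] D[of 0 0]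
        by (intro DERIV_add DERIV_diff) auto
      then show ?thesis
        using S[of ?a ?a] S[of ?a ?b] S[of ?b ?a] S[of ?b ?b] comb[of ?a] comb[of ?b] zero[OF ab] ab
        by (simp add: algebra_simps)
    qed
    then have "\<exists>c. \<forall>\<tau>\<in>{0..T - \<delta>}. N \<tau> = c"
      by (intro has_field_derivative_zero_constant) auto
    then have "N \<tau> = N 0" using that by force
    moreover have "N \<tau> = Q \<delta> \<tau>" if "0 \<le> \<tau>" "\<tau> + \<delta> \<le> T" for \<tau>
      using kernel_integral_square[OF cont, of \<tau> "\<tau> + \<delta>"] that \<open>0 < \<delta>\<close> by (simp add: N_def Q_def)
    ultimately show ?thesis using that by auto
  qed
  have close: "\<exists>d>0. \<forall>\<delta>. 0 < \<delta> \<and> \<delta> < d \<and> \<tau> + \<delta> \<le> T \<longrightarrow> \<bar>Q \<delta> \<tau> - \<delta>\<^sup>2 * S \<tau> \<tau>\<bar> \<le> e * \<delta>\<^sup>2"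
    if "e > 0" "\<tau> \<in> {0..T}" for e \<tau>
  proof -
    have "(\<tau>, \<tau>) \<in> {0..T} \<times> {0..T}" using that by auto
    from continuous_onE[OF cont this \<open>e > 0\<close>]
    obtain d where "d > 0" and d: "\<And>z. z \<in> {0..T} \<times> {0..T} \<Longrightarrow> dist z (\<tau>, \<tau>) \<le> d \<Longrightarrow>
        dist (case z of (p, q) \<Rightarrow> S p q) (case (\<tau>, \<tau>) of (p, q) \<Rightarrow> S p q) < e"
      by blast
    show ?thesis
    proof (intro exI[of _ "d / 2"] conjI allI impI)
      fix \<delta> assume \<delta>: "0 < \<delta> \<and> \<delta> < d / 2 \<and> \<tau> + \<delta> \<le> T"
      have near: "\<bar>S p q - S \<tau> \<tau>\<bar> \<le> e" if "p \<in> {\<tau>..\<tau> + \<delta>}" "q \<in> {\<tau>..\<tau> + \<delta>}" for p q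
      proof -
        have "dist (p, q) (\<tau>, \<tau>) \<le> dist p \<tau> + dist q \<tau>"
          by (simp add: dist_Pair_Pair sqrt_sum_squares_le_sum)
        also have "\<dots> < d" using that \<delta> by (auto simp: dist_real_def)
        finally show ?thesis using d[of "(p, q)"] that \<delta> \<open>\<tau> \<in> _\<close> by (auto simp: dist_real_def)
      qed
      have inner: "\<bar>integral {\<tau>..\<tau> + \<delta>} (S p) - (\<tau> + \<delta> - \<tau>) * S \<tau> \<tau>\<bar> \<le> e * (\<tau> + \<delta> - \<tau>)" if "p \<in> {\<tau>..\<tau> + \<delta>}" for p
        by (intro integral_near_const near that continuous_on_subset[OF continuous_on_section(1)[OF cont]])
           (use that \<delta> \<open>\<tau> \<in> _\<close> in auto)
      have "\<bar>Q \<delta> \<tau> - (\<tau> + \<delta> - \<tau>) * ((\<tau> + \<delta> - \<tau>) * S \<tau> \<tau>)\<bar> \<le> (e * (\<tau> + \<delta> - \<tau>)) * (\<tau> + \<delta> - \<tau>)"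
        unfolding Q_def
        by (intro integral_near_const inner continuous_on_subset[OF continuous_on_section_integral[OF cont]])
           (use \<delta> \<open>\<tau> \<in> _\<close> in auto)
      then show "\<bar>Q \<delta> \<tau> - \<delta>\<^sup>2 * S \<tau> \<tau>\<bar> \<le> e * \<delta>\<^sup>2" by (simp add: power2_eq_square mult.assoc)
    qed (use \<open>d > 0\<close> in auto)
  qed
  \<comment> \<open>A square with lower corner \<open>\<tau>\<close> must fit below
    \<open>T\<close>, so the end point is excluded here and recovered by continuity
    afterwards.\<close>
  have main: "S \<tau> \<tau> = S 0 0" if \<tau>: "\<tau> \<in> {0..<T}" for \<tau>
  proof -
    have "\<bar>S \<tau> \<tau> - S 0 0\<bar> \<le> e" if e: "e > 0" for e
    proof -
      have "e / 2 > 0" "\<tau> \<in> {0..T}" "0 \<in> {0..T}" using e \<tau> by auto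
      note close = close[OF this(1,2)] close[OF this(1,3)]
      obtain d1 where d1: "d1 > 0" "\<And>\<delta>. 0 < \<delta> \<Longrightarrow> \<delta> < d1 \<Longrightarrow> \<tau> + \<delta> \<le> T \<Longrightarrow> \<bar>Q \<delta> \<tau> - \<delta>\<^sup>2 * S \<tau> \<tau>\<bar> \<le> (e/2) * \<delta>\<^sup>2"
        using close(1) by blast
      obtain d2 where d2: "d2 > 0" "\<And>\<delta>. 0 < \<delta> \<Longrightarrow> \<delta> < d2 \<Longrightarrow> 0 + \<delta> \<le> T \<Longrightarrow> \<bar>Q \<delta> 0 - \<delta>\<^sup>2 * S 0 0\<bar> \<le> (e/2) * \<delta>\<^sup>2"
        using close(2) by blast
      define \<delta> where "\<delta> = min (min d1 d2) (T - \<tau>) / 2"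
      have \<delta>: "0 < \<delta>" "\<delta> < d1" "\<delta> < d2" "\<tau> + \<delta> \<le> T" using d1 d2 \<tau> by (auto simp: \<delta>_def min_def field_simps)
      have "\<bar>\<delta>\<^sup>2 * S \<tau> \<tau> - \<delta>\<^sup>2 * S 0 0\<bar> \<le> e * \<delta>\<^sup>2"
      proof -
        have "e * \<delta>\<^sup>2 = e/2 * \<delta>\<^sup>2 + e/2 * \<delta>\<^sup>2" by simp
        moreover have "Q \<delta> \<tau> = Q \<delta> 0" by (rule Q_const) (use \<delta> \<tau> in auto)
        moreover have "\<bar>Q \<delta> \<tau> - \<delta>\<^sup>2 * S \<tau> \<tau>\<bar> \<le> e/2 * \<delta>\<^sup>2" "\<bar>Q \<delta> 0 - \<delta>\<^sup>2 * S 0 0\<bar> \<le> e/2 * \<delta>\<^sup>2"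
          using d1(2)[of \<delta>] d2(2)[of \<delta>] \<delta> \<tau> by auto
        ultimately show ?thesis by linarith
      qed
      then have "\<delta>\<^sup>2 * \<bar>S \<tau> \<tau> - S 0 0\<bar> \<le> \<delta>\<^sup>2 * e"
        by (simp add: abs_mult mult.commute[of e] flip: right_diff_distrib)
      then show ?thesis using \<delta>(1) by simp
    qed
    then show ?thesis by (metis abs_le_zero_iff field_le_epsilon add_0 right_minus_eq)
  qed
  show ?thesis
  proof (cases "t < T")
    case False
    show ?thesis
    proof (cases "0 < T")
      case True
      have "continuous_on {0..T} (\<lambda>\<tau>. S \<tau> \<tau>)"
        using continuous_on_compose2[OF cont continuous_on_Pair[OF continuous_on_id continuous_on_id], of "{0..T}"]
        by (simp add: image_subset_iff)
      moreover have "closure {0..<T} = {0..T}" using True by simp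
      ultimately have cont_diag: "continuous_on (closure {0..<T}) (\<lambda>\<tau>. S \<tau> \<tau>)" by simp
      show ?thesis
        by (rule continuous_constant_on_closure[OF cont_diag main]) (use t True in auto)
    qed (use False t in auto)
  qed (rule main, use t in auto)
qed

text \<open>The intended \<open>F s t\<close> is <u'(s), u(t)>. By the fundamental theorem, the
  integral of \<open>A p c + G p c\<close> over \<open>{a..b}\<close> is
  \<open>F a c - F b c + F c b - F c a\<close>; for \<open>c = a\<close> and for
  \<open>c = b\<close> this is \<open>F a b - F b a\<close>. Only one variable of \<open>F\<close>
  is differentiated at a time.\<close>

lemma wave_kernel_energy:
  fixes A G F :: "real \<Rightarrow> real \<Rightarrow> real"
  assumes A: "continuous_on ({0..T} \<times> {0..T}) (\<lambda>(p, q). A p q)"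
    and G: "continuous_on ({0..T} \<times> {0..T}) (\<lambda>(p, q). G p q)"
    and sym: "\<And>p q. p \<in> {0..T} \<Longrightarrow> q \<in> {0..T} \<Longrightarrow> A p q = A q p"
      "\<And>p q. p \<in> {0..T} \<Longrightarrow> q \<in> {0..T} \<Longrightarrow> G p q = G q p"
    and FA: "\<And>s t. s \<in> {0..T} \<Longrightarrow> t \<in> {0..T} \<Longrightarrow> ((\<lambda>s. F s t) has_real_derivative - A s t) (at s within {0..T})"
    and FG: "\<And>s t. s \<in> {0..T} \<Longrightarrow> t \<in> {0..T} \<Longrightarrow> (F s has_real_derivative G s t) (at t within {0..T})"
    and t: "t \<in> {0..T}"
  shows "A t t + G t t = A 0 0 + G 0 0"
proof (rule kernel_diagonal_constant[where S = "\<lambda>p q. A p q + G p q", OF _ _ _ t])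
  show "continuous_on ({0..T} \<times> {0..T}) (\<lambda>(p, q). A p q + G p q)"
    using continuous_on_add[OF A G] by (simp add: case_prod_unfold)
  fix a b assume ab: "0 \<le> a" "a \<le> b" "b \<le> T"
  have IA: "((\<lambda>p. A p c) has_integral - F b c - - F a c) {a..b}" if "c \<in> {0..T}" for c
  proof (rule fundamental_theorem_of_calculus)
    fix p assume "p \<in> {a..b}"
    then have "((\<lambda>s. F s c) has_real_derivative - A p c) (at p within {a..b})"
      using that ab by (intro DERIV_subset[OF FA]) auto
    then show "((\<lambda>p. - F p c) has_vector_derivative A p c) (at p within {a..b})"
      using DERIV_minus by (fastforce simp flip: has_real_derivative_iff_has_vector_derivative)
  qed (use ab in auto)
  \<comment> \<open>\<open>F\<close> yields the integral of \<open>G\<close> in its second argument;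
    symmetry of \<open>G\<close> moves it to the first, where \<open>A\<close> is
    integrated.\<close>
  have IG: "((\<lambda>p. G p c) has_integral F c b - F c a) {a..b}" if "c \<in> {0..T}" for c
  proof -
    have "(G c has_integral F c b - F c a) {a..b}"
    proof (rule fundamental_theorem_of_calculus)
      fix p assume "p \<in> {a..b}"
      then show "(F c has_vector_derivative G c p) (at p within {a..b})"
        using DERIV_subset[OF FG[OF that, of p], of "{a..b}"] ab
        by (simp flip: has_real_derivative_iff_has_vector_derivative)
    qed (use ab in auto)
    then show ?thesis
      by (rule has_integral_eq[rotated]) (use sym(2) that ab in auto)
  qed
  have "((\<lambda>p. A p c + G p c) has_integral - F b c - - F a c + (F c b - F c a)) {a..b}" if "c \<in> {0..T}" for c
    using has_integral_add[OF IA IG] that by simp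
  from this[of a] this[of b] show "integral {a..b} (\<lambda>p. A p b + G p b) = integral {a..b} (\<lambda>p. A p a + G p a)"
    using ab by (simp add: integral_unique)
qed (use sym in auto)

section \<open>Positive definite kernels and the estimate with a source\<close>

lemma riemann_sum_error:
  fixes f :: "real \<Rightarrow> real" and x :: real and n :: nat
  assumes "continuous_on {0..x} f" "0 \<le> x" "n > 0"
    and near: "\<And>p q. p \<in> {0..x} \<Longrightarrow> q \<in> {0..x} \<Longrightarrow> \<bar>p - q\<bar> \<le> x / n \<Longrightarrow> \<bar>f p - f q\<bar> \<le> e"
  shows "\<bar>integral {0..x} f - x / n * (\<Sum>i<n. f (x * i / n))\<bar> \<le> e * x"
proof -
  \<comment> \<open>Generalised to the first \<open>m\<close> panels for induction: each panel of
    length \<open>x / n\<close> contributes at most \<open>e * (x / n)\<close> to the error.\<close>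
  have "\<bar>integral {0..x * m / n} f - x / n * (\<Sum>i<m. f (x * i / n))\<bar> \<le> e * (x * m / n)" if "m \<le> n" for m :: nat
    using that
  proof (induction m)
    case (Suc m)
    let ?a = "x * m / n" and ?b = "x * Suc m / n"
    have "x * real (Suc m) \<le> x * real n"
      using Suc.prems assms(2) by (intro mult_left_mono) auto
    then have ab: "0 \<le> ?a" "?a \<le> ?b" "?b \<le> x" and ba: "?b - ?a = x / n"
      using assms Suc.prems by (auto simp: divide_simps mult_left_mono mult_mono' algebra_simps)
    have "continuous_on {0..?b} f" by (rule continuous_on_subset[OF assms(1)]) (use ab in auto)
    from Henstock_Kurzweil_Integration.integral_combine[OF ab(1,2) integrable_continuous_real[OF this]]
    have *: "integral {0..?a} f + integral {?a..?b} f = integral {0..?b} f" .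
    have "\<bar>integral {?a..?b} f - (?b - ?a) * f ?a\<bar> \<le> e * (?b - ?a)"
      by (intro integral_near_const near continuous_on_subset[OF assms(1)]) (use ab ba in auto)
    then have 1: "\<bar>integral {?a..?b} f - x / n * f ?a\<bar> \<le> e * (x / n)" unfolding ba .
    have 2: "\<bar>integral {0..?a} f - x / n * (\<Sum>i<m. f (x * i / n))\<bar> \<le> e * (x * m / n)"
      using Suc by simp
    have "integral {0..?b} f - x / n * (\<Sum>i<Suc m. f (x * i / n))
      = (integral {0..?a} f - x / n * (\<Sum>i<m. f (x * i / n))) + (integral {?a..?b} f - x / n * f ?a)"
      unfolding * [symmetric] sum.lessThan_Suc distrib_left by (rule add_diff_add)
    moreover have "e * ?b = e * (x * m / n) + e * (x / n)" by (simp add: algebra_simps add_divide_distrib)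
    ultimately show ?case using order_trans[OF abs_triangle_ineq add_mono[OF 2 1]] by simp
  qed simp
  from this[of n] show ?thesis using \<open>n > 0\<close> by simp
qed

text \<open>On an equidistant product grid the Riemann sum of the double integral is a nonnegative
  multiple of a sum as in \<open>psd\<close>. Equal weights are the reason why \<open>psd\<close>
  can be stated with all coefficients equal to one.\<close>

lemma kernel_integral_nonneg:
  assumes cont: "continuous_on ({0..T} \<times> {0..T}) (\<lambda>(p, q). A p q)"
    and psd: "\<And>n \<tau>. (\<And>i. i < n \<Longrightarrow> \<tau> i \<in> {0..T}) \<Longrightarrow> 0 \<le> (\<Sum>i<n::nat. \<Sum>j<n. A (\<tau> i) (\<tau> j))"
    and x: "x \<in> {0..T}"
  shows "0 \<le> kernel_integral A x x"
proof -
  \<comment> \<open>An error \<open>e * x * x\<close> arises twice: from replacing the inner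
    integrals by sums and from replacing the outer one.\<close>
  have "0 \<le> kernel_integral A x x + e * (2 * x * x)" if "e > 0" for e
  proof -
    have "uniformly_continuous_on ({0..T} \<times> {0..T}) (\<lambda>(p, q). A p q)"
      by (intro compact_uniformly_continuous cont compact_Times) auto
    from uniformly_continuous_onE[OF this \<open>e > 0\<close>]
    obtain d where "d > 0" and d: "\<And>z z'. z \<in> {0..T} \<times> {0..T} \<Longrightarrow> z' \<in> {0..T} \<times> {0..T} \<Longrightarrow> dist z' z < d
        \<Longrightarrow> dist (case z' of (p, q) \<Rightarrow> A p q) (case z of (p, q) \<Rightarrow> A p q) < e"
      by metis
    obtain n :: nat where n: "x / d < n" using reals_Archimedean2 by blast
    then have "0 < n" using x \<open>d > 0\<close> by (metis atLeastAtMost_iff divide_nonneg_pos gr0I less_le_not_le of_nat_0)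
    have nd: "x / n < d" using n \<open>0 < n\<close> \<open>d > 0\<close> by (simp add: field_simps)
    define P where "P i = x * real i / n" for i
    have P: "P i \<in> {0..x}" if "i < n" for i
      using that x by (auto simp: P_def divide_simps mult_left_mono)
    have T: "q \<in> {0..T}" if "q \<in> {0..x}" for q using that x by auto
    have 1: "\<bar>integral {0..x} (A p) - x / n * (\<Sum>j<n. A p (P j))\<bar> \<le> e * x" if "p \<in> {0..x}" for p
      unfolding P_def
    proof (rule riemann_sum_error)
      show "continuous_on {0..x} (A p)"
        by (rule continuous_on_subset[OF continuous_on_section(1)[OF cont]]) (use T that in auto)
      fix q r assume "q \<in> {0..x}" "r \<in> {0..x}" "\<bar>q - r\<bar> \<le> x / n"
      then show "\<bar>A p q - A p r\<bar> \<le> e"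
        using d[of "(p, r)" "(p, q)"] nd T that by (auto simp: dist_Pair_Pair dist_real_def)
    qed (use x \<open>0 < n\<close> in auto)
    have 2: "\<bar>kernel_integral A x x - x / n * (\<Sum>i<n. integral {0..x} (A (P i)))\<bar> \<le> (e * x) * x"
      unfolding P_def kernel_integral_def
    proof (rule riemann_sum_error)
      show "continuous_on {0..x} (\<lambda>p. integral {0..x} (A p))"
        by (rule continuous_on_subset[OF continuous_on_section_integral[OF cont]]) (use x in auto)
      fix q r assume qr: "q \<in> {0..x}" "r \<in> {0..x}" "\<bar>q - r\<bar> \<le> x / n"
      have c: "continuous_on {0..x} (A p)" if "p \<in> {0..x}" for p
        by (rule continuous_on_subset[OF continuous_on_section(1)[OF cont]]) (use T that x in auto)
      have "\<bar>integral {0..x} (\<lambda>p. A q p - A r p) - (x - 0) * 0\<bar> \<le> e * (x - 0)"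
      proof (intro integral_near_const)
        fix p assume "p \<in> {0..x}"
        then show "\<bar>A q p - A r p - 0\<bar> \<le> e"
          using d[of "(r, p)" "(q, p)"] nd T qr by (auto simp: dist_Pair_Pair dist_real_def)
      qed (use x c qr in \<open>auto intro!: continuous_on_diff\<close>)
      moreover have "integral {0..x} (\<lambda>p. A q p - A r p) = integral {0..x} (A q) - integral {0..x} (A r)"
        using c qr by (intro integral_diff integrable_continuous_real) auto
      ultimately show "\<bar>integral {0..x} (A q) - integral {0..x} (A r)\<bar> \<le> e * x" by simp
    qed (use x \<open>0 < n\<close> in auto)
    have xn: "0 \<le> x / n" using x by simp
    have "0 \<le> (x / n) * ((x / n) * (\<Sum>i<n. \<Sum>j<n. A (P i) (P j)))"
      using xn by (intro mult_nonneg_nonneg psd) (use P T in auto)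
    also have "\<dots> = (x / n) * (\<Sum>i<n. x / n * (\<Sum>j<n. A (P i) (P j)))"
      by (simp add: sum_distrib_left)
    also have "\<dots> \<le> (x / n) * (\<Sum>i<n. integral {0..x} (A (P i)) + e * x)"
      using 1 P by (intro mult_left_mono sum_mono xn) (force simp: abs_le_iff)
    also have "\<dots> = (x / n) * (\<Sum>i<n. integral {0..x} (A (P i))) + e * x * x"
      using \<open>0 < n\<close> by (simp add: sum.distrib algebra_simps)
    also have "\<dots> \<le> kernel_integral A x x + e * (2 * x * x)"
      using 2 by (simp add: abs_le_iff algebra_simps)
    finally show ?thesis .
  qed
  note * = this
  have "0 \<le> kernel_integral A x x + e" if "e > 0" for e
  proof -
    have "0 \<le> x * x" by simp
    \<comment> \<open>The summand 1 keeps the denominator positive in the case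
      \<open>x = 0\<close>.\<close>
    then have pos: "0 < 2 * x * x + 1" by linarith
    then have "e / (2 * x * x + 1) * (2 * x * x) \<le> e"
      using \<open>e > 0\<close> by (simp add: field_simps)
    then show ?thesis using *[of "e / (2 * x * x + 1)"] pos \<open>e > 0\<close> by simp
  qed
  then show ?thesis by (rule field_le_epsilon)
qed

lemma derivative_upper_bound:
  fixes f :: "real \<Rightarrow> real"
  assumes "\<And>s. s \<in> {a..b} \<Longrightarrow> (f has_real_derivative f' s) (at s within {a..b})"
    and "\<And>s. s \<in> {a..b} \<Longrightarrow> f' s \<le> c" and "t \<in> {a..b}"
  shows "f t \<le> f a + c * (t - a)"
proof -
  have "(f has_derivative (*) (f' x)) (at x within {a..t})" if "x \<in> {a..t}" for x
    using DERIV_subset[OF assms(1), of x "{a..t}"] assms(3) that by (auto simp: has_field_derivative_def)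
  then have "\<exists>x\<in>{a..t}. f t - f a = f' x * (t - a)"
    using assms(3) by (intro mvt_very_simple) auto
  then obtain y where "y \<in> {a..t}" "f t - f a = f' y * (t - a)" by blast
  moreover have "f' y * (t - a) \<le> c * (t - a)"
    using assms \<open>y \<in> _\<close> by (intro mult_right_mono) auto
  ultimately show ?thesis by simp
qed

text \<open>The sum of \<open>L\<close> and the double integral of \<open>A\<close> has derivative 2
  (K(q,q) + integral of A(p,q) over p in [0,q]). For frozen \<open>q\<close> this bracket is the
  value at s = q of a function of s that starts at \<open>K 0 q\<close> and has derivative
  \<open>- B s q\<close>, since \<open>A\<close> cancels. Hence the bracket is at most
  \<open>m1 + T * m2\<close>, and integrating over time gives the factor \<open>2 * T\<close>. The
  double integral is dropped at the end because it is nonnegative.\<close>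

lemma wave_kernel_estimate:
  fixes A B K :: "real \<Rightarrow> real \<Rightarrow> real"
  assumes cont: "continuous_on ({0..T} \<times> {0..T}) (\<lambda>(p, q). A p q)"
    and sym: "\<And>p q. p \<in> {0..T} \<Longrightarrow> q \<in> {0..T} \<Longrightarrow> A p q = A q p"
    and psd: "\<And>n \<tau>. (\<And>i. i < n \<Longrightarrow> \<tau> i \<in> {0..T}) \<Longrightarrow> 0 \<le> (\<Sum>i<n::nat. \<Sum>j<n. A (\<tau> i) (\<tau> j))"
    and L: "\<And>q. q \<in> {0..T} \<Longrightarrow> (L has_real_derivative 2 * K q q) (at q within {0..T})"
    and K: "\<And>s q. s \<in> {0..T} \<Longrightarrow> q \<in> {0..T} \<Longrightarrow>
        ((\<lambda>s. K s q) has_real_derivative - (A s q + B s q)) (at s within {0..T})"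
    and m1: "\<And>q. q \<in> {0..T} \<Longrightarrow> \<bar>K 0 q\<bar> \<le> m1"
    and m2: "\<And>s q. s \<in> {0..T} \<Longrightarrow> q \<in> {0..T} \<Longrightarrow> \<bar>B s q\<bar> \<le> m2"
    and t: "t \<in> {0..T}"
  shows "L t \<le> L 0 + 2 * T * (m1 + T * m2)"
proof -
  have "0 \<in> {0..T}" using t by auto
  then have m2_nonneg: "0 \<le> m2" using m2[of 0 0] by linarith
  have kqq: "K q q + integral {0..q} (\<lambda>p. A p q) \<le> m1 + T * m2" if q: "q \<in> {0..T}" for q
  proof -
    have "((\<lambda>s. K s q + integral {0..s} (\<lambda>p. A p q)) has_real_derivative - (A s q + B s q) + A s q) (at s within {0..T})"
      if "s \<in> {0..T}" for s
      using K[OF that q] integral_has_real_derivative[OF continuous_on_section(2)[OF cont q] that]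
      by (rule DERIV_add)
    then have "K q q + integral {0..q} (\<lambda>p. A p q) \<le> (K 0 q + integral {0..0} (\<lambda>p. A p q)) + m2 * (q - 0)"
    proof (rule derivative_upper_bound[OF _ _ q])
      fix s assume "s \<in> {0..T}"
      then show "- (A s q + B s q) + A s q \<le> m2" using m2[OF _ q, of s] by (simp add: abs_le_iff)
    qed
    then have "K q q + integral {0..q} (\<lambda>p. A p q) \<le> K 0 q + m2 * q" by simp
    also have "m2 * q \<le> m2 * T" using m2_nonneg q by (intro mult_left_mono) auto
    finally show ?thesis using m1[OF q] by (simp add: mult.commute abs_le_iff)
  qed
  have D: "((\<lambda>t. L t + kernel_integral A t t) has_real_derivative 2 * K q q + (integral {0..q} (A q) + integral {0..q} (\<lambda>p. A p q))) (at q within {0..T})"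
    if "q \<in> {0..T}" for q
    using DERIV_add[OF L[OF that] kernel_integral_path_derivative[OF cont, of "{0..T}" 0 0 q]] that by simp
  have deriv: "((\<lambda>t. L t + kernel_integral A t t) has_real_derivative 2 * (K q q + integral {0..q} (\<lambda>p. A p q))) (at q within {0..T})"
    if "q \<in> {0..T}" for q
  proof -
    have "integral {0..q} (A q) = integral {0..q} (\<lambda>p. A p q)"
      using that sym by (intro integral_cong) auto
    then show ?thesis using D[OF that] by simp
  qed
  define c where "c = m1 + T * m2"
  have "L t + kernel_integral A t t \<le> L 0 + kernel_integral A 0 0 + 2 * c * (t - 0)"
  proof (rule derivative_upper_bound[OF deriv _ t])
    fix q assume "q \<in> {0..T}"
    then show "2 * (K q q + integral {0..q} (\<lambda>p. A p q)) \<le> 2 * c"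
      using kqq by (intro mult_left_mono) (auto simp: c_def)
  qed
  moreover have "c * t \<le> c * T"
    using m1[of 0] m2_nonneg t by (intro mult_left_mono) (auto simp: c_def)
  then have "2 * c * t \<le> 2 * T * c" by (simp add: mult.commute)
  moreover have "0 \<le> kernel_integral A t t" by (rule kernel_integral_nonneg[OF cont psd t]) auto
  ultimately have "L t \<le> L 0 + 2 * T * c" by (simp add: kernel_integral_def)
  then show ?thesis by (simp add: c_def)
qed

section \<open>Smooth functions and convolution\<close>

text \<open>\<open>smooth\<close> quantifies over all words of derivatives. A set of differentiable
  functions that is closed under differentiation is an invariant for these words, which replaces
  explicit formulas for higher derivatives.\<close>

lemma smooth_coinduct:
  assumes "f \<in> S" "\<And>f x. f \<in> S \<Longrightarrow> f differentiable (at x)"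
    and "\<And>f b. f \<in> S \<Longrightarrow> b \<in> Basis \<Longrightarrow> dir_deriv b f \<in> S"
  shows "smooth f"
proof -
  have "iter_deriv vs f \<in> S" if "vs \<in> lists Basis" for vs
    using that by induction (auto intro: assms)
  then show ?thesis by (simp add: smooth_def assms(2))
qed

lemma smooth_differentiable: "smooth f \<Longrightarrow> f differentiable (at x)"
  by (metis iter_deriv.simps(1) lists.Nil smooth_def)

lemma smooth_continuous_on: "smooth f \<Longrightarrow> continuous_on S f"
  by (meson continuous_at_imp_continuous_on differentiable_imp_continuous_within smooth_differentiable)

lemma smooth_dir_deriv:
  assumes "smooth f" "b \<in> Basis"
  shows "smooth (dir_deriv b f)"
proof -
  \<comment> \<open>The head of a word is the outermost derivative, so a derivative taken first is
    appended at the end.\<close>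
  have "iter_deriv vs (dir_deriv b f) = iter_deriv (vs @ [b]) f" for vs
    by (induction vs) auto
  then show ?thesis using assms by (simp add: smooth_def)
qed

lemma smooth_has_derivative:
  assumes "smooth f"
  shows "(f has_derivative (\<lambda>h. \<Sum>b\<in>Basis. (h \<bullet> b) * dir_deriv b f x)) (at x)"
proof -
  have D: "(f has_derivative frechet_derivative f (at x)) (at x)"
    using smooth_differentiable[OF assms] by (simp add: frechet_derivative_works)
  then interpret bounded_linear "frechet_derivative f (at x)" by (rule has_derivative_bounded_linear)
  have "frechet_derivative f (at x) h = (\<Sum>b\<in>Basis. (h \<bullet> b) * dir_deriv b f x)" for h
    by (subst euclidean_representation[symmetric, of h]) (simp add: sum scaleR dir_deriv_def)
  then show ?thesis using D by (metis (no_types, lifting) ext)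
qed

lemma dir_deriv_eqI:
  assumes "(f has_derivative f') (at x)"
  shows "dir_deriv v f x = f' v"
  using frechet_derivative_at[OF assms] by (simp add: dir_deriv_def)

lemma smooth_affine:
  assumes "smooth f"
  shows "smooth (\<lambda>x. k * f (a + c *\<^sub>R x))"
    and "dir_deriv v (\<lambda>x. k * f (a + c *\<^sub>R x)) x = k * c * dir_deriv v f (a + c *\<^sub>R x)"
proof -
  have D: "((\<lambda>x. k * f (a + c *\<^sub>R x)) has_derivative
      (\<lambda>h. k * frechet_derivative f (at (a + c *\<^sub>R x)) (c *\<^sub>R h))) (at x)" if "smooth f" for f k x
  proof -
    have "((\<lambda>x. a + c *\<^sub>R x) has_derivative (\<lambda>h. c *\<^sub>R h)) (at x)"
      by (auto intro!: derivative_eq_intros)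
    moreover have "(f has_derivative frechet_derivative f (at (a + c *\<^sub>R x))) (at (a + c *\<^sub>R x))"
      using smooth_differentiable[OF that] by (simp add: frechet_derivative_works)
    ultimately have "((\<lambda>x. f (a + c *\<^sub>R x)) has_derivative
        (\<lambda>h. frechet_derivative f (at (a + c *\<^sub>R x)) (c *\<^sub>R h))) (at x)"
      by (rule has_derivative_compose)
    then show ?thesis by (rule has_derivative_mult_right)
  qed
  have *: "dir_deriv v (\<lambda>x. k * f (a + c *\<^sub>R x)) x = k * c * dir_deriv v f (a + c *\<^sub>R x)" if "smooth f" for f k v x
  proof -
    have "linear (frechet_derivative f (at (a + c *\<^sub>R x)))"
      by (simp add: linear_frechet_derivative smooth_differentiable that)
    then show ?thesis
      using dir_deriv_eqI[OF D[OF that]] by (simp add: dir_deriv_def linear_scale)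
  qed
  show "dir_deriv v (\<lambda>x. k * f (a + c *\<^sub>R x)) x = k * c * dir_deriv v f (a + c *\<^sub>R x)"
    by (rule *[OF assms])
  show "smooth (\<lambda>x. k * f (a + c *\<^sub>R x))"
  \<comment> \<open>The factor \<open>k\<close> is free in this set because each differentiation
    brings out another factor \<open>c\<close>.\<close>
  proof (rule smooth_coinduct[where S = "{\<lambda>x. k * g (a + c *\<^sub>R x) | g k. smooth g}"])
    fix f b assume f: "f \<in> {\<lambda>x. k * g (a + c *\<^sub>R x) | g k. smooth g}"
    then show "f differentiable (at x)" for x using D by (auto simp: differentiable_def)
    assume b: "b \<in> (Basis :: 'a set)"
    from f obtain k g where "f = (\<lambda>x. k * g (a + c *\<^sub>R x))" "smooth g" by auto
    then have "dir_deriv b f = (\<lambda>x. (k * c) * dir_deriv b g (a + c *\<^sub>R x))" using * by auto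
    then show "dir_deriv b f \<in> {\<lambda>x. k * g (a + c *\<^sub>R x) | g k. smooth g}"
      using smooth_dir_deriv[OF \<open>smooth g\<close> b] by blast
  qed (use assms in auto)
qed

text \<open>Products alone are not closed under differentiation: Leibniz' rule produces a sum of two
  products. Finite sums of products are closed, and so serve as the invariant for
  \<open>smooth_coinduct\<close>.\<close>

inductive_set smooth_products :: "('a::euclidean_space \<Rightarrow> real) set" where
  prod: "smooth f \<Longrightarrow> smooth g \<Longrightarrow> (\<lambda>x. f x * g x) \<in> smooth_products"
| sum: "f \<in> smooth_products \<Longrightarrow> g \<in> smooth_products \<Longrightarrow> (\<lambda>x. f x + g x) \<in> smooth_products"

lemma dir_deriv_mult:
  assumes "f differentiable (at x)" "g differentiable (at x)"
  shows "dir_deriv v (\<lambda>x. f x * g x) x = f x * dir_deriv v g x + dir_deriv v f x * g x"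
  using dir_deriv_eqI[OF has_derivative_mult[OF assms[THEN frechet_derivative_works[THEN iffD1]]]]
  by (simp add: dir_deriv_def)

lemma smooth_mult:
  assumes "smooth f" "smooth g"
  shows "smooth (\<lambda>x. f x * g x)"
proof (rule smooth_coinduct[where S = smooth_products])
  have *: "f differentiable (at x) \<and> dir_deriv b f \<in> smooth_products" if "f \<in> smooth_products" "b \<in> Basis"
    for f x and b :: 'a
    using that(1)
  proof (induction arbitrary: x)
    case (prod f g)
    have "dir_deriv b (\<lambda>x. f x * g x) = (\<lambda>x. f x * dir_deriv b g x + dir_deriv b f x * g x)"
      using prod by (intro ext dir_deriv_mult smooth_differentiable)
    moreover have "\<dots> \<in> smooth_products"
      using prod that(2) by (intro smooth_products.intros smooth_dir_deriv)
    ultimately show ?case using prod by (simp add: differentiable_mult smooth_differentiable)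
  next
    case (sum f g)
    have "dir_deriv b (\<lambda>x. f x + g x) x = dir_deriv b f x + dir_deriv b g x" for x
    proof -
      have "(f has_derivative frechet_derivative f (at x)) (at x)" "(g has_derivative frechet_derivative g (at x)) (at x)"
        using sum.IH frechet_derivative_works by blast+
      from dir_deriv_eqI[OF has_derivative_add[OF this]] show ?thesis by (simp add: dir_deriv_def)
    qed
    then show ?case using sum by (auto intro: smooth_products.sum differentiable_add)
  qed
  fix f :: "'a \<Rightarrow> real" assume f: "f \<in> smooth_products"
  show "f differentiable (at x)" for x using *[OF f SOME_Basis] by blast
  show "dir_deriv b f \<in> smooth_products" if "b \<in> Basis" for b using *[OF f that] by blast
qed (use assms in \<open>auto intro: smooth_products.intros\<close>)

section \<open>Test functions: supports, closure properties and bounds\<close>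

lemma test_functionI:
  assumes "smooth \<phi>" "\<And>x. R < norm x \<Longrightarrow> \<phi> x = 0"
  shows "\<phi> \<in> test_functions"
proof -
  have "{x. \<phi> x \<noteq> 0} \<subseteq> cball 0 R" using assms(2) by (force simp: not_less)
  then have "bounded {x. \<phi> x \<noteq> 0}" using bounded_cball bounded_subset by blast
  then show ?thesis using assms(1) by (simp add: test_functions_def)
qed

lemma test_function_support:
  assumes "\<phi> \<in> test_functions"
  obtains R where "R > 0" "\<And>x. R < norm x \<Longrightarrow> \<phi> x = 0"
proof -
  have "bounded (closure {x. \<phi> x \<noteq> 0})" using assms by (simp add: test_functions_def compact_imp_bounded)
  then have "bounded {x. \<phi> x \<noteq> 0}" by (rule bounded_subset) (rule closure_subset)
  then obtain R where "\<forall>x\<in>{x. \<phi> x \<noteq> 0}. norm x \<le> R" "0 < R" unfolding bounded_pos by blast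
  then show ?thesis using that[of R] by force
qed

lemma test_function_smooth: "\<phi> \<in> test_functions \<Longrightarrow> smooth \<phi>"
  by (simp add: test_functions_def)

lemma dir_deriv_locally_const:
  assumes "open U" "x \<in> U" "\<And>y. y \<in> U \<Longrightarrow> f y = c"
  shows "dir_deriv v f x = 0"
proof -
  have "((\<lambda>x. c) has_derivative (\<lambda>h. 0)) (at x)" by simp
  then have "(f has_derivative (\<lambda>h. 0)) (at x)"
    by (rule has_derivative_transform_within_open[OF _ assms(1,2)]) (use assms(3) in auto)
  then show ?thesis by (rule dir_deriv_eqI)
qed

lemma dir_deriv_support:
  assumes "\<And>x. R < norm x \<Longrightarrow> f x = 0" "R < norm x"
  shows "dir_deriv v f x = 0"
proof (rule dir_deriv_locally_const)
  show "open {x. R < norm x}" by (intro open_Collect_less continuous_intros)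
qed (use assms in auto)

lemma test_function_dir_deriv:
  assumes "\<phi> \<in> test_functions" "b \<in> Basis"
  shows "dir_deriv b \<phi> \<in> test_functions"
proof -
  obtain R where "R > 0" "\<And>x. R < norm x \<Longrightarrow> \<phi> x = 0" by (rule test_function_support[OF assms(1)]) blast
  then show ?thesis
    using test_functionI[OF smooth_dir_deriv[OF test_function_smooth[OF assms(1)] assms(2)]] dir_deriv_support
    by blast
qed

lemma test_function_mult:
  assumes "\<phi> \<in> test_functions" "smooth g"
  shows "(\<lambda>x. \<phi> x * g x) \<in> test_functions"
proof -
  obtain R where "R > 0" "\<And>x. R < norm x \<Longrightarrow> \<phi> x = 0" by (rule test_function_support[OF assms(1)]) blast
  then show ?thesis using assms by (intro test_functionI[of _ R] smooth_mult) (auto simp: test_function_smooth)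
qed

lemma test_function_affine:
  assumes "\<phi> \<in> test_functions" "c \<noteq> 0"
  shows "(\<lambda>x. k * \<phi> (a + c *\<^sub>R x)) \<in> test_functions"
proof -
  obtain R where R: "R > 0" "\<And>x. R < norm x \<Longrightarrow> \<phi> x = 0" by (rule test_function_support[OF assms(1)]) blast
  show ?thesis
  proof (rule test_functionI[OF smooth_affine(1)[OF test_function_smooth[OF assms(1)]]])
    fix x :: 'a assume "(R + norm a) / \<bar>c\<bar> < norm x"
    then have "R + norm a < \<bar>c\<bar> * norm x" using assms(2) by (simp add: field_simps)
    also have "\<bar>c\<bar> * norm x = norm ((a + c *\<^sub>R x) - a)" by simp
    also have "\<dots> \<le> norm (a + c *\<^sub>R x) + norm a" by (rule norm_triangle_ineq4)
    finally show "k * \<phi> (a + c *\<^sub>R x) = 0" using R(2) by simp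
  qed
qed

lemma test_function_bounded:
  assumes "\<phi> \<in> test_functions"
  obtains C where "\<And>x. \<bar>\<phi> x\<bar> \<le> C"
proof -
  obtain R where R: "R > 0" "\<And>x. R < norm x \<Longrightarrow> \<phi> x = 0" by (rule test_function_support[OF assms(1)]) blast
  have "bounded (\<phi> ` cball 0 R)"
    by (intro compact_imp_bounded compact_continuous_image smooth_continuous_on test_function_smooth assms) auto
  then obtain C where C: "\<And>x. norm x \<le> R \<Longrightarrow> \<bar>\<phi> x\<bar> \<le> C" unfolding bounded_iff by fastforce
  have "\<bar>\<phi> x\<bar> \<le> C" for x
    using C[of x] C[of 0] R by (cases "norm x \<le> R") (auto simp: not_le)
  then show ?thesis by (rule that)
qed

text \<open>A single constant bounds increments and derivatives, so that it bounds first-order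
  remainders when differentiating under the integral.\<close>

lemma test_function_lipschitz:
  assumes "\<phi> \<in> test_functions"
  obtains C where "C \<ge> 0" "\<And>x y. \<bar>\<phi> x - \<phi> y\<bar> \<le> C * norm (x - y)"
    "\<And>x h. \<bar>\<Sum>b\<in>Basis. (h \<bullet> b) * dir_deriv b \<phi> x\<bar> \<le> C * norm h"
proof -
  have "\<forall>b\<in>Basis. \<exists>C. \<forall>x. \<bar>dir_deriv b \<phi> x\<bar> \<le> C"
    using test_function_bounded[OF test_function_dir_deriv[OF assms]] by metis
  then obtain c where c: "\<And>b x. b \<in> Basis \<Longrightarrow> \<bar>dir_deriv b \<phi> x\<bar> \<le> c b" by metis
  define C where "C = (\<Sum>b\<in>(Basis::'a set). c b)"
  have c0: "0 \<le> c b" if "b \<in> Basis" for b using c[OF that, of 0] by linarith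
  have 1: "\<bar>\<Sum>b\<in>Basis. (h \<bullet> b) * dir_deriv b \<phi> x\<bar> \<le> C * norm h" for x h
  proof -
    have "\<bar>\<Sum>b\<in>Basis. (h \<bullet> b) * dir_deriv b \<phi> x\<bar> \<le> (\<Sum>b\<in>Basis. \<bar>(h \<bullet> b) * dir_deriv b \<phi> x\<bar>)"
      by (rule sum_abs)
    also have "\<dots> \<le> (\<Sum>b\<in>Basis. norm h * c b)"
      unfolding abs_mult by (intro sum_mono mult_mono c Basis_le_norm) auto
    finally show ?thesis by (simp add: C_def sum_distrib_left mult.commute)
  qed
  have 2: "\<bar>\<phi> x - \<phi> y\<bar> \<le> C * norm (x - y)" for x y
  proof -
    have "norm (\<phi> x - \<phi> y) \<le> C * norm (x - y)"
    proof (rule differentiable_bound[of UNIV])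
      show "(\<phi> has_derivative (\<lambda>h. \<Sum>b\<in>Basis. (h \<bullet> b) * dir_deriv b \<phi> x)) (at x within UNIV)" for x
        using smooth_has_derivative[OF test_function_smooth[OF assms]] by simp
      show "onorm (\<lambda>h. \<Sum>b\<in>Basis. (h \<bullet> b) * dir_deriv b \<phi> x) \<le> C" for x
        using 1 by (intro onorm_le) auto
    qed auto
    then show ?thesis by simp
  qed
  show ?thesis using that[of C] 1 2 c0 by (auto simp: C_def sum_nonneg)
qed


lemma integrable_mult_test_function:
  fixes f g :: "'a::euclidean_space \<Rightarrow> real"
  assumes "locally_integrable f" "g \<in> borel_measurable borel" "\<And>y. \<bar>g y\<bar> \<le> C" "\<And>y. y \<notin> K \<Longrightarrow> g y = 0" "compact K"
  shows "integrable lborel (\<lambda>y. f y * g y)"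
proof -
  have int: "integrable lborel (\<lambda>y. indicator K y *\<^sub>R f y)"
    using assms(1,5) by (simp add: locally_integrable_def set_integrable_def)
  have eq: "f y * g y = (indicator K y *\<^sub>R f y) * g y" for y
    using assms(4)[of y] by (auto simp: indicator_def)
  have "integrable lborel (\<lambda>y. C * (indicator K y *\<^sub>R f y))"
    using int by (intro integrable_mult_right)
  then show ?thesis
  proof (rule Bochner_Integration.integrable_bound)
    have "(\<lambda>y. (indicator K y *\<^sub>R f y) * g y) \<in> borel_measurable lborel"
      using borel_measurable_integrable[OF int] assms(2) by measurable
    then show "(\<lambda>y. f y * g y) \<in> borel_measurable lborel" unfolding eq .
    have "\<bar>g y\<bar> \<le> \<bar>C\<bar>" for y using assms(3)[of y] by linarith
    then have "norm (indicator K y *\<^sub>R f y) * norm (g y) \<le> norm (indicator K y *\<^sub>R f y) * norm C" for y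
      by (intro mult_left_mono) auto
    then have "norm (f y * g y) \<le> norm (C * (indicator K y *\<^sub>R f y))" for y
      unfolding eq norm_mult by (simp only: mult.commute)
    then show "AE y in lborel. norm (f y * g y) \<le> norm (C * (indicator K y *\<^sub>R f y))" by simp
  qed
qed

section \<open>Convolution of a locally integrable function with a test function\<close>

definition conv :: "('a::euclidean_space \<Rightarrow> real) \<Rightarrow> ('a \<Rightarrow> real) \<Rightarrow> 'a \<Rightarrow> real" where
  "conv f \<rho> x = (\<integral>y. f y * \<rho> (x - y) \<partial>lborel)"

lemma test_function_measurable: "\<phi> \<in> test_functions \<Longrightarrow> \<phi> \<in> borel_measurable borel"
  by (intro borel_measurable_continuous_onI smooth_continuous_on test_function_smooth)

lemma integrable_test_function:
  assumes "locally_integrable f" "\<phi> \<in> test_functions"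
  shows "integrable lborel (\<lambda>y. f y * \<phi> y)"
proof -
  obtain R where R: "R > 0" "\<And>x. R < norm x \<Longrightarrow> \<phi> x = 0"
    by (rule test_function_support[OF assms(2)]) blast
  obtain C where "\<And>x. \<bar>\<phi> x\<bar> \<le> C" by (rule test_function_bounded[OF assms(2)]) blast
  then show ?thesis
    using R by (intro integrable_mult_test_function[OF assms(1), where K = "cball 0 R"] test_function_measurable assms)
      (auto simp: not_le)
qed

lemma test_function_translate:
  assumes "\<phi> \<in> test_functions"
  shows "(\<lambda>y. \<phi> (x - y)) \<in> test_functions" and "dir_deriv b (\<lambda>y. \<phi> (x - y)) y = - dir_deriv b \<phi> (x - y)"
  using test_function_affine[OF assms, of "-1" 1 x] smooth_affine(2)[OF test_function_smooth[OF assms], of b 1 x "-1" y]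
  by simp_all

lemma integrable_conv:
  assumes "locally_integrable f" "\<phi> \<in> test_functions"
  shows "integrable lborel (\<lambda>y. f y * \<phi> (x - y))"
  using integrable_test_function[OF assms(1) test_function_translate(1)[OF assms(2)]] .

text \<open>Differentiation under the integral sign. Along a sequence tending to \<open>x\<close>,
  the remainder quotients of \<open>\<rho>\<close> tend to 0 pointwise, vanish outside a fixed
  compact set and are bounded by twice the Lipschitz constant, so dominated convergence applies
  although \<open>f\<close> is only locally integrable.\<close>

lemma has_derivative_conv:
  assumes f: "locally_integrable f" and \<rho>: "\<rho> \<in> test_functions"
  shows "(conv f \<rho> has_derivative (\<lambda>h. \<Sum>b\<in>Basis. (h \<bullet> b) * conv f (dir_deriv b \<rho>) x)) (at x)"
proof -
  obtain R where R: "R > 0" "\<And>x. R < norm x \<Longrightarrow> \<rho> x = 0"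
    by (rule test_function_support[OF \<rho>]) blast
  define D where "D y h = (\<Sum>b\<in>Basis. (h \<bullet> b) * dir_deriv b \<rho> y)" for y h
  obtain C where C: "C \<ge> 0" "\<And>x y. \<bar>\<rho> x - \<rho> y\<bar> \<le> C * norm (x - y)" "\<And>x h. \<bar>D x h\<bar> \<le> C * norm h"
    unfolding D_def by (rule test_function_lipschitz[OF \<rho>]) blast
  have D0: "D y h = 0" if "R < norm y" for y h
    using dir_deriv_support[OF R(2) that] by (simp add: D_def)
  have int_D: "integrable lborel (\<lambda>y. f y * D (x - y) h)" for h
    unfolding D_def sum_distrib_left mult.left_commute[of "f _"]
    by (intro Bochner_Integration.integrable_sum integrable_mult_right integrable_conv f test_function_dir_deriv \<rho>)
  have conv_D: "(\<Sum>b\<in>Basis. (h \<bullet> b) * conv f (dir_deriv b \<rho>) x) = (\<integral>y. f y * D (x - y) h \<partial>lborel)" for h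
    unfolding D_def sum_distrib_left mult.left_commute[of "f _"] conv_def
    by (subst Bochner_Integration.integral_sum)
       (auto intro!: integrable_conv f test_function_dir_deriv \<rho>)
  \<comment> \<open>The base point may move by less than 1, hence the radius \<open>R + 1\<close>
    instead of the support radius \<open>R\<close>.\<close>
  define K where "K = cball x (R + 1)"
  have "((\<lambda>z. (conv f \<rho> z - conv f \<rho> x - (\<integral>y. f y * D (x - y) (z - x) \<partial>lborel)) / norm (z - x)) \<longlongrightarrow> 0) (at x within ball x 1)"
    unfolding tendsto_at_iff_sequentially
  proof (intro allI impI)
    fix X assume X: "\<forall>n. X n \<in> ball x 1 - {x}" "X \<longlonglongrightarrow> x"
    \<comment> \<open>\<open>f\<close> times the normalised first-order remainder of
      \<open>\<rho>\<close>; its integral is the remainder quotient of the convolution.\<close>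
    define s where "s n y = f y * ((\<rho> (X n - y) - \<rho> (x - y) - D (x - y) (X n - x)) / norm (X n - x))" for n y
    have s_zero: "s n y = 0" if "y \<notin> K" for n y
    proof -
      have "R + 1 < norm (x - y)" using that by (simp add: K_def dist_norm)
      moreover have "norm (x - y) \<le> norm (X n - y) + norm (x - X n)" by norm
      moreover have "norm (x - X n) < 1" using X(1) by (auto simp: dist_norm)
      ultimately have "R < norm (X n - y)" "R < norm (x - y)" by linarith+
      then show ?thesis using R(2) D0 by (simp add: s_def)
    qed
    have s_int: "integrable lborel (s n)" for n
      unfolding s_def right_diff_distrib diff_divide_distrib times_divide_eq_right
      by (intro Bochner_Integration.integrable_diff integrable_divide integrable_conv f \<rho> int_D)
    have s_bound: "norm (s n y) \<le> 2 * C * \<bar>indicator K y *\<^sub>R f y\<bar>" for n y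
    proof (cases "y \<in> K")
      case True
      have "X n \<noteq> x" using X(1) by auto
      have "\<bar>\<rho> (X n - y) - \<rho> (x - y) - D (x - y) (X n - x)\<bar> \<le> \<bar>\<rho> (X n - y) - \<rho> (x - y)\<bar> + \<bar>D (x - y) (X n - x)\<bar>"
        by (rule abs_triangle_ineq4)
      also have "\<dots> \<le> C * norm (X n - y - (x - y)) + C * norm (X n - x)" by (intro add_mono C)
      finally have "\<bar>(\<rho> (X n - y) - \<rho> (x - y) - D (x - y) (X n - x)) / norm (X n - x)\<bar> \<le> 2 * C"
        using \<open>X n \<noteq> x\<close> by (simp add: field_simps)
      then have "\<bar>f y\<bar> * \<bar>(\<rho> (X n - y) - \<rho> (x - y) - D (x - y) (X n - x)) / norm (X n - x)\<bar> \<le> \<bar>f y\<bar> * (2 * C)"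
        by (rule mult_left_mono) simp
      then show ?thesis using True by (simp add: s_def abs_mult mult_ac)
    qed (simp add: s_zero)
    have "(\<lambda>n. \<integral>y. s n y \<partial>lborel) \<longlonglongrightarrow> (\<integral>y. (0::real) \<partial>(lborel :: 'a measure))"
    proof (rule integral_dominated_convergence)
      have "integrable lborel (\<lambda>y. indicator K y *\<^sub>R f y)"
        using f by (simp add: locally_integrable_def set_integrable_def K_def)
      then show "integrable lborel (\<lambda>y. 2 * C * \<bar>indicator K y *\<^sub>R f y\<bar>)"
        by (intro integrable_mult_right integrable_abs)
      have "(\<lambda>n. s n y) \<longlonglongrightarrow> 0" for y
      proof -
        \<comment> \<open>Differentiability of \<open>\<rho>\<close> at \<open>x - y\<close>, used
          along the points \<open>X n - y\<close>; these avoid \<open>x - y\<close> because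
          \<open>X n\<close> differs from \<open>x\<close>.\<close>
        have "((\<lambda>z. (\<rho> z - \<rho> (x - y) - D (x - y) (z - (x - y))) / norm (z - (x - y))) \<longlongrightarrow> 0) (at (x - y))"
          using smooth_has_derivative[OF test_function_smooth[OF \<rho>], of "x - y"]
          unfolding has_derivative_at_within has_derivative_def D_def
          by (auto simp: divide_inverse mult.commute Lim_ident_at)
        then have "((\<lambda>n. (\<rho> (X n - y) - \<rho> (x - y) - D (x - y) (X n - y - (x - y))) / norm (X n - y - (x - y))) \<longlongrightarrow> 0) sequentially"
        proof (rule filterlim_compose)
          show "filterlim (\<lambda>n. X n - y) (at (x - y)) sequentially"
            using X by (auto simp: filterlim_at intro!: tendsto_intros)
        qed
        then have "(\<lambda>n. (\<rho> (X n - y) - \<rho> (x - y) - D (x - y) (X n - x)) / norm (X n - x)) \<longlonglongrightarrow> 0"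
          by simp
        then have "(\<lambda>n. f y * ((\<rho> (X n - y) - \<rho> (x - y) - D (x - y) (X n - x)) / norm (X n - x))) \<longlonglongrightarrow> 0"
          by (rule tendsto_mult_right_zero)
        then show ?thesis by (simp only: s_def)
      qed
      then show "AE y in lborel. (\<lambda>n. s n y) \<longlonglongrightarrow> 0" by simp
      show "\<And>n. AE y in lborel. norm (s n y) \<le> 2 * C * \<bar>indicator K y *\<^sub>R f y\<bar>" using s_bound by simp
      show "\<And>n. s n \<in> borel_measurable lborel" using s_int by auto
    qed simp
    moreover have "(\<integral>y. s n y \<partial>lborel) = (conv f \<rho> (X n) - conv f \<rho> x - (\<integral>y. f y * D (x - y) (X n - x) \<partial>lborel)) / norm (X n - x)" for n
      unfolding s_def conv_def right_diff_distrib times_divide_eq_right integral_divide_zero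
      by (simp add: Bochner_Integration.integral_diff Bochner_Integration.integrable_diff integrable_conv f \<rho> int_D)
    ultimately show "((\<lambda>z. (conv f \<rho> z - conv f \<rho> x - (\<integral>y. f y * D (x - y) (z - x) \<partial>lborel)) / norm (z - x)) \<circ> X) \<longlonglongrightarrow> 0"
      by (simp add: comp_def)
  qed
  then have "((\<lambda>z. (conv f \<rho> z - conv f \<rho> x - (\<Sum>b\<in>Basis. ((z - x) \<bullet> b) * conv f (dir_deriv b \<rho>) x)) / norm (z - x)) \<longlongrightarrow> 0) (at x)"
    unfolding conv_D using at_within_open[of x "ball x 1"] by simp
  moreover have "bounded_linear (\<lambda>h. \<Sum>b\<in>Basis. (h \<bullet> b) * conv f (dir_deriv b \<rho>) x)"
    by (intro bounded_linear_intros)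
  ultimately show ?thesis
    unfolding has_derivative_def by (simp add: divide_inverse mult.commute Lim_ident_at)
qed

lemma dir_deriv_conv:
  assumes "locally_integrable f" "\<rho> \<in> test_functions" "b \<in> Basis"
  shows "dir_deriv b (conv f \<rho>) = conv f (dir_deriv b \<rho>)"
proof
  fix x
  have "dir_deriv b (conv f \<rho>) x = (\<Sum>c\<in>Basis. (b \<bullet> c) * conv f (dir_deriv c \<rho>) x)"
    by (rule dir_deriv_eqI[OF has_derivative_conv[OF assms(1,2)]])
  also have "\<dots> = (\<Sum>c\<in>Basis. if c = b then conv f (dir_deriv c \<rho>) x else 0)"
    using assms(3) by (intro sum.cong) (auto simp: inner_Basis)
  finally show "dir_deriv b (conv f \<rho>) x = conv f (dir_deriv b \<rho>) x" using assms(3) by simp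
qed

text \<open>A derivative of the convolution falls on the kernel and leaves a test function there, so
  the convolutions of \<open>f\<close> with all test functions form the required invariant
  set.\<close>

lemma smooth_conv:
  assumes "locally_integrable f" "\<rho> \<in> test_functions"
  shows "smooth (conv f \<rho>)"
proof (rule smooth_coinduct[where S = "conv f ` test_functions"])
  show "g differentiable (at x)" if "g \<in> conv f ` test_functions" for g x
    using that has_derivative_conv[OF assms(1)] by (auto simp: differentiable_def)
  show "dir_deriv b g \<in> conv f ` test_functions" if "g \<in> conv f ` test_functions" "b \<in> Basis" for g b
    using that by (auto simp: dir_deriv_conv[OF assms(1)] intro: test_function_dir_deriv)
qed (use assms in auto)

lemma test_function_conv:
  assumes "locally_integrable f" "\<rho> \<in> test_functions" "\<And>x. r < norm x \<Longrightarrow> f x = 0"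
  shows "conv f \<rho> \<in> test_functions"
proof -
  obtain R where R: "R > 0" "\<And>x. R < norm x \<Longrightarrow> \<rho> x = 0"
    by (rule test_function_support[OF assms(2)]) blast
  show ?thesis
  proof (rule test_functionI[OF smooth_conv[OF assms(1,2)]])
    fix x :: 'a assume x: "r + R < norm x"
    have "f y * \<rho> (x - y) = 0" for y
    proof -
      have "norm x \<le> norm y + norm (x - y)" by norm
      then have "r < norm y \<or> R < norm (x - y)" using x by linarith
      then show ?thesis using assms(3) R(2) by auto
    qed
    then show "conv f \<rho> x = 0" unfolding conv_def by (simp only: integral_zero)
  qed
qed

text \<open>The reflected translate of \<open>\<rho>\<close> is itself a test function. The sign
  from the reflection cancels the one in the definition of weak derivatives.\<close>

lemma conv_weak_deriv:
  assumes "has_weak_deriv b f g" "\<rho> \<in> test_functions"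
  shows "conv f (dir_deriv b \<rho>) x = conv g \<rho> x"
proof -
  have "(\<integral>y. f y * dir_deriv b (\<lambda>y. \<rho> (x - y)) y \<partial>lborel) = - (\<integral>y. g y * \<rho> (x - y) \<partial>lborel)"
    using assms(1) test_function_translate(1)[OF assms(2)] by (auto simp: has_weak_deriv_def)
  then show ?thesis by (simp add: conv_def test_function_translate(2)[OF assms(2)])
qed

section \<open>Curves in semi-inner product spaces\<close>

locale semi_inner =
  fixes V :: "('a \<Rightarrow> real) set" and ip :: "('a \<Rightarrow> real) \<Rightarrow> ('a \<Rightarrow> real) \<Rightarrow> real"
  assumes zero: "(\<lambda>x. 0) \<in> V"
    and add: "f \<in> V \<Longrightarrow> g \<in> V \<Longrightarrow> (\<lambda>x. f x + g x) \<in> V"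
    and scale: "f \<in> V \<Longrightarrow> (\<lambda>x. c * f x) \<in> V"
    and commute: "f \<in> V \<Longrightarrow> g \<in> V \<Longrightarrow> ip f g = ip g f"
    and add_left: "f \<in> V \<Longrightarrow> g \<in> V \<Longrightarrow> k \<in> V \<Longrightarrow> ip (\<lambda>x. f x + g x) k = ip f k + ip g k"
    and scale_left: "f \<in> V \<Longrightarrow> k \<in> V \<Longrightarrow> ip (\<lambda>x. c * f x) k = c * ip f k"
    and nonneg: "f \<in> V \<Longrightarrow> 0 \<le> ip f f"
begin

definition nrm :: "('a \<Rightarrow> real) \<Rightarrow> real" where
  "nrm f = sqrt (ip f f)"

lemma nrm_nonneg: "f \<in> V \<Longrightarrow> 0 \<le> nrm f"
  by (simp add: nrm_def nonneg)

lemma nrm_square: "f \<in> V \<Longrightarrow> (nrm f)\<^sup>2 = ip f f"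
  by (simp add: nrm_def nonneg)

lemma diff: "f \<in> V \<Longrightarrow> g \<in> V \<Longrightarrow> (\<lambda>x. f x - g x) \<in> V"
  using add[of f "\<lambda>x. - 1 * g x"] scale[of g "-1"] by simp

lemma diff_left: "f \<in> V \<Longrightarrow> g \<in> V \<Longrightarrow> k \<in> V \<Longrightarrow> ip (\<lambda>x. f x - g x) k = ip f k - ip g k"
  using add_left[of f "\<lambda>x. - 1 * g x" k] scale[of g "-1"] scale_left[of g k "-1"] by simp

lemma add_right: "f \<in> V \<Longrightarrow> g \<in> V \<Longrightarrow> k \<in> V \<Longrightarrow> ip k (\<lambda>x. f x + g x) = ip k f + ip k g"
  by (simp add: commute[of k] add_left add)

lemma scale_right: "f \<in> V \<Longrightarrow> k \<in> V \<Longrightarrow> ip k (\<lambda>x. c * f x) = c * ip k f"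
  by (simp add: commute[of k] scale_left scale)

lemma diff_right: "f \<in> V \<Longrightarrow> g \<in> V \<Longrightarrow> k \<in> V \<Longrightarrow> ip k (\<lambda>x. f x - g x) = ip k f - ip k g"
  by (simp add: commute[of k] diff_left diff)

lemma nrm_scale: "f \<in> V \<Longrightarrow> nrm (\<lambda>x. c * f x) = \<bar>c\<bar> * nrm f"
  by (simp add: nrm_def scale scale_left scale_right real_sqrt_mult flip: mult.assoc power2_eq_square)

lemma nrm_minus_commute: "f \<in> V \<Longrightarrow> g \<in> V \<Longrightarrow> nrm (\<lambda>x. f x - g x) = nrm (\<lambda>x. g x - f x)"
  using nrm_scale[of "\<lambda>x. f x - g x" "-1"] by (simp add: diff)

lemma cauchy_schwarz:
  assumes "f \<in> V" "g \<in> V"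
  shows "\<bar>ip f g\<bar> \<le> nrm f * nrm g"
proof -
  have quad: "0 \<le> ip f f - 2 * t * ip f g + t\<^sup>2 * ip g g" for t
  proof -
    have "0 \<le> ip (\<lambda>x. f x - t * g x) (\<lambda>x. f x - t * g x)"
      using assms by (intro nonneg diff scale)
    also have "\<dots> = ip f f - 2 * t * ip f g + t\<^sup>2 * ip g g"
      using assms by (simp add: diff scale diff_left diff_right scale_left scale_right commute[of g f]
          power2_eq_square algebra_simps)
    finally show ?thesis .
  qed
  have "(ip f g)\<^sup>2 \<le> ip f f * ip g g"
  proof (cases "ip g g = 0")
    case True
    have "ip f g = 0"
    proof (rule ccontr)
      assume "ip f g \<noteq> 0"
      \<comment> \<open>In the degenerate case the quadratic is affine in its parameter, and this
        choice gives it the value -1.\<close>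
      then show False using quad[of "(ip f f + 1) / (2 * ip f g)"] True by (simp add: field_simps)
    qed
    then show ?thesis using nonneg assms by simp
  next
    case False
    then have "0 < ip g g" using nonneg[OF assms(2)] by simp
    \<comment> \<open>The minimiser of the quadratic.\<close>
    then show ?thesis using quad[of "ip f g / ip g g"] by (simp add: power2_eq_square field_simps)
  qed
  then have "sqrt ((ip f g)\<^sup>2) \<le> sqrt (ip f f * ip g g)" by (rule real_sqrt_le_mono)
  then show ?thesis by (simp add: nrm_def real_sqrt_mult)
qed

lemma nrm_triangle:
  assumes "f \<in> V" "g \<in> V"
  shows "nrm (\<lambda>x. f x + g x) \<le> nrm f + nrm g"
proof (rule power2_le_imp_le)
  have "(nrm (\<lambda>x. f x + g x))\<^sup>2 = (nrm f)\<^sup>2 + 2 * ip f g + (nrm g)\<^sup>2"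
    using assms by (simp add: nrm_square add add_left add_right commute[of g f])
  also have "\<dots> \<le> (nrm f + nrm g)\<^sup>2"
    using cauchy_schwarz[OF assms] by (simp add: power2_sum)
  finally show "(nrm (\<lambda>x. f x + g x))\<^sup>2 \<le> (nrm f + nrm g)\<^sup>2" .
qed (use assms nrm_nonneg in auto)

lemma nrm_triangle_diff:
  assumes "f \<in> V" "g \<in> V" "h \<in> V"
  shows "nrm (\<lambda>x. f x - h x) \<le> nrm (\<lambda>x. f x - g x) + nrm (\<lambda>x. g x - h x)"
  using nrm_triangle[of "\<lambda>x. f x - g x" "\<lambda>x. g x - h x"] assms by (simp add: diff)

lemma nrm_diff_le: "f \<in> V \<Longrightarrow> g \<in> V \<Longrightarrow> nrm (\<lambda>x. f x - g x) \<le> nrm f + nrm g"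
  using nrm_triangle[of f "\<lambda>x. - 1 * g x"] nrm_scale[of g "-1"] scale[of g "-1"] by simp

lemma nrm_reverse_triangle:
  assumes "f \<in> V" "g \<in> V"
  shows "\<bar>nrm f - nrm g\<bar> \<le> nrm (\<lambda>x. f x - g x)"
  using nrm_triangle[of "\<lambda>x. f x - g x" g] nrm_triangle[of "\<lambda>x. g x - f x" f] assms
    nrm_minus_commute[OF assms] by (simp add: diff)

lemma sum_closed: "(\<And>i. i < n \<Longrightarrow> u i \<in> V) \<Longrightarrow> (\<lambda>x. \<Sum>i<n::nat. u i x) \<in> V"
  by (induction n) (auto simp: zero add)

lemma sum_left:
  "(\<And>i. i < n \<Longrightarrow> u i \<in> V) \<Longrightarrow> g \<in> V \<Longrightarrow> ip (\<lambda>x. \<Sum>i<n::nat. u i x) g = (\<Sum>i<n. ip (u i) g)"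
proof (induction n)
  case 0
  then show ?case using scale_left[OF zero, of g 0] by simp
qed (simp add: add_left sum_closed)

text \<open>The double sum is the form evaluated on the sum of the \<open>u i\<close>. This supplies
  the hypothesis \<open>psd\<close> for kernels of the form \<open>ip (w s) (w t)\<close>.\<close>

lemma gram_nonneg:
  assumes u: "\<And>i. i < n \<Longrightarrow> u i \<in> V"
  shows "0 \<le> (\<Sum>i<n::nat. \<Sum>j<n. ip (u i) (u j))"
proof -
  let ?s = "\<lambda>x. \<Sum>i<n. u i x"
  have s: "?s \<in> V" by (rule sum_closed[OF u])
  have "0 \<le> ip ?s ?s" using s by (rule nonneg)
  also have "\<dots> = (\<Sum>i<n. ip (u i) ?s)" by (rule sum_left[OF u s])
  also have "\<dots> = (\<Sum>i<n. \<Sum>j<n. ip (u i) (u j))"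
  proof (intro sum.cong refl)
    fix i assume "i \<in> {..<n}"
    then have i: "u i \<in> V" using u by simp
    have "ip (u i) ?s = (\<Sum>j<n. ip (u j) (u i))"
      unfolding commute[OF i s] by (rule sum_left[OF u i])
    also have "\<dots> = (\<Sum>j<n. ip (u i) (u j))"
      using u i by (intro sum.cong refl commute) auto
    finally show "ip (u i) ?s = (\<Sum>j<n. ip (u i) (u j))" .
  qed
  finally show ?thesis .
qed

section \<open>Continuity and differentiation of forms along curves\<close>

lemma C0_curveD:
  assumes "C0_curve T V nrm u" "t \<in> {0..T}"
  shows "u t \<in> V" "((\<lambda>s. nrm (\<lambda>x. u s x - u t x)) \<longlongrightarrow> 0) (at t within {0..T})"
  using assms by (auto simp: C0_curve_def)

lemma C0_curve_bounded:
  assumes u: "C0_curve T V nrm u"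
  obtains M where "0 \<le> M" "\<And>t. t \<in> {0..T} \<Longrightarrow> nrm (u t) \<le> M"
proof -
  have "continuous_on {0..T} (\<lambda>t. nrm (u t))"
    unfolding continuous_on_def
  proof
    fix t assume t: "t \<in> {0..T}"
    have "((\<lambda>s. nrm (u s) - nrm (u t)) \<longlongrightarrow> 0) (at t within {0..T})"
      by (rule tendsto_zero_within[OF C0_curveD(2)[OF u t]]) (use nrm_reverse_triangle C0_curveD(1)[OF u] t in blast)
    then show "((\<lambda>t. nrm (u t)) \<longlongrightarrow> nrm (u t)) (at t within {0..T})" by (rule LIM_zero_cancel)
  qed
  then have "bounded ((\<lambda>t. nrm (u t)) ` {0..T})"
    by (intro compact_imp_bounded compact_continuous_image) auto
  then obtain M where M: "\<And>t. t \<in> {0..T} \<Longrightarrow> \<bar>nrm (u t)\<bar> \<le> M"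
    unfolding bounded_iff real_norm_def by blast
  have "nrm (u t) \<le> \<bar>M\<bar>" if "t \<in> {0..T}" for t using M[OF that] by linarith
  then show ?thesis by (intro that[of "\<bar>M\<bar>"]) auto
qed

text \<open>The increment is split as a(u(p) - u(s), v(q)) + a(u(s), v(q) - v(t)), where v(q) stays
  bounded by compactness. The form \<open>a\<close> is independent of \<open>ip\<close>, so the
  energy form can be used with the H^1 norm.\<close>

lemma continuous_on_bilinear:
  assumes u: "C0_curve T V nrm u" and v: "C0_curve T V nrm v"
    and bound: "\<And>f g. f \<in> V \<Longrightarrow> g \<in> V \<Longrightarrow> \<bar>a f g\<bar> \<le> C * (nrm f * nrm g)"
    and a_left: "\<And>f g k. f \<in> V \<Longrightarrow> g \<in> V \<Longrightarrow> k \<in> V \<Longrightarrow> a (\<lambda>x. f x - g x) k = a f k - a g k"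
    and a_right: "\<And>f g k. f \<in> V \<Longrightarrow> g \<in> V \<Longrightarrow> k \<in> V \<Longrightarrow> a k (\<lambda>x. f x - g x) = a k f - a k g"
  shows "continuous_on ({0..T} \<times> {0..T}) (\<lambda>(s, t). a (u s) (v t))"
  unfolding continuous_on_def
proof
  fix z assume z: "z \<in> {0..T} \<times> {0..T}"
  then obtain s t where st: "z = (s, t)" "s \<in> {0..T}" "t \<in> {0..T}" by auto
  let ?F = "at z within {0..T} \<times> {0..T}"
  obtain M where M: "0 \<le> M" "\<And>t. t \<in> {0..T} \<Longrightarrow> nrm (v t) \<le> M" by (rule C0_curve_bounded[OF v]) blast
  let ?g = "\<lambda>w. \<bar>C\<bar> * (nrm (\<lambda>x. u (fst w) x - u s x) * M) + \<bar>C\<bar> * (nrm (u s) * nrm (\<lambda>x. v (snd w) x - v t x))"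
  have cont: "((\<lambda>w. nrm (\<lambda>x. c (p w) x - c r x)) \<longlongrightarrow> 0) ?F"
    if c: "C0_curve T V nrm c" and r: "r \<in> {0..T}" and p: "(p \<longlongrightarrow> r) ?F" "\<And>w. w \<in> {0..T} \<times> {0..T} \<Longrightarrow> p w \<in> {0..T}"
    for c r p
  proof -
    \<comment> \<open>\<open>C0_curve\<close> only provides a limit that ignores the point
      \<open>r\<close>, whereas \<open>p\<close> may take the value \<open>r\<close>. The vanishing
      at \<open>r\<close> upgrades the limit to continuity there.\<close>
    have zero: "nrm (\<lambda>x. c r x - c r x) = 0" using nrm_scale[OF zero, of 0] by simp
    then have "continuous (at r within {0..T}) (\<lambda>q. nrm (\<lambda>x. c q x - c r x))"
      using C0_curveD(2)[OF c r] unfolding continuous_within by simp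
    moreover have "\<forall>\<^sub>F w in ?F. p w \<in> {0..T}" using p(2) by (simp add: eventually_at_filter)
    ultimately show ?thesis using continuous_within_tendsto_compose[OF _ _ p(1)] zero by fastforce
  qed
  have lim: "(?g \<longlongrightarrow> \<bar>C\<bar> * (0 * M) + \<bar>C\<bar> * (nrm (u s) * 0)) ?F"
  proof (intro tendsto_add tendsto_mult tendsto_const)
    show "((\<lambda>w. nrm (\<lambda>x. u (fst w) x - u s x)) \<longlongrightarrow> 0) ?F"
      by (rule cont[OF u st(2)]) (use tendsto_fst[OF tendsto_ident_at, of z] in \<open>auto simp: st(1)\<close>)
    show "((\<lambda>w. nrm (\<lambda>x. v (snd w) x - v t x)) \<longlongrightarrow> 0) ?F"
      by (rule cont[OF v st(3)]) (use tendsto_snd[OF tendsto_ident_at, of z] in \<open>auto simp: st(1)\<close>)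
  qed
  have "\<bar>a (u p) (v q) - a (u s) (v t)\<bar> \<le> ?g (p, q)" if "p \<in> {0..T}" "q \<in> {0..T}" for p q
  proof -
    have V: "u p \<in> V" "v q \<in> V" "u s \<in> V" "v t \<in> V" using C0_curveD(1) u v that st by auto
    have "\<bar>a (u p) (v q) - a (u s) (v t)\<bar> = \<bar>a (\<lambda>x. u p x - u s x) (v q) + a (u s) (\<lambda>x. v q x - v t x)\<bar>"
      using V by (simp add: a_left a_right)
    also have "\<dots> \<le> C * (nrm (\<lambda>x. u p x - u s x) * nrm (v q)) + C * (nrm (u s) * nrm (\<lambda>x. v q x - v t x))"
      using V by (intro order_trans[OF abs_triangle_ineq] add_mono bound diff)
    also have "\<dots> \<le> \<bar>C\<bar> * (nrm (\<lambda>x. u p x - u s x) * M) + \<bar>C\<bar> * (nrm (u s) * nrm (\<lambda>x. v q x - v t x))"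
    proof (intro add_mono mult_mono)
      show "nrm (v q) \<le> M" using M(2) that by auto
      show "0 \<le> nrm (v q)" "0 \<le> nrm (\<lambda>x. u p x - u s x)"
        "0 \<le> nrm (\<lambda>x. u p x - u s x) * nrm (v q)" "0 \<le> nrm (u s) * nrm (\<lambda>x. v q x - v t x)"
        using nrm_nonneg[OF V(2)] nrm_nonneg[OF V(3)] nrm_nonneg[OF diff[OF V(1,3)]] nrm_nonneg[OF diff[OF V(2,4)]] by auto
    qed (use nrm_nonneg[OF V(3)] nrm_nonneg[OF diff[OF V(2,4)]] in auto)
    finally show ?thesis by simp
  qed
  note bd = this
  have "(?g \<longlongrightarrow> 0) ?F" using lim by simp
  then have "((\<lambda>w. a (u (fst w)) (v (snd w)) - a (u s) (v t)) \<longlongrightarrow> 0) ?F"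
  proof (rule tendsto_zero_within)
    fix w assume "w \<in> {0..T} \<times> {0..T}"
    then show "\<bar>a (u (fst w)) (v (snd w)) - a (u s) (v t)\<bar> \<le> ?g w"
      using bd[of "fst w" "snd w"] by (auto simp: mem_Times_iff)
  qed
  then have "((\<lambda>w. a (u (fst w)) (v (snd w))) \<longlongrightarrow> a (u s) (v t)) ?F" by (rule LIM_zero_cancel)
  then show "((\<lambda>(s, t). a (u s) (v t)) \<longlongrightarrow> (case z of (s, t) \<Rightarrow> a (u s) (v t))) ?F"
    by (simp add: st(1) case_prod_unfold)
qed

lemma difference_quotient_closed: "f \<in> V \<Longrightarrow> g \<in> V \<Longrightarrow> (\<lambda>x. (f x - g x) / c) \<in> V"
  using scale[OF diff, of f g "1 / c"] by simp

lemma difference_quotient_left: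
  "f \<in> V \<Longrightarrow> g \<in> V \<Longrightarrow> k \<in> V \<Longrightarrow> ip (\<lambda>x. (f x - g x) / c) k = (ip f k - ip g k) / c"
  using scale_left[OF diff, of f g k "1 / c"] by (simp add: diff_left)

lemma ip_curve_deriv:
  assumes u: "C0_curve T V nrm u" and u': "C0_curve T V nrm u'" and D: "curve_deriv T nrm u u'"
    and k: "k \<in> V" and t: "t \<in> {0..T}"
  shows "((\<lambda>s. ip (u s) k) has_real_derivative ip (u' t) k) (at t within {0..T})"
proof -
  have "((\<lambda>s. nrm (\<lambda>x. (u s x - u t x) / (s - t) - u' t x)) \<longlongrightarrow> 0) (at t within {0..T})"
    using D t by (simp add: curve_deriv_def)
  from tendsto_mult_left_zero[OF this, of "nrm k"]
  have "((\<lambda>s. (ip (u s) k - ip (u t) k) / (s - t) - ip (u' t) k) \<longlongrightarrow> 0) (at t within {0..T})"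
  proof (rule tendsto_zero_within)
    fix s assume "s \<in> {0..T}"
    then have V: "u s \<in> V" "u t \<in> V" "u' t \<in> V" using C0_curveD(1) u u' t by auto
    have "(ip (u s) k - ip (u t) k) / (s - t) - ip (u' t) k = ip (\<lambda>x. (u s x - u t x) / (s - t) - u' t x) k"
      unfolding diff_left[OF difference_quotient_closed[OF V(1,2)] V(3) k] difference_quotient_left[OF V(1,2) k] by simp
    then show "\<bar>(ip (u s) k - ip (u t) k) / (s - t) - ip (u' t) k\<bar> \<le> nrm (\<lambda>x. (u s x - u t x) / (s - t) - u' t x) * nrm k"
      using cauchy_schwarz[OF diff[OF difference_quotient_closed[OF V(1,2)] V(3)] k] by simp
  qed
  then show ?thesis unfolding has_field_derivative_iff by (rule LIM_zero_cancel)
qed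

text \<open>Instead of a product rule, the square is expanded around \<open>t\<close>: |u(s)|^2 =
  |u(s) - u(t)|^2 + 2 <u(s), u(t)> - |u(t)|^2. The first term is of smaller order than s - t, and
  the second is covered by \<open>ip_curve_deriv\<close>.\<close>

lemma ip_self_curve_deriv:
  assumes u: "C0_curve T V nrm u" and u': "C0_curve T V nrm u'" and D: "curve_deriv T nrm u u'"
    and t: "t \<in> {0..T}"
  shows "((\<lambda>s. ip (u s) (u s)) has_real_derivative 2 * ip (u' t) (u t)) (at t within {0..T})"
proof -
  let ?F = "at t within {0..T}"
  define d where "d s = (\<lambda>x. (u s x - u t x) / (s - t))" for s
  have ut: "u t \<in> V" "u' t \<in> V" using C0_curveD(1) u u' t by auto
  have "((\<lambda>s. nrm (\<lambda>x. d s x - u' t x)) \<longlongrightarrow> 0) ?F"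
    using D t by (simp add: curve_deriv_def d_def)
  from tendsto_mult[OF tendsto_add[OF this tendsto_const[of "nrm (u' t)"]] C0_curveD(2)[OF u t]]
  have "((\<lambda>s. (nrm (\<lambda>x. d s x - u' t x) + nrm (u' t)) * nrm (\<lambda>x. u s x - u t x)) \<longlongrightarrow> 0) ?F" by simp
  \<comment> \<open>Up to sign the quotient is the norm of the difference quotient, which is bounded
    near \<open>t\<close>, times the norm of the increment, which tends to zero.\<close>
  then have "((\<lambda>s. (nrm (\<lambda>x. u s x - u t x))\<^sup>2 / (s - t)) \<longlongrightarrow> 0) ?F"
  proof (rule tendsto_zero_within)
    fix s assume s: "s \<in> {0..T}"
    have us: "u s \<in> V" by (rule C0_curveD(1)[OF u s])
    have dV: "d s \<in> V" unfolding d_def by (rule difference_quotient_closed[OF us ut(1)])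
    have "nrm (d s) = nrm (\<lambda>x. u s x - u t x) / \<bar>s - t\<bar>"
      using nrm_scale[OF diff[OF us ut(1)], of "1 / (s - t)"] by (simp add: d_def)
    then have "\<bar>(nrm (\<lambda>x. u s x - u t x))\<^sup>2 / (s - t)\<bar> = nrm (d s) * nrm (\<lambda>x. u s x - u t x)"
      by (simp add: abs_divide power2_eq_square)
    also have "\<dots> \<le> (nrm (\<lambda>x. d s x - u' t x) + nrm (u' t)) * nrm (\<lambda>x. u s x - u t x)"
      using nrm_triangle[OF diff[OF dV ut(2)] ut(2)] nrm_nonneg[OF diff[OF us ut(1)]] by (intro mult_right_mono) simp_all
    finally show "\<bar>(nrm (\<lambda>x. u s x - u t x))\<^sup>2 / (s - t)\<bar> \<le> (nrm (\<lambda>x. d s x - u' t x) + nrm (u' t)) * nrm (\<lambda>x. u s x - u t x)" .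
  qed
  moreover have "nrm (\<lambda>x. u t x - u t x) = 0" using nrm_scale[OF zero, of 0] by simp
  ultimately have "((\<lambda>s. (nrm (\<lambda>x. u s x - u t x))\<^sup>2) has_real_derivative 0) ?F"
    by (simp add: has_field_derivative_iff)
  from DERIV_add[OF this DERIV_diff[OF DERIV_cmult[OF ip_curve_deriv[OF u u' D ut(1) t], of 2] DERIV_const[of "ip (u t) (u t)"]]]
  have deriv: "((\<lambda>s. (nrm (\<lambda>x. u s x - u t x))\<^sup>2 + (2 * ip (u s) (u t) - ip (u t) (u t))) has_real_derivative 2 * ip (u' t) (u t)) ?F"
    by simp
  have eq: "ip (u s) (u s) = (nrm (\<lambda>x. u s x - u t x))\<^sup>2 + (2 * ip (u s) (u t) - ip (u t) (u t))" if "s \<in> {0..T}" for s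
  proof -
    have us: "u s \<in> V" by (rule C0_curveD(1)[OF u that])
    show ?thesis
      unfolding nrm_square[OF diff[OF us ut(1)]] diff_left[OF us ut(1) diff[OF us ut(1)]]
        diff_right[OF us ut(1) us] diff_right[OF us ut(1) ut(1)] commute[OF ut(1) us] by linarith
  qed
  show ?thesis
    unfolding has_field_derivative_def
    by (rule has_derivative_transform[OF t eq deriv[unfolded has_field_derivative_def]])
qed

end

section \<open>Mollification in $L^2$\<close>

lemma L2_iff: "f \<in> L2_space \<longleftrightarrow> f \<in> borel_measurable borel \<and> integrable lborel (\<lambda>x. (f x)\<^sup>2)"
  by (simp add: L2_space_def)

lemma L2_measurable: "f \<in> L2_space \<Longrightarrow> f \<in> borel_measurable borel"
  by (simp add: L2_iff)

lemma L2_dominated: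
  assumes "f \<in> borel_measurable borel" "integrable lborel h" "AE x in lborel. (f x)\<^sup>2 \<le> h x"
  shows "f \<in> L2_space"
  unfolding L2_iff
proof
  show "integrable lborel (\<lambda>x. (f x)\<^sup>2)"
  proof (rule Bochner_Integration.integrable_bound[OF assms(2)])
    show "AE x in lborel. norm ((f x)\<^sup>2) \<le> norm (h x)"
      using assms(3) by eventually_elim simp
  qed (use assms(1) in measurable)
qed (rule assms(1))

lemma L2_mult_integrable:
  assumes "f \<in> L2_space" "g \<in> L2_space"
  shows "integrable lborel (\<lambda>x. f x * g x)"
proof (rule Bochner_Integration.integrable_bound)
  show "integrable lborel (\<lambda>x. (f x)\<^sup>2 + (g x)\<^sup>2)" using assms by (simp add: L2_iff)
  have "\<bar>f x * g x\<bar> \<le> (f x)\<^sup>2 + (g x)\<^sup>2" for x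
  proof -
    have "2 * \<bar>f x * g x\<bar> \<le> (f x)\<^sup>2 + (g x)\<^sup>2"
      using sum_squares_bound[of "\<bar>f x\<bar>" "\<bar>g x\<bar>"] by (simp add: abs_mult)
    then show ?thesis by linarith
  qed
  then show "AE x in lborel. norm (f x * g x) \<le> norm ((f x)\<^sup>2 + (g x)\<^sup>2)" by simp
  show "(\<lambda>x. f x * g x) \<in> borel_measurable lborel" using assms[THEN L2_measurable] by simp
qed

lemma L2_add:
  assumes "f \<in> L2_space" "g \<in> L2_space"
  shows "(\<lambda>x. f x + g x) \<in> L2_space"
proof (rule L2_dominated)
  show "integrable lborel (\<lambda>x. (f x)\<^sup>2 + 2 * (f x * g x) + (g x)\<^sup>2)"
    using assms L2_mult_integrable[OF assms] by (simp add: L2_iff)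
qed (use assms[THEN L2_measurable] in \<open>simp_all add: power2_sum\<close>)

interpretation L2: semi_inner "L2_space :: ('a::euclidean_space \<Rightarrow> real) set" "\<lambda>f g. \<integral>x. f x * g x \<partial>lborel"
  rewrites "semi_inner.nrm (\<lambda>f g. \<integral>x. f x * g x \<partial>(lborel :: 'a measure)) = L2_norm"
proof -
  show *: "semi_inner (L2_space :: ('a \<Rightarrow> real) set) (\<lambda>f g. \<integral>x. f x * g x \<partial>lborel)"
  proof
    show "(\<lambda>x. c * f x) \<in> L2_space" if "f \<in> L2_space" for c and f :: "'a \<Rightarrow> real"
      using that by (auto simp: L2_iff power_mult_distrib intro!: borel_measurable_times)
    show "(\<integral>x. (f x + g x) * k x \<partial>lborel) = (\<integral>x. f x * k x \<partial>lborel) + (\<integral>x. g x * k x \<partial>lborel)"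
      if "f \<in> L2_space" "g \<in> L2_space" "k \<in> L2_space" for f g k :: "'a \<Rightarrow> real"
      using that by (simp add: distrib_right L2_mult_integrable)
    show "(\<lambda>x. f x + g x) \<in> L2_space" if "f \<in> L2_space" "g \<in> L2_space" for f g :: "'a \<Rightarrow> real"
      using that by (rule L2_add)
    show "(\<integral>x. c * f x * k x \<partial>lborel) = c * (\<integral>x. f x * k x \<partial>lborel)" for c and f k :: "'a \<Rightarrow> real"
      by (simp add: mult.assoc)
  qed (auto simp: L2_iff mult.commute)
  then show "semi_inner.nrm (\<lambda>f g. \<integral>x. f x * g x \<partial>(lborel :: 'a measure)) = L2_norm"
    by (simp add: semi_inner.nrm_def L2_norm_def fun_eq_iff power2_eq_square)
qed

lemma L2_norm_cong_AE:
  assumes "f \<in> borel_measurable borel" "g \<in> borel_measurable borel" "AE x in lborel. f x = g x"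
  shows "L2_norm f = L2_norm g"
  unfolding L2_norm_def using assms by (intro arg_cong[where f = sqrt] integral_cong_AE) auto

lemma L2_cong_AE:
  assumes "f \<in> L2_space" "g \<in> borel_measurable borel" "AE x in lborel. f x = g x"
  shows "g \<in> L2_space"
proof (rule L2_dominated[OF assms(2)])
  show "integrable lborel (\<lambda>x. (f x)\<^sup>2)" using assms(1) by (simp add: L2_iff)
qed (use assms(3) in auto)

lemma integrable_indicator_compact: "compact K \<Longrightarrow> integrable lborel (indicator K :: 'a::euclidean_space \<Rightarrow> real)"
  using emeasure_bounded_finite[OF compact_imp_bounded] by (intro integrable_real_indicator) (auto simp: borel_compact)

lemma L2_locally_integrable:
  assumes "f \<in> L2_space"
  shows "locally_integrable f"
  unfolding locally_integrable_def
proof (intro allI impI)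
  fix K :: "'a set" assume K: "compact K"
  have "(indicator K :: 'a \<Rightarrow> real) \<in> L2_space"
    using K by (simp add: L2_iff power2_eq_square integrable_indicator_compact borel_compact borel_measurable_indicator flip: indicator_inter_arith)
  from L2_mult_integrable[OF this assms] show "set_integrable lborel K f"
    by (simp add: set_integrable_def)
qed

text \<open>Local integrability makes the restrictions to balls measurable, and the function is
  their pointwise limit.\<close>

lemma locally_integrable_measurable:
  fixes f :: "'a::euclidean_space \<Rightarrow> real"
  assumes "locally_integrable f"
  shows "f \<in> borel_measurable borel"
proof (rule borel_measurable_LIMSEQ_real)
  show "(\<lambda>n. indicator (cball 0 (real n)) x *\<^sub>R f x) \<longlonglongrightarrow> f x" for x
  proof (rule tendsto_eventually)
    have "\<forall>\<^sub>F n in sequentially. norm x \<le> real n"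
      using eventually_ge_at_top[of "nat \<lceil>norm x\<rceil>"] by eventually_elim linarith
    then show "\<forall>\<^sub>F n in sequentially. indicator (cball 0 (real n)) x *\<^sub>R f x = f x"
      by eventually_elim simp
  qed
  show "(\<lambda>x. indicator (cball 0 (real n)) x *\<^sub>R f x) \<in> borel_measurable borel" for n
    using assms borel_measurable_integrable[of lborel "\<lambda>x. indicator (cball 0 (real n)) x *\<^sub>R f x"]
    by (simp add: locally_integrable_def set_integrable_def)
qed

lemma indicator_locally_integrable:
  "A \<in> sets borel \<Longrightarrow> locally_integrable (indicator A :: 'a::euclidean_space \<Rightarrow> real)"
  unfolding locally_integrable_def set_integrable_def
  by (auto intro!: integrable_real_mult_indicator[where 'a = 'a] simp: integrable_indicator_compact borel_compact mult.commute)

lemma integral_lborel_affine: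
  fixes f :: "'a::euclidean_space \<Rightarrow> real"
  assumes "f \<in> borel_measurable borel" "c \<noteq> 0"
  shows "(\<integral>x. f x \<partial>lborel) = \<bar>c\<bar> ^ DIM('a) * (\<integral>x. f (t + c *\<^sub>R x) \<partial>lborel)"
  using assms by (subst lborel_affine[OF assms(2), of t]) (simp add: integral_density integral_distr)

lemma nn_integral_lborel_reflect:
  fixes f :: "'a::euclidean_space \<Rightarrow> ennreal"
  assumes "f \<in> borel_measurable borel"
  shows "(\<integral>\<^sup>+x. f (x - t) \<partial>lborel) = (\<integral>\<^sup>+x. f x \<partial>lborel)" "(\<integral>\<^sup>+x. f (t - x) \<partial>lborel) = (\<integral>\<^sup>+x. f x \<partial>lborel)"
proof -
  have [measurable, simp]: "(-) t \<in> borel_measurable borel" by simp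
  show "(\<integral>\<^sup>+x. f (x - t) \<partial>lborel) = (\<integral>\<^sup>+x. f x \<partial>lborel)" using assms
    by (subst (2) lborel_affine[of 1 "-t"], simp, simp add: nn_integral_density nn_integral_distr)
  show "(\<integral>\<^sup>+x. f (t - x) \<partial>lborel) = (\<integral>\<^sup>+x. f x \<partial>lborel)" using assms
    by (subst (2) lborel_affine[of "-1" "t"], simp, simp add: nn_integral_density nn_integral_distr density_1)
qed

section \<open>Averaging with a single kernel\<close>

locale averaging_kernel =
  fixes \<rho> :: "'a::euclidean_space \<Rightarrow> real"
  assumes test: "\<rho> \<in> test_functions" and nonneg: "0 \<le> \<rho> x" and mass: "(\<integral>x. \<rho> x \<partial>lborel) = 1"
begin

lemma measurable: "\<rho> \<in> borel_measurable borel"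
  by (rule test_function_measurable[OF test])

lemma integrable: "integrable lborel \<rho>"
  using mass not_integrable_integral_eq by fastforce

lemma nn_mass: "(\<integral>\<^sup>+x. ennreal (\<rho> x) \<partial>lborel) = 1"
  using nn_integral_eq_integral[OF integrable] nonneg mass by simp

lemma integral_reflect: "integrable lborel (\<lambda>y. \<rho> (x - y))" "(\<integral>y. \<rho> (x - y) \<partial>lborel) = 1"
proof -
  have n: "(\<integral>\<^sup>+y. ennreal (\<rho> (x - y)) \<partial>lborel) = 1"
    using nn_integral_lborel_reflect(2)[of "\<lambda>x. ennreal (\<rho> x)" x] measurable nn_mass by simp
  have m: "(\<lambda>y. \<rho> (x - y)) \<in> borel_measurable lborel" using measurable by measurable
  show "integrable lborel (\<lambda>y. \<rho> (x - y))"
    using n m nonneg by (intro integrableI_nonneg) auto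
  show "(\<integral>y. \<rho> (x - y) \<partial>lborel) = 1"
    using n m nonneg by (subst integral_eq_nn_integral) auto
qed

text \<open>Jensen's inequality for the probability density \<open>\<rho> (x - y)\<close>, derived
  from the nonnegativity of the variance of \<open>f\<close> around its mean
  \<open>conv f \<rho> x\<close>.\<close>

lemma conv_square_le:
  assumes f: "f \<in> L2_space"
  shows "integrable lborel (\<lambda>y. (f y)\<^sup>2 * \<rho> (x - y))" "(conv f \<rho> x)\<^sup>2 \<le> (\<integral>y. (f y)\<^sup>2 * \<rho> (x - y) \<partial>lborel)"
proof -
  have "locally_integrable (\<lambda>y. (f y)\<^sup>2)"
    using f unfolding L2_iff locally_integrable_def set_integrable_def
    by (intro allI impI integrable_mult_indicator) (auto simp: borel_compact)
  from integrable_conv[OF this test]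
  show int: "integrable lborel (\<lambda>y. (f y)\<^sup>2 * \<rho> (x - y))" .
  have int1: "integrable lborel (\<lambda>y. f y * \<rho> (x - y))"
    by (rule integrable_conv[OF L2_locally_integrable[OF f] test])
  define c where "c = conv f \<rho> x"
  have "0 \<le> (\<integral>y. (f y - c)\<^sup>2 * \<rho> (x - y) \<partial>lborel)"
    using nonneg by (intro integral_nonneg_AE) auto
  also have "\<dots> = (\<integral>y. (f y)\<^sup>2 * \<rho> (x - y) - 2 * c * (f y * \<rho> (x - y)) + c\<^sup>2 * \<rho> (x - y) \<partial>lborel)"
    by (intro Bochner_Integration.integral_cong) (auto simp: power2_eq_square algebra_simps)
  also have "\<dots> = (\<integral>y. (f y)\<^sup>2 * \<rho> (x - y) \<partial>lborel) - 2 * c * c + c\<^sup>2"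
    using int int1 integral_reflect[of x] by (simp add: c_def conv_def)
  finally show "(conv f \<rho> x)\<^sup>2 \<le> (\<integral>y. (f y)\<^sup>2 * \<rho> (x - y) \<partial>lborel)"
    by (simp add: c_def power2_eq_square)
qed

text \<open>Integrate the Jensen bound over x and exchange the integrals; the inner one is then the
  mass of the kernel. The contraction property makes the class of approximable functions closed in
  L^2.\<close>

lemma conv_L2:
  assumes f: "f \<in> L2_space"
  shows "conv f \<rho> \<in> L2_space" and "L2_norm (conv f \<rho>) \<le> L2_norm f"
proof -
  have cm: "conv f \<rho> \<in> borel_measurable borel"
    by (intro borel_measurable_continuous_onI smooth_continuous_on smooth_conv L2_locally_integrable f test)
  note [measurable] = L2_measurable[OF f] measurable
  have "(\<integral>\<^sup>+x. ennreal ((conv f \<rho> x)\<^sup>2) \<partial>lborel) \<le> (\<integral>\<^sup>+x. (\<integral>\<^sup>+y. ennreal ((f y)\<^sup>2 * \<rho> (x - y)) \<partial>lborel) \<partial>lborel)"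
  proof (rule nn_integral_mono)
    fix x
    have "(\<integral>\<^sup>+y. ennreal ((f y)\<^sup>2 * \<rho> (x - y)) \<partial>lborel) = ennreal (\<integral>y. (f y)\<^sup>2 * \<rho> (x - y) \<partial>lborel)"
      using conv_square_le(1)[OF f] nonneg by (intro nn_integral_eq_integral) auto
    then show "ennreal ((conv f \<rho> x)\<^sup>2) \<le> (\<integral>\<^sup>+y. ennreal ((f y)\<^sup>2 * \<rho> (x - y)) \<partial>lborel)"
      using conv_square_le(2)[OF f] by (simp add: ennreal_leI)
  qed
  also have "\<dots> = (\<integral>\<^sup>+y. (\<integral>\<^sup>+x. ennreal ((f y)\<^sup>2 * \<rho> (x - y)) \<partial>lborel) \<partial>lborel)"
    by (rule lborel_pair.Fubini'[symmetric]) measurable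
  also have "\<dots> = (\<integral>\<^sup>+y. ennreal ((f y)\<^sup>2) * (\<integral>\<^sup>+x. ennreal (\<rho> (x - y)) \<partial>lborel) \<partial>lborel)"
    by (simp add: ennreal_mult nonneg nn_integral_cmult)
  also have "\<dots> = (\<integral>\<^sup>+y. ennreal ((f y)\<^sup>2) \<partial>lborel)"
    using nn_integral_lborel_reflect(1)[of "\<lambda>x. ennreal (\<rho> x)"] nn_mass by simp
  also have "\<dots> = ennreal (\<integral>y. (f y)\<^sup>2 \<partial>lborel)"
    using f by (intro nn_integral_eq_integral) (auto simp: L2_iff)
  finally have le: "(\<integral>\<^sup>+x. ennreal ((conv f \<rho> x)\<^sup>2) \<partial>lborel) \<le> ennreal (\<integral>y. (f y)\<^sup>2 \<partial>lborel)" .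
  have int: "integrable lborel (\<lambda>x. (conv f \<rho> x)\<^sup>2)"
    using cm le by (intro integrableI_nonneg) (auto simp: le_less_trans)
  then show "conv f \<rho> \<in> L2_space" using cm by (simp add: L2_iff)
  have "(\<integral>\<^sup>+x. ennreal ((conv f \<rho> x)\<^sup>2) \<partial>lborel) = ennreal (\<integral>x. (conv f \<rho> x)\<^sup>2 \<partial>lborel)"
    using int by (intro nn_integral_eq_integral) auto
  then have "(\<integral>x. (conv f \<rho> x)\<^sup>2 \<partial>lborel) \<le> (\<integral>y. (f y)\<^sup>2 \<partial>lborel)"
    using le by simp
  then show "L2_norm (conv f \<rho>) \<le> L2_norm f" by (simp add: L2_norm_def)
qed

lemma conv_indicator_bounds:
  assumes "A \<in> sets borel"
  shows "0 \<le> conv (indicator A) \<rho> x" "conv (indicator A) \<rho> x \<le> 1"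
proof -
  show "0 \<le> conv (indicator A) \<rho> x"
    unfolding conv_def using nonneg by (intro integral_nonneg_AE) auto
  have "conv (indicator A) \<rho> x \<le> (\<integral>y. \<rho> (x - y) \<partial>lborel)"
    unfolding conv_def
    using integral_reflect(1) integrable_conv[OF indicator_locally_integrable[OF assms] test] nonneg
    by (intro integral_mono) (auto simp: indicator_def)
  then show "conv (indicator A) \<rho> x \<le> 1" by (simp add: integral_reflect(2))
qed

lemma conv_const_near:
  assumes "\<And>x. r < norm x \<Longrightarrow> \<rho> x = 0" "\<And>y. norm (x - y) \<le> r \<Longrightarrow> f y = c"
  shows "conv f \<rho> x = c"
proof -
  have "f y * \<rho> (x - y) = c * \<rho> (x - y)" for y
    using assms(1)[of "x - y"] assms(2)[of y] by (cases "norm (x - y) \<le> r") auto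
  then have "conv f \<rho> x = (\<integral>y. c * \<rho> (x - y) \<partial>lborel)" unfolding conv_def by (simp only:)
  then show ?thesis by (simp add: integral_reflect)
qed

end


section \<open>Convergence of mollifications in the mean square\<close>

lemma conv_diff:
  assumes "locally_integrable f" "locally_integrable g" "\<rho> \<in> test_functions"
  shows "conv (\<lambda>x. f x - g x) \<rho> x = conv f \<rho> x - conv g \<rho> x"
  using assms by (simp add: conv_def left_diff_distrib integrable_conv)

lemma conv_add:
  assumes "locally_integrable f" "locally_integrable g" "\<rho> \<in> test_functions"
  shows "conv (\<lambda>x. f x + g x) \<rho> x = conv f \<rho> x + conv g \<rho> x"
  using assms by (simp add: conv_def distrib_right integrable_conv)

lemma conv_cmult: "conv (\<lambda>x. c * f x) \<rho> x = c * conv f \<rho> x"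
  by (simp add: conv_def mult.assoc)

text \<open>Besides shrinking supports, \<open>radius_le\<close> confines all kernels to one ball,
  so that the convolutions of a function with bounded support share a bounded support.\<close>

locale approximate_identity =
  fixes \<rho> :: "nat \<Rightarrow> 'a::euclidean_space \<Rightarrow> real" and r :: "nat \<Rightarrow> real"
  assumes kernel: "averaging_kernel (\<rho> k)"
    and support: "r k < norm x \<Longrightarrow> \<rho> k x = 0" and radius_lim: "r \<longlonglongrightarrow> 0" and radius_le: "r k \<le> r 0"
begin

lemma test: "\<rho> k \<in> test_functions"
  by (rule averaging_kernel.test[OF kernel])

lemma conv_locally_const:
  assumes "open U" "x \<in> U" "\<And>y. y \<in> U \<Longrightarrow> f y = c"
  shows "\<forall>\<^sub>F k in sequentially. conv f (\<rho> k) x = c"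
proof -
  obtain e where e: "e > 0" "ball x e \<subseteq> U" using assms by (meson openE)
  have "\<forall>\<^sub>F k in sequentially. r k < e" by (rule order_tendstoD(2)[OF radius_lim \<open>e > 0\<close>])
  then show ?thesis
  proof eventually_elim
    case (elim k)
    show ?case
    proof (rule averaging_kernel.conv_const_near[OF kernel support])
      fix y assume "norm (x - y) \<le> r k"
      then have "y \<in> ball x e" using elim by (simp add: dist_norm)
      then show "f y = c" using e assms(3) by auto
    qed
  qed
qed

definition approximated :: "('a \<Rightarrow> real) \<Rightarrow> bool" where
  "approximated f \<longleftrightarrow> f \<in> L2_space \<and> (\<lambda>k. L2_norm (\<lambda>x. conv f (\<rho> k) x - f x)) \<longlonglongrightarrow> 0"

text \<open>A three-term estimate: the error for \<open>g\<close> is small, and since convolution is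
  a contraction, replacing \<open>f\<close> by \<open>g\<close> costs at most their distance on
  either side.\<close>

lemma approximated_limit:
  assumes f: "f \<in> L2_space" and g: "\<And>e. e > 0 \<Longrightarrow> \<exists>g. approximated g \<and> L2_norm (\<lambda>x. f x - g x) < e"
  shows "approximated f"
proof -
  have "(\<lambda>k. L2_norm (\<lambda>x. conv f (\<rho> k) x - f x)) \<longlonglongrightarrow> 0"
  proof (rule LIMSEQ_I)
    fix e :: real assume "e > 0"
    then obtain g where g: "approximated g" "L2_norm (\<lambda>x. f x - g x) < e / 3" using g[of "e / 3"] by auto
    then have gL: "g \<in> L2_space" by (simp add: approximated_def)
    have "(\<lambda>k. L2_norm (\<lambda>x. conv g (\<rho> k) x - g x)) \<longlonglongrightarrow> 0" using g(1) by (simp add: approximated_def)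
    then have "\<forall>\<^sub>F k in sequentially. L2_norm (\<lambda>x. conv g (\<rho> k) x - g x) < e / 3"
      using \<open>e > 0\<close> by (intro order_tendstoD(2)[of _ 0]) auto
    then obtain k0 where k0: "\<And>k. k \<ge> k0 \<Longrightarrow> L2_norm (\<lambda>x. conv g (\<rho> k) x - g x) < e / 3"
      unfolding eventually_sequentially by blast
    show "\<exists>k0. \<forall>k\<ge>k0. norm (L2_norm (\<lambda>x. conv f (\<rho> k) x - f x) - 0) < e"
    proof (intro exI allI impI)
      fix k assume "k0 \<le> k"
      note contraction = averaging_kernel.conv_L2[OF kernel, of _ k]
      have L: "conv f (\<rho> k) \<in> L2_space" "conv g (\<rho> k) \<in> L2_space" using f gL contraction by auto
      have fg: "(\<lambda>x. f x - g x) \<in> L2_space" by (rule L2.diff[OF f gL])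
      have "L2_norm (\<lambda>x. conv f (\<rho> k) x - f x) \<le> L2_norm (\<lambda>x. conv f (\<rho> k) x - conv g (\<rho> k) x) + L2_norm (\<lambda>x. conv g (\<rho> k) x - f x)"
        by (rule L2.nrm_triangle_diff[OF L f])
      also have "(\<lambda>x. conv f (\<rho> k) x - conv g (\<rho> k) x) = conv (\<lambda>x. f x - g x) (\<rho> k)"
        using f gL by (simp add: conv_diff[OF L2_locally_integrable L2_locally_integrable test] fun_eq_iff)
      also have "L2_norm (\<lambda>x. conv g (\<rho> k) x - f x) \<le> L2_norm (\<lambda>x. conv g (\<rho> k) x - g x) + L2_norm (\<lambda>x. g x - f x)"
        by (rule L2.nrm_triangle_diff[OF L(2) gL f])
      finally have "L2_norm (\<lambda>x. conv f (\<rho> k) x - f x) < e / 3 + (e / 3 + e / 3)"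
        using contraction(2)[OF fg] g(2) k0[OF \<open>k0 \<le> k\<close>] L2.nrm_minus_commute[OF f gL] by linarith
      then show "norm (L2_norm (\<lambda>x. conv f (\<rho> k) x - f x) - 0) < e"
        using L2.nrm_nonneg[OF L2.diff[OF L(1) f]] by simp
    qed
  qed
  then show ?thesis using f by (simp add: approximated_def)
qed

lemma approximated_cmult:
  assumes "approximated f"
  shows "approximated (\<lambda>x. c * f x)"
proof -
  have f: "f \<in> L2_space" using assms by (simp add: approximated_def)
  have "L2_norm (\<lambda>x. conv (\<lambda>x. c * f x) (\<rho> k) x - c * f x) = \<bar>c\<bar> * L2_norm (\<lambda>x. conv f (\<rho> k) x - f x)" for k
    using L2.nrm_scale[OF L2.diff[OF averaging_kernel.conv_L2(1)[OF kernel f] f], where c = c]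
    by (simp add: conv_cmult right_diff_distrib)
  then show ?thesis
    using assms by (auto simp: approximated_def L2.scale intro!: tendsto_mult_right_zero)
qed

lemma approximated_add:
  assumes "approximated f" "approximated g"
  shows "approximated (\<lambda>x. f x + g x)"
proof -
  have fg: "f \<in> L2_space" "g \<in> L2_space" using assms by (auto simp: approximated_def)
  have "(\<lambda>k. L2_norm (\<lambda>x. conv (\<lambda>x. f x + g x) (\<rho> k) x - (f x + g x))) \<longlonglongrightarrow> 0"
  proof (rule tendsto_zero_sequentially)
    show "(\<lambda>k. L2_norm (\<lambda>x. conv f (\<rho> k) x - f x) + L2_norm (\<lambda>x. conv g (\<rho> k) x - g x)) \<longlonglongrightarrow> 0"
      using assms by (intro tendsto_add_zero) (auto simp: approximated_def)
    fix k
    have d: "(\<lambda>x. conv f (\<rho> k) x - f x) \<in> L2_space" "(\<lambda>x. conv g (\<rho> k) x - g x) \<in> L2_space"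
      using fg averaging_kernel.conv_L2(1)[OF kernel] by (auto intro: L2.diff)
    have "(\<lambda>x. conv (\<lambda>x. f x + g x) (\<rho> k) x - (f x + g x)) = (\<lambda>x. (conv f (\<rho> k) x - f x) + (conv g (\<rho> k) x - g x))"
      using fg by (simp add: conv_add[OF L2_locally_integrable L2_locally_integrable test] fun_eq_iff)
    then show "\<bar>L2_norm (\<lambda>x. conv (\<lambda>x. f x + g x) (\<rho> k) x - (f x + g x))\<bar>
        \<le> L2_norm (\<lambda>x. conv f (\<rho> k) x - f x) + L2_norm (\<lambda>x. conv g (\<rho> k) x - g x)"
      using L2.nrm_triangle[OF d] L2.nrm_nonneg[OF L2.add[OF d]] by simp
  qed
  then show ?thesis using fg by (simp add: approximated_def L2.add)
qed

lemma indicator_L2: "A \<in> sets borel \<Longrightarrow> emeasure lborel A < \<infinity> \<Longrightarrow> indicator A \<in> (L2_space :: ('a \<Rightarrow> real) set)"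
  by (simp add: L2_iff power2_eq_square integrable_real_indicator flip: indicator_inter_arith)

text \<open>At a point of an open set the convolution equals 1 for all large \<open>k\<close>. Off
  \<open>U\<close> there is no such pointwise information, as the boundary may have positive
  measure; there the contraction bound takes over.\<close>

lemma approximated_open:
  assumes U: "open U" "emeasure lborel U < \<infinity>"
  shows "approximated (indicator U)"
proof -
  let ?f = "indicator U :: 'a \<Rightarrow> real"
  have [measurable]: "U \<in> sets borel" using U by simp
  have f: "?f \<in> L2_space" by (rule indicator_L2) (use U in auto)
  have g: "conv ?f (\<rho> k) \<in> L2_space" "L2_norm (conv ?f (\<rho> k)) \<le> L2_norm ?f" for k
    using averaging_kernel.conv_L2[OF kernel f] by auto
  have int: "integrable lborel (\<lambda>x. ?f x)" using U by (intro integrable_real_indicator) auto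
  have lim: "(\<lambda>k. \<integral>x. conv ?f (\<rho> k) x * ?f x \<partial>lborel) \<longlonglongrightarrow> (\<integral>x. ?f x \<partial>lborel)"
  proof (rule integral_dominated_convergence[OF _ _ int])
    show "AE x in lborel. (\<lambda>k. conv ?f (\<rho> k) x * ?f x) \<longlonglongrightarrow> ?f x"
    proof (intro always_eventually allI)
      fix x
      show "(\<lambda>k. conv ?f (\<rho> k) x * ?f x) \<longlonglongrightarrow> ?f x"
      proof (cases "x \<in> U")
        case True
        have "\<forall>\<^sub>F k in sequentially. conv ?f (\<rho> k) x = 1"
          by (rule conv_locally_const[OF U(1) True]) simp
        then have "\<forall>\<^sub>F k in sequentially. conv ?f (\<rho> k) x * ?f x = ?f x" by eventually_elim simp
        then show ?thesis by (rule tendsto_eventually)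
      qed simp
    qed
    show "AE x in lborel. norm (conv ?f (\<rho> k) x * ?f x) \<le> ?f x" for k
      using averaging_kernel.conv_indicator_bounds[OF kernel, of U k]
      by (intro always_eventually allI) (simp add: indicator_def)
    show "(\<lambda>x. conv ?f (\<rho> k) x * ?f x) \<in> borel_measurable lborel" for k
      using L2_measurable[OF g(1)[of k]] by simp
  qed simp
  \<comment> \<open>Expanding the square, the contraction property reduces norm convergence to the limit above.\<close>
  have sq: "(L2_norm (\<lambda>x. conv ?f (\<rho> k) x - ?f x))\<^sup>2 \<le> 2 * (L2_norm ?f)\<^sup>2 - 2 * (\<integral>x. conv ?f (\<rho> k) x * ?f x \<partial>lborel)" for k
  proof -
    have "(L2_norm (\<lambda>x. conv ?f (\<rho> k) x - ?f x))\<^sup>2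
      = (L2_norm (conv ?f (\<rho> k)))\<^sup>2 - 2 * (\<integral>x. conv ?f (\<rho> k) x * ?f x \<partial>lborel) + (L2_norm ?f)\<^sup>2"
      unfolding L2.nrm_square[OF L2.diff[OF g(1) f]] L2.nrm_square[OF g(1)] L2.nrm_square[OF f]
        L2.diff_left[OF g(1) f L2.diff[OF g(1) f]] L2.diff_right[OF g(1) f g(1)] L2.diff_right[OF g(1) f f]
        L2.commute[OF f g(1)] by simp
    moreover have "(L2_norm (conv ?f (\<rho> k)))\<^sup>2 \<le> (L2_norm ?f)\<^sup>2"
      using g(2) L2.nrm_nonneg[OF g(1)] by (rule power_mono)
    ultimately show ?thesis by linarith
  qed
  have "(\<lambda>k. (L2_norm (\<lambda>x. conv ?f (\<rho> k) x - ?f x))\<^sup>2) \<longlonglongrightarrow> 0"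
  proof (rule Lim_null_comparison)
    have "(\<integral>x. ?f x \<partial>lborel) = (L2_norm ?f)\<^sup>2"
      unfolding L2.nrm_square[OF f] by (simp flip: indicator_inter_arith)
    then show "(\<lambda>k. 2 * (L2_norm ?f)\<^sup>2 - 2 * (\<integral>x. conv ?f (\<rho> k) x * ?f x \<partial>lborel)) \<longlonglongrightarrow> 0"
      using tendsto_diff[OF tendsto_const tendsto_mult_left[OF lim, of 2], of "2 * (L2_norm ?f)\<^sup>2"] by simp
  qed (use sq in simp)
  then have "(\<lambda>k. sqrt ((L2_norm (\<lambda>x. conv ?f (\<rho> k) x - ?f x))\<^sup>2)) \<longlonglongrightarrow> sqrt 0"
    by (rule tendsto_real_sqrt)
  then show ?thesis
    using f L2.nrm_nonneg[OF L2.diff[OF g(1) f]] by (simp add: approximated_def)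
qed

text \<open>Outer regularity supplies an open superset. The excess is chosen below
  \<open>e\<^sup>2\<close> because the L^2 norm of an indicator is the square root of the
  measure.\<close>

lemma approximated_indicator:
  assumes A: "A \<in> sets borel" "emeasure lborel A < \<infinity>"
  shows "approximated (indicator A)"
proof (rule approximated_limit)
  show "indicator A \<in> L2_space" by (rule indicator_L2[OF A])
  fix e :: real assume "e > 0"
  then obtain U where U: "open U" "A \<subseteq> U" "emeasure lborel (U - A) < ennreal (e\<^sup>2)"
    using outer_regular_lborel[OF A(1), of "e\<^sup>2"] by auto
  have Um: "U \<in> sets borel" using U by simp
  have "emeasure lborel U = emeasure lborel (U - A) + emeasure lborel A"
    using U A Um by (subst plus_emeasure) (auto intro!: arg_cong[where f = "emeasure lborel"])
  also have "\<dots> < \<infinity>" using U(3) A(2) by (auto simp: less_top[symmetric])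
  finally have fin: "emeasure lborel U < \<infinity>" .
  have fin': "emeasure lborel (U - A) < \<infinity>" using U(3) by (rule less_trans) simp
  have "(\<integral>x. (indicator A x - indicator U x :: real)\<^sup>2 \<partial>lborel) = (\<integral>x. indicator (U - A) x \<partial>(lborel :: 'a measure))"
    using U(2) by (intro Bochner_Integration.integral_cong) (auto simp: indicator_def)
  also have "\<dots> = measure lborel (U - A)" by simp
  also have "\<dots> < e\<^sup>2"
    using U(3) fin' by (simp add: emeasure_eq_ennreal_measure ennreal_less_iff)
  finally have "L2_norm (\<lambda>x. indicator A x - indicator U x) < sqrt (e\<^sup>2)"
    unfolding L2_norm_def by (rule real_sqrt_less_mono)
  then show "\<exists>g. approximated g \<and> L2_norm (\<lambda>x. indicator A x - g x) < e"
    using approximated_open[OF U(1) fin] \<open>e > 0\<close> by auto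
qed

lemma approximated_nonneg:
  assumes "f \<in> borel_measurable borel" "\<And>x. 0 \<le> f x" "f \<in> L2_space"
  shows "approximated f"
proof -
  have "f \<in> borel_measurable lborel" using assms by simp
  then show ?thesis using assms(2,3)
  proof (induction rule: borel_measurable_induct_real)
    case (set A)
    have "integrable lborel (\<lambda>x. (indicator A x :: real)\<^sup>2)" using set by (simp add: L2_iff)
    then have "integrable lborel (indicator A :: 'a \<Rightarrow> real)"
      by (simp add: power2_eq_square flip: indicator_inter_arith)
    then show ?case using set by (intro approximated_indicator) (auto simp: integrable_indicator_iff)
  next
    case (mult u c)
    \<comment> \<open>If \<open>c = 0\<close>, square integrability of \<open>c * u\<close> says
      nothing about \<open>u\<close>, so the zero function is treated separately.\<close>
    show ?case
    proof (cases "c = 0")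
      case False
      then have "u \<in> L2_space" using L2.scale[OF mult.prems, of "1 / c"] by simp
      then show ?thesis by (intro approximated_cmult mult)
    next
      case True
      then show ?thesis
        using L2.zero by (auto simp: approximated_def conv_def L2_norm_def)
    qed
  next
    case (add u v)
    \<comment> \<open>Both summands are nonnegative, so the square of each is dominated by the
      square of the sum.\<close>
    have L: "integrable lborel (\<lambda>x. (v x + u x)\<^sup>2)" using add.prems by (simp add: L2_iff)
    have "u \<in> L2_space"
      by (rule L2_dominated[OF _ L]) (use add in \<open>auto simp: power2_sum\<close>)
    moreover have "v \<in> L2_space"
      by (rule L2_dominated[OF _ L]) (use add in \<open>auto simp: power2_sum\<close>)
    ultimately show ?case by (intro approximated_add add)
  next
    case (seq U)
    have L: "integrable lborel (\<lambda>x. (f x)\<^sup>2)" using seq.prems by (simp add: L2_iff)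
    have le: "U i x \<le> f x" for i x
      using seq.hyps by (intro incseq_le[of "\<lambda>i. U i x"]) (auto simp: incseq_def le_fun_def)
    have UL: "U i \<in> L2_space" for i
      by (rule L2_dominated[OF _ L]) (use seq le in \<open>auto intro!: power_mono\<close>)
    have "(\<lambda>i. \<integral>x. (f x - U i x)\<^sup>2 \<partial>lborel) \<longlonglongrightarrow> (\<integral>x. 0 \<partial>(lborel :: 'a measure))"
    proof (rule integral_dominated_convergence[OF _ _ L])
      show "AE x in lborel. (\<lambda>i. (f x - U i x)\<^sup>2) \<longlonglongrightarrow> 0"
      proof (intro always_eventually allI)
        fix x
        have "(\<lambda>i. (f x - U i x)\<^sup>2) \<longlonglongrightarrow> (f x - f x)\<^sup>2"
          using seq.hyps by (intro tendsto_intros) auto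
        then show "(\<lambda>i. (f x - U i x)\<^sup>2) \<longlonglongrightarrow> 0" by simp
      qed
      have "\<bar>(f x - U i x)\<^sup>2\<bar> \<le> (f x)\<^sup>2" for i x
        using le[of i x] seq.hyps(2)[of i x] by (simp add: power_mono)
      then show "AE x in lborel. norm ((f x - U i x)\<^sup>2) \<le> (f x)\<^sup>2" for i by simp
    qed (use seq.hyps(1) L2_measurable[OF seq.prems] in auto)
    then have "(\<lambda>i. L2_norm (\<lambda>x. f x - U i x)) \<longlonglongrightarrow> sqrt 0"
      unfolding L2_norm_def by (intro tendsto_real_sqrt) simp
    then have lim: "(\<lambda>i. L2_norm (\<lambda>x. f x - U i x)) \<longlonglongrightarrow> 0" by simp
    show ?case
    proof (rule approximated_limit[OF seq.prems])
      fix e :: real assume "e > 0"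
      then have "\<forall>\<^sub>F i in sequentially. L2_norm (\<lambda>x. f x - U i x) < e" by (rule order_tendstoD(2)[OF lim])
      then obtain i where "L2_norm (\<lambda>x. f x - U i x) < e" by (auto dest: eventually_happens)
      then show "\<exists>g. approximated g \<and> L2_norm (\<lambda>x. f x - g x) < e" using seq UL by blast
    qed
  qed
qed

text \<open>The positive and the negative part are nonnegative and dominated by \<open>f\<close> in
  absolute value; the sign \<open>s\<close> handles both at once.\<close>

theorem approximated_L2:
  assumes f: "f \<in> L2_space"
  shows "approximated f"
proof -
  note [measurable] = L2_measurable[OF f]
  have int: "integrable lborel (\<lambda>x. (f x)\<^sup>2)" using f by (simp add: L2_iff)
  have "(max 0 (s * f x))\<^sup>2 \<le> (f x)\<^sup>2" if "s \<in> {1, -1}" for s x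
    using that by (auto simp: max_def)
  then have "approximated (\<lambda>x. max 0 (s * f x))" if "s \<in> {1, -1}" for s
    using that by (intro approximated_nonneg L2_dominated[OF _ int]) auto
  from approximated_add[OF this[of 1] approximated_cmult[OF this[of "-1"], of "-1"]]
  have "approximated (\<lambda>x. max 0 (1 * f x) + - 1 * max 0 (- 1 * f x))" by simp
  also have "(\<lambda>x. max 0 (1 * f x) + - 1 * max 0 (- 1 * f x)) = f" by (auto simp: max_def)
  finally show ?thesis .
qed

end

section \<open>Weak derivatives and the space $H^1$\<close>

lemma mollifier_approximate_identity:
  fixes \<psi> :: "'a::euclidean_space \<Rightarrow> real"
  assumes "mollifier \<psi>"
  obtains \<rho> :: "nat \<Rightarrow> 'a \<Rightarrow> real" and r where "approximate_identity \<rho> r"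
proof -
  have \<psi>: "\<psi> \<in> test_functions" "\<And>x. 0 \<le> \<psi> x" "(\<integral>x. \<psi> x \<partial>lborel) = 1"
    using assms by (auto simp: mollifier_def)
  obtain R where R: "R > 0" "\<And>x. R < norm x \<Longrightarrow> \<psi> x = 0"
    by (rule test_function_support[OF \<psi>(1)]) blast
  \<comment> \<open>Starts at 1 and decreases to 0, so the support radii are largest at index 0, as
    \<open>radius_le\<close> demands.\<close>
  define \<epsilon> where "\<epsilon> k = inverse (real (Suc k))" for k
  have \<epsilon>: "0 < \<epsilon> k" for k by (simp add: \<epsilon>_def)
  have scaled_eq: "scaled (\<epsilon> k) \<psi> = (\<lambda>x. (1 / \<epsilon> k ^ DIM('a)) * \<psi> (0 + (1 / \<epsilon> k) *\<^sub>R x))" for k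
    by (simp add: scaled_def fun_eq_iff divide_inverse mult.commute)
  have "approximate_identity (\<lambda>k. scaled (\<epsilon> k) \<psi>) (\<lambda>k. R * \<epsilon> k)"
  proof
    show "scaled (\<epsilon> k) \<psi> \<in> test_functions" for k
      unfolding scaled_eq using \<psi>(1) \<epsilon>[of k] by (intro test_function_affine) auto
    show "0 \<le> scaled (\<epsilon> k) \<psi> x" for k x
      using \<psi>(2) \<epsilon>[of k] by (simp add: scaled_def)
    show "(\<integral>x. scaled (\<epsilon> k) \<psi> x \<partial>lborel) = 1" for k
    proof -
      have "(\<integral>x. \<psi> ((1 / \<epsilon> k) *\<^sub>R x) \<partial>lborel) = \<epsilon> k ^ DIM('a)"
        using integral_lborel_affine[OF test_function_measurable[OF \<psi>(1)], of "1 / \<epsilon> k" 0] \<epsilon>[of k] \<psi>(3)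
        by (simp add: power_one_over field_simps)
      then show ?thesis unfolding scaled_eq using \<epsilon>[of k] by simp
    qed
    show "scaled (\<epsilon> k) \<psi> x = 0" if "R * \<epsilon> k < norm x" for k x
      using that \<epsilon>[of k] R(2)[of "x /\<^sub>R \<epsilon> k"] by (simp add: scaled_def field_simps)
    show "R * \<epsilon> k \<le> R * \<epsilon> 0" for k
      using R(1) by (simp add: \<epsilon>_def field_simps)
    have "(\<lambda>k. R * \<epsilon> k) \<longlonglongrightarrow> R * 0"
      unfolding \<epsilon>_def by (intro tendsto_intros LIMSEQ_inverse_real_of_nat)
    then show "(\<lambda>k. R * \<epsilon> k) \<longlonglongrightarrow> 0" by simp
  qed
  then show ?thesis by (rule that)
qed

lemma L2_weight:
  fixes n f :: "'a::euclidean_space \<Rightarrow> real"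
  assumes f: "f \<in> L2_space" and n: "n \<in> borel_measurable borel" "AE x in lborel. \<bar>n x\<bar> \<le> D"
  shows "(\<lambda>x. n x * f x) \<in> L2_space" and "L2_norm (\<lambda>x. n x * f x) \<le> D * L2_norm f"
proof -
  \<comment> \<open>Lebesgue measure is not null, so a bound that holds almost everywhere holds
    somewhere; hence \<open>D\<close> is nonnegative.\<close>
  have "\<exists>x::'a. \<bar>n x\<bar> \<le> D"
    using eventually_happens[OF n(2)] by (simp add: ae_filter_eq_bot_iff)
  then have D: "0 \<le> D" by (meson abs_ge_zero order_trans)
  have sq: "AE x in lborel. (n x * f x)\<^sup>2 \<le> (D * f x)\<^sup>2"
    using n(2)
  proof eventually_elim
    case (elim x)
    then have "\<bar>n x * f x\<bar> \<le> \<bar>D * f x\<bar>" using D by (simp add: abs_mult mult_right_mono)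
    then show ?case by (simp add: abs_le_square_iff)
  qed
  have Df: "(\<lambda>x. D * f x) \<in> L2_space" by (rule L2.scale[OF f])
  show nf: "(\<lambda>x. n x * f x) \<in> L2_space"
    by (rule L2_dominated[OF _ _ sq]) (use n(1) L2_measurable[OF f] Df in \<open>auto simp: L2_iff\<close>)
  have "L2_norm (\<lambda>x. n x * f x) \<le> L2_norm (\<lambda>x. D * f x)"
    unfolding L2_norm_def using sq nf Df by (intro real_sqrt_le_mono integral_mono_AE) (auto simp: L2_iff)
  then show "L2_norm (\<lambda>x. n x * f x) \<le> D * L2_norm f" using L2.nrm_scale[OF f, of D] D by simp
qed

lemma locally_integrable_combine:
  assumes "locally_integrable f" "locally_integrable g"
  shows "locally_integrable (\<lambda>x. c * f x + d * g x)"
  unfolding locally_integrable_def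
proof (intro allI impI)
  fix K :: "'a set" assume "compact K"
  then have "set_integrable lborel K f" "set_integrable lborel K g"
    using assms by (auto simp: locally_integrable_def)
  then have "set_integrable lborel K (\<lambda>x. c * f x)" "set_integrable lborel K (\<lambda>x. d * g x)"
    by (auto intro: set_integrable_mult_right)
  then show "set_integrable lborel K (\<lambda>x. c * f x + d * g x)" by (rule set_integral_add(1))
qed

lemma integral_combine_test:
  assumes "locally_integrable f" "locally_integrable g" "\<phi> \<in> test_functions"
  shows "(\<integral>x. (c * f x + d * g x) * \<phi> x \<partial>lborel) = c * (\<integral>x. f x * \<phi> x \<partial>lborel) + d * (\<integral>x. g x * \<phi> x \<partial>lborel)"
  using assms by (simp add: distrib_right mult.assoc integrable_test_function)

lemma has_weak_deriv_combine:
  assumes "has_weak_deriv b f f'" "has_weak_deriv b g g'" "b \<in> Basis"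
  shows "has_weak_deriv b (\<lambda>x. c * f x + d * g x) (\<lambda>x. c * f' x + d * g' x)"
  using assms unfolding has_weak_deriv_def
  by (auto simp: locally_integrable_combine integral_combine_test test_function_dir_deriv)

lemma locally_integrable_cong_AE:
  assumes "locally_integrable f" "g \<in> borel_measurable borel" "AE x in lborel. f x = g x"
  shows "locally_integrable g"
  unfolding locally_integrable_def set_integrable_def
proof (intro allI impI)
  fix K :: "'a set" assume K: "compact K"
  have "integrable lborel (\<lambda>x. indicator K x *\<^sub>R f x)"
    using assms(1) K by (simp add: locally_integrable_def set_integrable_def)
  then show "integrable lborel (\<lambda>x. indicator K x *\<^sub>R g x)"
    by (rule integrable_cong_AE_imp) (use assms K in \<open>auto simp: borel_compact intro!: borel_measurable_times borel_measurable_indicator\<close>)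
qed

lemma has_weak_deriv_cong_AE:
  assumes "has_weak_deriv v f h" "g \<in> borel_measurable borel" "AE x in lborel. f x = g x" "v \<in> Basis"
  shows "has_weak_deriv v g h"
proof -
  have f: "locally_integrable f" using assms(1) by (simp add: has_weak_deriv_def)
  have g: "locally_integrable g" by (rule locally_integrable_cong_AE[OF f assms(2,3)])
  have "(\<integral>x. g x * dir_deriv v \<phi> x \<partial>lborel) = (\<integral>x. f x * dir_deriv v \<phi> x \<partial>lborel)" if "\<phi> \<in> test_functions" for \<phi>
    using assms(3) borel_measurable_integrable[OF integrable_test_function[OF f test_function_dir_deriv[OF that assms(4)]]]
      borel_measurable_integrable[OF integrable_test_function[OF g test_function_dir_deriv[OF that assms(4)]]]
    by (intro integral_cong_AE) auto
  then show ?thesis using assms(1) g by (simp add: has_weak_deriv_def)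
qed

lemma has_weak_deriv_SOME: "has_weak_deriv v f g \<Longrightarrow> has_weak_deriv v f (weak_deriv v f)"
  unfolding weak_deriv_def by (rule someI[of "has_weak_deriv v f"])

lemma H1_D:
  assumes "f \<in> H1_space"
  shows "f \<in> L2_space" and "b \<in> Basis \<Longrightarrow> weak_deriv b f \<in> L2_space"
    and "b \<in> Basis \<Longrightarrow> has_weak_deriv b f (weak_deriv b f)"
  using assms has_weak_deriv_SOME unfolding H1_space_def weakly_differentiable_def by blast+

section \<open>Test functions determine functions; uniqueness of weak derivatives\<close>

lemma AE_cbox_box: "AE x in lborel. x \<in> cbox a b \<longrightarrow> x \<in> box a (b :: 'a::euclidean_space)"
proof -
  have "emeasure lborel (cbox a b - box a b) = emeasure lborel (cbox a b) - emeasure lborel (box a b)"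
    by (rule emeasure_Diff) (auto simp: box_subset_cbox emeasure_lborel_box_eq)
  also have "\<dots> = 0"
    by (auto simp: emeasure_lborel_cbox_eq emeasure_lborel_box_eq)
  finally have "cbox a b - box a b \<in> null_sets lborel" by (auto intro: null_setsI)
  then have "AE x in lborel. x \<notin> cbox a b - box a b" by (rule AE_not_in)
  then show ?thesis by eventually_elim auto
qed

text \<open>Open boxes form an intersection-stable generator of the Borel sets, and the sets over
  which \<open>f\<close> integrates to 0 form a Dynkin system; \<open>total\<close> provides closure
  under complements. Integrating over the sets where \<open>f\<close> is positive or negative
  finishes the proof.\<close>

lemma AE_zero_of_box_integrals:
  fixes f :: "'a::euclidean_space \<Rightarrow> real"
  assumes int: "integrable lborel f" and box: "\<And>a b. (LINT x:box a b|lborel. f x) = 0" and total: "(LINT x|lborel. f x) = 0"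
  shows "AE x in lborel. f x = 0"
proof -
  have f[measurable]: "f \<in> borel_measurable borel" using borel_measurable_integrable[OF int] by simp
  have set_int: "set_integrable lborel A f" if "A \<in> sets borel" for A
    using integrable_mult_indicator[of A lborel f] that int by (simp add: set_integrable_def)
  have zero: "(LINT x:A|lborel. f x) = 0" if A: "A \<in> sets borel" for A
  proof -
    have "Int_stable (range (\<lambda>(a, b). box a b :: 'a set))"
      by (auto simp: Int_stable_def box_Int_box)
    moreover have "range (\<lambda>(a, b). box a b :: 'a set) \<subseteq> Pow UNIV" by auto
    moreover have "A \<in> sigma_sets UNIV (range (\<lambda>(a, b). box a b))" using A unfolding borel_eq_box by simp
    ultimately show ?thesis
    proof (induction rule: sigma_sets_induct_disjoint)
      case (basic A)
      then show ?case using box by auto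
    next
      case empty
      then show ?case by (simp add: set_lebesgue_integral_def)
    next
      case (compl A)
      then have A: "A \<in> sets borel" by (simp add: borel_eq_box)
      have "(LINT x:A \<union> (UNIV - A)|lborel. f x) = (LINT x:A|lborel. f x) + (LINT x:UNIV - A|lborel. f x)"
        using A by (intro set_integral_Un set_int) auto
      then show ?case using compl total by (simp add: set_lebesgue_integral_def)
    next
      case (union F)
      then have F: "F i \<in> sets borel" for i by (auto simp: borel_eq_box)
      have "(LINT x:(\<Union>i. F i)|lborel. f x) = (\<Sum>i. LINT x:F i|lborel. f x)"
        using union(1) F by (intro lebesgue_integral_countable_add set_int) (auto simp: disjoint_family_on_def)
      then show ?case using union by simp
    qed
  qed
  have half: "AE x in lborel. s * f x \<le> 0" if "s \<in> {1, -1}" for s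
  proof -
    let ?A = "{x. 0 < s * f x}"
    have A: "?A \<in> sets borel" by measurable
    have "(\<integral>x. s * (indicator ?A x *\<^sub>R f x) \<partial>lborel) = 0"
      using zero[OF A] by (simp add: set_lebesgue_integral_def)
    moreover have "integrable lborel (\<lambda>x. s * (indicator ?A x *\<^sub>R f x))"
      using set_int[OF A] by (simp add: set_integrable_def)
    moreover have "AE x in lborel. 0 \<le> s * (indicator ?A x *\<^sub>R f x)"
      by (auto simp: indicator_def)
    ultimately have "AE x in lborel. s * (indicator ?A x *\<^sub>R f x) = 0"
      by (subst (asm) integral_nonneg_eq_0_iff_AE) auto
    then show ?thesis by eventually_elim (auto simp: indicator_def split: if_splits)
  qed
  show ?thesis using half[of 1, simplified] half[of "-1", simplified] by eventually_elim auto
qed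

context approximate_identity
begin

text \<open>Mollified indicators of the box are test functions. They converge to the indicator off
  the faces of the box, which form a null set, and are dominated through their common bounded
  support.\<close>

lemma test_functions_separate_boxes:
  fixes g :: "'a \<Rightarrow> real"
  assumes g: "locally_integrable g" and zero: "\<And>\<phi>. \<phi> \<in> test_functions \<Longrightarrow> (\<integral>x. g x * \<phi> x \<partial>lborel) = 0"
  shows "(LINT x:box a b|lborel. g x) = 0"
proof -
  let ?f = "indicator (box a b) :: 'a \<Rightarrow> real"
  obtain M where M: "\<And>x. x \<in> box a b \<Longrightarrow> norm x \<le> M" using bounded_box[of a b] by (auto simp: bounded_iff)
  have loc: "locally_integrable ?f" by (rule indicator_locally_integrable) simp
  have outside: "conv ?f (\<rho> k) x = 0" if "M + r 0 < norm x" for k x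
  proof (rule averaging_kernel.conv_const_near[OF kernel support])
    fix y assume "norm (x - y) \<le> r k"
    moreover have "norm x \<le> norm y + norm (x - y)" by norm
    ultimately have "M < norm y" using that radius_le[of k] by linarith
    then show "?f y = 0" using M[of y] by (auto simp: indicator_def)
  qed
  have test_k: "conv ?f (\<rho> k) \<in> test_functions" for k
    by (rule test_functionI[OF smooth_conv[OF loc test] outside])
  have "(\<lambda>k. \<integral>x. g x * conv ?f (\<rho> k) x \<partial>lborel) \<longlonglongrightarrow> (\<integral>x. g x * ?f x \<partial>lborel)"
  proof (rule integral_dominated_convergence)
    show "integrable lborel (\<lambda>x. \<bar>indicator (cball 0 (M + r 0)) x *\<^sub>R g x\<bar>)"
      using g by (intro integrable_abs) (auto simp: locally_integrable_def set_integrable_def)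
    show "(\<lambda>x. g x * ?f x) \<in> borel_measurable lborel"
      using locally_integrable_measurable[OF g] by simp
    show "(\<lambda>x. g x * conv ?f (\<rho> k) x) \<in> borel_measurable lborel" for k
      using locally_integrable_measurable[OF g] test_function_measurable[OF test_k[of k]] by simp
    show "AE x in lborel. norm (g x * conv ?f (\<rho> k) x) \<le> \<bar>indicator (cball 0 (M + r 0)) x *\<^sub>R g x\<bar>" for k
    proof (intro always_eventually allI)
      fix x
      show "norm (g x * conv ?f (\<rho> k) x) \<le> \<bar>indicator (cball 0 (M + r 0)) x *\<^sub>R g x\<bar>"
        using outside[of x k] averaging_kernel.conv_indicator_bounds[OF kernel, of "box a b" k x]
        by (cases "norm x \<le> M + r 0") (auto simp: abs_mult intro: mult_left_le)
    qed
    show "AE x in lborel. (\<lambda>k. g x * conv ?f (\<rho> k) x) \<longlonglongrightarrow> g x * ?f x"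
      using AE_cbox_box[of a b]
    proof eventually_elim
      case (elim x)
      have "\<forall>\<^sub>F k in sequentially. conv ?f (\<rho> k) x = ?f x"
      proof (cases "x \<in> box a b")
        case True
        then show ?thesis using conv_locally_const[of "box a b" x ?f 1] by (simp add: open_box)
      next
        case False
        then have "x \<in> - cbox a b" using elim by auto
        then show ?thesis
          using False conv_locally_const[of "- cbox a b" x ?f 0] box_subset_cbox[of a b]
          by (auto simp: open_Compl indicator_def)
      qed
      then have "\<forall>\<^sub>F k in sequentially. g x * conv ?f (\<rho> k) x = g x * ?f x" by eventually_elim simp
      then show ?case by (rule tendsto_eventually)
    qed
  qed
  then have "(\<integral>x. g x * ?f x \<partial>lborel) = 0"
    using zero[OF test_k] by (simp add: LIMSEQ_const_iff)
  then show ?thesis by (simp add: set_lebesgue_integral_def mult.commute)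
qed

theorem test_functions_separate:
  fixes g :: "'a \<Rightarrow> real"
  assumes g: "locally_integrable g" and zero: "\<And>\<phi>. \<phi> \<in> test_functions \<Longrightarrow> (\<integral>x. g x * \<phi> x \<partial>lborel) = 0"
  shows "AE x in lborel. g x = 0"
proof -
  \<comment> \<open>\<open>g\<close> is only locally integrable, so it is cut to boxes exhausting
    the space. An intersection of two boxes is again a box, hence the cut function still integrates
    to zero over every box.\<close>
  define B where "B n = box (- (real n *\<^sub>R One)) (real n *\<^sub>R One :: 'a)" for n
  note sep = test_functions_separate_boxes[OF g zero]
  have "AE x in lborel. indicator (B n) x *\<^sub>R g x = 0" for n
  proof (rule AE_zero_of_box_integrals)
    \<comment> \<open>Local integrability concerns compact sets, so the open box is first enclosed
      in the closed one.\<close>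
    have "integrable lborel (\<lambda>x. indicator (B n) x *\<^sub>R (indicator (cbox (- (real n *\<^sub>R One)) (real n *\<^sub>R One)) x *\<^sub>R g x))"
      using g by (intro integrable_mult_indicator[of "B n"]) (simp_all add: locally_integrable_def set_integrable_def B_def)
    then show "integrable lborel (\<lambda>x. indicator (B n) x *\<^sub>R g x)"
      by (rule Bochner_Integration.integrable_cong[THEN iffD1, rotated 2])
        (use box_subset_cbox in \<open>auto simp: B_def indicator_def\<close>)
    show "(LINT x|lborel. indicator (B n) x *\<^sub>R g x) = 0"
      using sep by (simp add: set_lebesgue_integral_def B_def)
    fix a b
    have "(LINT x:box a b|lborel. indicator (B n) x *\<^sub>R g x) = (LINT x:box a b \<inter> B n|lborel. g x)"
      by (simp add: set_lebesgue_integral_def indicator_inter_arith mult.assoc)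
    also have "\<dots> = 0" unfolding B_def box_Int_box by (rule sep)
    finally show "(LINT x:box a b|lborel. indicator (B n) x *\<^sub>R g x) = 0" .
  qed
  then have "AE x in lborel. \<forall>n. indicator (B n) x *\<^sub>R g x = 0" unfolding AE_all_countable ..
  then show ?thesis
  proof eventually_elim
    case (elim x)
    have "x \<in> (\<Union>n. B n)" unfolding B_def UN_box_eq_UNIV by simp
    then obtain n where "x \<in> B n" by blast
    with elim[THEN spec, of n] show ?case by simp
  qed
qed

text \<open>Without this nothing could be said about \<open>weak_deriv\<close>, which is an
  arbitrary choice among all weak derivatives.\<close>

lemma weak_deriv_unique:
  fixes f g h :: "'a \<Rightarrow> real"
  assumes "has_weak_deriv v f g" "has_weak_deriv v f h"
  shows "AE x in lborel. g x = h x"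
proof -
  have l: "locally_integrable g" "locally_integrable h" using assms by (auto simp: has_weak_deriv_def)
  have "AE x in lborel. 1 * g x + (- 1) * h x = 0"
  proof (rule test_functions_separate[OF locally_integrable_combine[OF l]])
    fix \<phi> :: "'a \<Rightarrow> real" assume \<phi>: "\<phi> \<in> test_functions"
    have "- (\<integral>x. g x * \<phi> x \<partial>lborel) = - (\<integral>x. h x * \<phi> x \<partial>lborel)"
    proof -
      have "(\<integral>x. f x * dir_deriv v \<phi> x \<partial>lborel) = - (\<integral>x. g x * \<phi> x \<partial>lborel)"
        "(\<integral>x. f x * dir_deriv v \<phi> x \<partial>lborel) = - (\<integral>x. h x * \<phi> x \<partial>lborel)"
        using assms \<phi> unfolding has_weak_deriv_def by blast+
      then show ?thesis by (rule trans[OF sym])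
    qed
    then show "(\<integral>x. (1 * g x + - 1 * h x) * \<phi> x \<partial>lborel) = 0"
      unfolding integral_combine_test[OF l \<phi>] by simp
  qed
  then show ?thesis by eventually_elim simp
qed

lemma weak_deriv_AE: "has_weak_deriv v f g \<Longrightarrow> AE x::'a in lborel. weak_deriv v f x = g x"
  using weak_deriv_unique has_weak_deriv_SOME by blast

section \<open>The Sobolev space H^1 and density of test functions\<close>

lemma H1_I:
  fixes f :: "'a \<Rightarrow> real"
  assumes "f \<in> L2_space" "\<And>b. b \<in> Basis \<Longrightarrow> has_weak_deriv b f (g b)" "\<And>b. b \<in> Basis \<Longrightarrow> g b \<in> L2_space"
  shows "f \<in> H1_space"
proof -
  \<comment> \<open>The chosen representative agrees almost everywhere with the witness
    \<open>g b\<close>, so membership in L^2 carries over.\<close>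
  have "weak_deriv b f \<in> L2_space" if "b \<in> Basis" for b
  proof (rule L2_cong_AE[OF assms(3)[OF that]])
    show "weak_deriv b f \<in> borel_measurable borel"
      using has_weak_deriv_SOME[OF assms(2)[OF that]]
      by (intro locally_integrable_measurable) (simp add: has_weak_deriv_def)
    show "AE x in lborel. g b x = weak_deriv b f x"
      using weak_deriv_AE[OF assms(2)[OF that]] by eventually_elim simp
  qed
  then show ?thesis using assms by (auto simp: H1_space_def weakly_differentiable_def)
qed

text \<open>Linearity holds only almost everywhere, since \<open>weak_deriv\<close> picks a
  representative for each function separately.\<close>

lemma H1_combine:
  fixes f g :: "'a \<Rightarrow> real"
  assumes "f \<in> H1_space" "g \<in> H1_space"
  shows "(\<lambda>x. c * f x + d * g x) \<in> H1_space"
    and "b \<in> Basis \<Longrightarrow> AE x in lborel. weak_deriv b (\<lambda>x. c * f x + d * g x) x = c * weak_deriv b f x + d * weak_deriv b g x"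
proof -
  have D: "has_weak_deriv b (\<lambda>x. c * f x + d * g x) (\<lambda>x. c * weak_deriv b f x + d * weak_deriv b g x)" if "b \<in> Basis" for b
    using assms that by (intro has_weak_deriv_combine H1_D)
  have L: "(\<lambda>x. c * f x + d * g x) \<in> L2_space" if "f \<in> L2_space" "g \<in> L2_space" for f g :: "'a \<Rightarrow> real"
    using that by (intro L2.add L2.scale)
  show "(\<lambda>x. c * f x + d * g x) \<in> H1_space"
    by (rule H1_I[OF L[OF assms[THEN H1_D(1)]] D L[OF H1_D(2)[OF assms(1)] H1_D(2)[OF assms(2)]]])
  show "b \<in> Basis \<Longrightarrow> AE x in lborel. weak_deriv b (\<lambda>x. c * f x + d * g x) x = c * weak_deriv b f x + d * weak_deriv b g x"
    by (rule weak_deriv_AE[OF D])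
qed

lemma H1_cong_AE:
  fixes f g :: "'a \<Rightarrow> real"
  assumes "f \<in> H1_space" "g \<in> borel_measurable borel" "AE x in lborel. f x = g x" "b \<in> Basis"
  shows "AE x in lborel. weak_deriv b f x = weak_deriv b g x"
  using weak_deriv_AE[OF has_weak_deriv_cong_AE[OF H1_D(3)[OF assms(1,4)] assms(2,3,4)]]
  by eventually_elim simp

lemma H1_zero: "(\<lambda>x. 0) \<in> (H1_space :: ('a \<Rightarrow> real) set)"
proof (rule H1_I[where g = "\<lambda>_ x. 0"])
  show "has_weak_deriv b (\<lambda>x. 0) (\<lambda>x. 0)" for b :: 'a
    using L2_locally_integrable[OF L2.zero] by (simp add: has_weak_deriv_def)
qed (rule L2.zero)+


definition H1_ip :: "('a \<Rightarrow> real) \<Rightarrow> ('a \<Rightarrow> real) \<Rightarrow> real" where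
  "H1_ip f g = (\<integral>x. f x * g x \<partial>lborel) + (\<Sum>b\<in>Basis. \<integral>x. weak_deriv b f x * weak_deriv b g x \<partial>lborel)"

lemma weak_deriv_form_combine:
  fixes f g k :: "'a \<Rightarrow> real"
  assumes "f \<in> H1_space" "g \<in> H1_space" "b \<in> Basis" "k \<in> L2_space"
  shows "(\<integral>x. weak_deriv b (\<lambda>x. c * f x + d * g x) x * k x \<partial>lborel)
    = c * (\<integral>x. weak_deriv b f x * k x \<partial>lborel) + d * (\<integral>x. weak_deriv b g x * k x \<partial>lborel)"
proof -
  have L: "weak_deriv b f \<in> L2_space" "weak_deriv b g \<in> L2_space" "weak_deriv b (\<lambda>x. c * f x + d * g x) \<in> L2_space"
    using assms H1_D(2) H1_combine(1) by blast+
  note [measurable] = L[THEN L2_measurable] L2_measurable[OF assms(4)]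
  have "(\<integral>x. weak_deriv b (\<lambda>x. c * f x + d * g x) x * k x \<partial>lborel)
    = (\<integral>x. (c * weak_deriv b f x + d * weak_deriv b g x) * k x \<partial>lborel)"
  proof (rule integral_cong_AE)
    show "AE x in lborel. weak_deriv b (\<lambda>x. c * f x + d * g x) x * k x = (c * weak_deriv b f x + d * weak_deriv b g x) * k x"
      using H1_combine(2)[OF assms(1-3), of c d] by eventually_elim simp
  qed auto
  also have "\<dots> = c * (\<integral>x. weak_deriv b f x * k x \<partial>lborel) + d * (\<integral>x. weak_deriv b g x * k x \<partial>lborel)"
    using L2.add_left[OF L2.scale[OF L(1)] L2.scale[OF L(2)] assms(4), of c d]
      L2.scale_left[OF L(1) assms(4), of c] L2.scale_left[OF L(2) assms(4), of d] by simp
  finally show ?thesis .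
qed

sublocale H1: semi_inner "H1_space :: ('a \<Rightarrow> real) set" H1_ip
  rewrites "semi_inner.nrm H1_ip = H1_norm"
proof -
  have ip: "H1_ip (\<lambda>x. c * f x + d * g x) k = c * H1_ip f k + d * H1_ip g k"
    if "f \<in> H1_space" "g \<in> H1_space" "k \<in> H1_space" for c d and f g k :: "'a \<Rightarrow> real"
  proof -
    note L = that[THEN H1_D(1)]
    have "(\<integral>x. (c * f x + d * g x) * k x \<partial>lborel) = c * (\<integral>x. f x * k x \<partial>lborel) + d * (\<integral>x. g x * k x \<partial>lborel)"
      using L2.add_left[OF L2.scale[OF L(1)] L2.scale[OF L(2)] L(3), of c d]
        L2.scale_left[OF L(1,3), of c] L2.scale_left[OF L(2,3), of d] by simp
    moreover have "(\<Sum>b\<in>Basis. \<integral>x. weak_deriv b (\<lambda>x. c * f x + d * g x) x * weak_deriv b k x \<partial>lborel)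
      = (\<Sum>b\<in>Basis. c * (\<integral>x. weak_deriv b f x * weak_deriv b k x \<partial>lborel) + d * (\<integral>x. weak_deriv b g x * weak_deriv b k x \<partial>lborel))"
      by (intro sum.cong refl weak_deriv_form_combine that H1_D(2))
    ultimately show ?thesis
      by (simp add: H1_ip_def sum.distrib sum_distrib_left distrib_left)
  qed
  show "semi_inner (H1_space :: ('a \<Rightarrow> real) set) H1_ip"
  proof
    show "(\<lambda>x. f x + g x) \<in> H1_space" if "f \<in> H1_space" "g \<in> H1_space" for f g :: "'a \<Rightarrow> real"
      using H1_combine(1)[OF that, of 1 1] by simp
    show "(\<lambda>x. c * f x) \<in> H1_space" if "f \<in> H1_space" for c and f :: "'a \<Rightarrow> real"
      using H1_combine(1)[OF that that, of c 0] by simp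
    show "H1_ip (\<lambda>x. f x + g x) k = H1_ip f k + H1_ip g k"
      if "f \<in> H1_space" "g \<in> H1_space" "k \<in> H1_space" for f g k :: "'a \<Rightarrow> real"
      using ip[OF that, of 1 1] by simp
    show "H1_ip (\<lambda>x. c * f x) k = c * H1_ip f k" if "f \<in> H1_space" "k \<in> H1_space" for c and f k :: "'a \<Rightarrow> real"
      using ip[OF that(1,1,2), of c 0] by simp
    show "0 \<le> H1_ip f f" for f :: "'a \<Rightarrow> real"
      unfolding H1_ip_def by (intro add_nonneg_nonneg sum_nonneg integral_nonneg_AE) auto
    show "H1_ip f g = H1_ip g f" for f g :: "'a \<Rightarrow> real"
      by (simp add: H1_ip_def mult.commute)
  qed (rule H1_zero)
  have "(L2_norm f)\<^sup>2 = (\<integral>x. f x * f x \<partial>lborel)" for f :: "'a \<Rightarrow> real"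
    by (simp add: L2_norm_def power2_eq_square)
  then show "semi_inner.nrm H1_ip = H1_norm"
    by (simp add: semi_inner.nrm_def[OF \<open>semi_inner _ H1_ip\<close>] H1_norm_def H1_ip_def fun_eq_iff)
qed

text \<open>The error is split as m_k (g * \<rho>_k - g) + (m_k - c) g: the first part is small by
  mollification, the second by dominated convergence. It serves cut-off functions with
  \<open>c = 1\<close> and their derivatives with \<open>c = 0\<close>.\<close>

lemma multiplier_conv_limit:
  fixes m :: "nat \<Rightarrow> 'a \<Rightarrow> real" and g :: "'a \<Rightarrow> real"
  assumes g: "g \<in> L2_space" and m: "\<And>k. m k \<in> borel_measurable borel" "\<And>k x. \<bar>m k x\<bar> \<le> C"
    and lim: "\<And>x. (\<lambda>k. m k x) \<longlonglongrightarrow> c"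
  shows "(\<lambda>x. m k x * conv g (\<rho> k) x) \<in> L2_space"
    and "(\<lambda>k. L2_norm (\<lambda>x. m k x * conv g (\<rho> k) x - c * g x)) \<longlonglongrightarrow> 0"
proof -
  have C: "0 \<le> C" using m(2)[of 0 0] by linarith
  have conv_L: "conv g (\<rho> k) \<in> L2_space" for k by (rule averaging_kernel.conv_L2(1)[OF kernel g])
  have mult: "(\<lambda>x. n x * f x) \<in> L2_space" "L2_norm (\<lambda>x. n x * f x) \<le> D * L2_norm f"
    if "f \<in> L2_space" "n \<in> borel_measurable borel" "\<And>x. \<bar>n x\<bar> \<le> D" for n f :: "'a \<Rightarrow> real" and D
    using L2_weight[OF that(1,2), of D] that(3) by auto
  show "(\<lambda>x. m k x * conv g (\<rho> k) x) \<in> L2_space" by (rule mult(1)[OF conv_L m])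
  have c: "\<bar>c\<bar> \<le> C"
  proof -
    have "(\<lambda>k. \<bar>m k 0\<bar>) \<longlonglongrightarrow> \<bar>c\<bar>" by (intro tendsto_rabs lim)
    then show ?thesis by (rule LIMSEQ_le_const2) (use m(2) in auto)
  qed
  \<comment> \<open>The factor 4 comes from |m_k - c| \<le> 2 C, as the limit \<open>c\<close> obeys
    the same bound as the multipliers.\<close>
  have int: "integrable lborel (\<lambda>x. 4 * C\<^sup>2 * (g x)\<^sup>2)" using g by (simp add: L2_iff)
  have "(\<lambda>k. \<integral>x. ((m k x - c) * g x)\<^sup>2 \<partial>lborel) \<longlonglongrightarrow> (\<integral>x. 0 \<partial>(lborel :: 'a measure))"
  proof (rule integral_dominated_convergence[OF _ _ int])
    show "AE x in lborel. (\<lambda>k. ((m k x - c) * g x)\<^sup>2) \<longlonglongrightarrow> 0"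
    proof (intro always_eventually allI)
      fix x
      have "(\<lambda>k. ((m k x - c) * g x)\<^sup>2) \<longlonglongrightarrow> ((c - c) * g x)\<^sup>2" by (intro tendsto_intros lim)
      then show "(\<lambda>k. ((m k x - c) * g x)\<^sup>2) \<longlonglongrightarrow> 0" by simp
    qed
    have "(m k x - c)\<^sup>2 \<le> (2 * C)\<^sup>2" for k x
    proof -
      have "\<bar>m k x - c\<bar> \<le> 2 * C" using m(2)[of k x] c by linarith
      then show ?thesis using power_mono[of "\<bar>m k x - c\<bar>" "2 * C" 2] by simp
    qed
    then have "(m k x - c)\<^sup>2 * (g x)\<^sup>2 \<le> (2 * C)\<^sup>2 * (g x)\<^sup>2" for k x by (rule mult_right_mono) simp
    then show "AE x in lborel. norm (((m k x - c) * g x)\<^sup>2) \<le> 4 * C\<^sup>2 * (g x)\<^sup>2" for k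
      by (simp add: power_mult_distrib)
  qed (use m(1) L2_measurable[OF g] in auto)
  then have "(\<lambda>k. L2_norm (\<lambda>x. (m k x - c) * g x)) \<longlonglongrightarrow> sqrt 0"
    unfolding L2_norm_def by (intro tendsto_real_sqrt) simp
  then have lim2: "(\<lambda>k. L2_norm (\<lambda>x. (m k x - c) * g x)) \<longlonglongrightarrow> 0" by simp
  have lim1: "(\<lambda>k. C * L2_norm (\<lambda>x. conv g (\<rho> k) x - g x)) \<longlonglongrightarrow> 0"
    using approximated_L2[OF g] by (intro tendsto_mult_right_zero) (simp add: approximated_def)
  show "(\<lambda>k. L2_norm (\<lambda>x. m k x * conv g (\<rho> k) x - c * g x)) \<longlonglongrightarrow> 0"
  proof (rule tendsto_zero_sequentially[OF tendsto_add_zero[OF lim1 lim2]])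
    fix k
    have d: "(\<lambda>x. conv g (\<rho> k) x - g x) \<in> L2_space" by (rule L2.diff[OF conv_L g])
    have mc: "(\<lambda>x. (m k x - c) * g x) \<in> L2_space"
    proof (rule mult(1)[OF g])
      show "\<bar>m k x - c\<bar> \<le> 2 * C" for x using m(2)[of k x] c by linarith
    qed (use m(1) in simp)
    note md = mult[OF d m(1)[of k] m(2)[of k]]
    have eq: "(\<lambda>x. m k x * conv g (\<rho> k) x - c * g x) = (\<lambda>x. m k x * (conv g (\<rho> k) x - g x) + (m k x - c) * g x)"
      by (simp add: fun_eq_iff algebra_simps)
    show "\<bar>L2_norm (\<lambda>x. m k x * conv g (\<rho> k) x - c * g x)\<bar>
      \<le> C * L2_norm (\<lambda>x. conv g (\<rho> k) x - g x) + L2_norm (\<lambda>x. (m k x - c) * g x)"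
      unfolding eq using L2.nrm_triangle[OF md(1) mc] md(2) L2.nrm_nonneg[OF L2.add[OF md(1) mc]] by simp
  qed
qed

text \<open>Mollify and cut off. In the derivative of the product, one term mollifies the weak
  derivative of \<open>f\<close>; the other carries the derivative of the cut-off, which is
  uniformly bounded and eventually zero at each point.\<close>

theorem H1_test_function_approximation:
  fixes f :: "'a \<Rightarrow> real"
  assumes f: "f \<in> H1_space"
  obtains \<phi> :: "nat \<Rightarrow> 'a \<Rightarrow> real" where "\<And>k. \<phi> k \<in> test_functions"
    and "\<And>k. \<phi> k \<in> L2_space" and "\<And>b k. b \<in> Basis \<Longrightarrow> dir_deriv b (\<phi> k) \<in> L2_space"
    and "(\<lambda>k. L2_norm (\<lambda>x. \<phi> k x - f x)) \<longlonglongrightarrow> 0"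
    and "\<And>b. b \<in> Basis \<Longrightarrow> (\<lambda>k. L2_norm (\<lambda>x. dir_deriv b (\<phi> k) x - weak_deriv b f x)) \<longlonglongrightarrow> 0"
proof -
  define B where "B k = (indicator (cball 0 (real k)) :: 'a \<Rightarrow> real)" for k
  \<comment> \<open>The cut-off is smoothed with the fixed kernel \<open>\<rho> 0\<close>: with
    \<open>\<rho> k\<close> its derivatives could not be bounded by one constant in this
    way.\<close>
  define \<eta> where "\<eta> k = conv (B k) (\<rho> 0)" for k
  define \<phi> where "\<phi> k x = \<eta> k x * conv f (\<rho> k) x" for k x
  have B: "locally_integrable (B k)" for k unfolding B_def by (rule indicator_locally_integrable) simp
  have smooth_\<eta>: "smooth (\<eta> k)" for k unfolding \<eta>_def by (rule smooth_conv[OF B test])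
  have \<eta>_test: "\<eta> k \<in> test_functions" for k
    unfolding \<eta>_def by (rule test_function_conv[OF B test, of "real k"]) (simp add: B_def)
  have L: "f \<in> L2_space" "\<And>b. b \<in> Basis \<Longrightarrow> weak_deriv b f \<in> L2_space"
    using H1_D[OF f] by auto
  have loc: "locally_integrable f" by (rule L2_locally_integrable[OF L(1)])
  have \<eta>_bound: "\<bar>\<eta> k x\<bar> \<le> 1" for k x
    using averaging_kernel.conv_indicator_bounds[OF kernel, of "cball 0 (real k)" 0 x] by (simp add: \<eta>_def B_def)
  have \<eta>_one: "\<eta> k x = 1" if "norm x + r 0 \<le> real k" for k x
    unfolding \<eta>_def
  proof (rule averaging_kernel.conv_const_near[OF kernel support])
    fix y assume "norm (x - y) \<le> r 0"
    moreover have "norm y \<le> norm x + norm (x - y)" by norm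
    ultimately show "B k y = 1" using that by (simp add: B_def)
  qed
  have ev: "\<forall>\<^sub>F k in sequentially. c < real k" for c
    using filterlim_real_sequentially by (simp add: filterlim_at_top_dense)
  have \<eta>_lim: "(\<lambda>k. \<eta> k x) \<longlonglongrightarrow> 1" for x
    by (rule tendsto_eventually, rule eventually_mono[OF ev[of "norm x + r 0"]]) (simp add: \<eta>_one)
  \<comment> \<open>Once \<open>k\<close> exceeds \<open>norm x + r 0\<close>, the cut-off is
    identically 1 near \<open>x\<close>, not only at \<open>x\<close>.\<close>
  have d\<eta>_lim: "(\<lambda>k. dir_deriv b (\<eta> k) x) \<longlonglongrightarrow> 0" for b x
  proof (rule tendsto_eventually, rule eventually_mono[OF ev[of "norm x + r 0"]])
    fix k assume k: "norm x + r 0 < real k"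
    show "dir_deriv b (\<eta> k) x = 0"
    proof (rule dir_deriv_locally_const)
      show "open {x. norm x + r 0 < real k}" by (intro open_Collect_less continuous_intros)
    qed (use k \<eta>_one in auto)
  qed
  \<comment> \<open>The derivative falls on \<open>\<rho> 0\<close> and the indicator is at most 1,
    so the L^1 norm of the kernel's derivative bounds all cut-offs simultaneously.\<close>
  have d\<eta>_bound: "\<bar>dir_deriv b (\<eta> k) x\<bar> \<le> (\<integral>y. \<bar>dir_deriv b (\<rho> 0) y\<bar> \<partial>lborel)" if b: "b \<in> Basis" for b k x
  proof -
    let ?\<sigma> = "dir_deriv b (\<rho> 0)"
    have \<sigma>: "?\<sigma> \<in> test_functions" by (rule test_function_dir_deriv[OF test b])
    have one: "locally_integrable (\<lambda>y::'a. 1 :: real)"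
      using indicator_locally_integrable[of "UNIV :: 'a set"] by simp
    have int: "integrable lborel (\<lambda>y. ?\<sigma> (x - y))" using integrable_conv[OF one \<sigma>] by simp
    have "\<bar>dir_deriv b (\<eta> k) x\<bar> = \<bar>\<integral>y. B k y * ?\<sigma> (x - y) \<partial>lborel\<bar>"
      unfolding \<eta>_def dir_deriv_conv[OF B test b] conv_def ..
    also have "\<dots> \<le> (\<integral>y. \<bar>B k y * ?\<sigma> (x - y)\<bar> \<partial>lborel)"
      using integral_norm_bound[of lborel "\<lambda>y. B k y * ?\<sigma> (x - y)"] by simp
    also have "\<dots> \<le> (\<integral>y. \<bar>?\<sigma> (x - y)\<bar> \<partial>lborel)"
      using int integrable_conv[OF B \<sigma>]
      by (intro integral_mono) (auto simp: B_def indicator_def)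
    also have "\<dots> = (\<integral>y. \<bar>?\<sigma> y\<bar> \<partial>lborel)"
      using integral_lborel_affine[of "\<lambda>y. \<bar>?\<sigma> y\<bar>" "-1" x] test_function_measurable[OF \<sigma>] by simp
    finally show ?thesis .
  qed
  have \<eta>_meas: "\<eta> k \<in> borel_measurable borel" "b \<in> Basis \<Longrightarrow> dir_deriv b (\<eta> k) \<in> borel_measurable borel" for k b
    using \<eta>_test by (auto intro: test_function_measurable test_function_dir_deriv)
  note M1 = multiplier_conv_limit[OF _ \<eta>_meas(1) \<eta>_bound \<eta>_lim]
  have \<phi>_test: "\<phi> k \<in> test_functions" for k
    unfolding \<phi>_def by (rule test_function_mult[OF \<eta>_test smooth_conv[OF loc test]])
  have d\<phi>: "dir_deriv b (\<phi> k) = (\<lambda>x. \<eta> k x * conv (weak_deriv b f) (\<rho> k) x + dir_deriv b (\<eta> k) x * conv f (\<rho> k) x)"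
    if b: "b \<in> Basis" for b k
  proof
    fix x
    have "dir_deriv b (\<phi> k) x = \<eta> k x * dir_deriv b (conv f (\<rho> k)) x + dir_deriv b (\<eta> k) x * conv f (\<rho> k) x"
      unfolding \<phi>_def by (intro dir_deriv_mult smooth_differentiable smooth_\<eta> smooth_conv[OF loc test])
    then show "dir_deriv b (\<phi> k) x = \<eta> k x * conv (weak_deriv b f) (\<rho> k) x + dir_deriv b (\<eta> k) x * conv f (\<rho> k) x"
      by (simp add: dir_deriv_conv[OF loc test b] conv_weak_deriv[OF H1_D(3)[OF f b] test])
  qed
  show ?thesis
  proof (rule that[of \<phi>])
    show "\<phi> k \<in> test_functions" for k by (rule \<phi>_test)
    show "\<phi> k \<in> L2_space" for k unfolding \<phi>_def by (rule M1(1)[OF L(1)])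
    show "(\<lambda>k. L2_norm (\<lambda>x. \<phi> k x - f x)) \<longlonglongrightarrow> 0"
      using M1(2)[OF L(1)] by (simp add: \<phi>_def)
    fix b :: 'a assume b: "b \<in> Basis"
    note M2 = multiplier_conv_limit[OF L(1) \<eta>_meas(2)[OF b] d\<eta>_bound[OF b] d\<eta>_lim]
    have L12: "(\<lambda>x. \<eta> k x * conv (weak_deriv b f) (\<rho> k) x) \<in> L2_space"
      "(\<lambda>x. dir_deriv b (\<eta> k) x * conv f (\<rho> k) x) \<in> L2_space" for k
      by (rule M1(1)[OF L(2)[OF b]], rule M2(1))
    show "dir_deriv b (\<phi> k) \<in> L2_space" for k
      unfolding d\<phi>[OF b] by (rule L2.add[OF L12])
    show "(\<lambda>k. L2_norm (\<lambda>x. dir_deriv b (\<phi> k) x - weak_deriv b f x)) \<longlonglongrightarrow> 0"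
    proof (rule tendsto_zero_sequentially[OF tendsto_add_zero[OF M1(2)[OF L(2)[OF b]] M2(2)]])
      fix k
      let ?u = "\<lambda>x. \<eta> k x * conv (weak_deriv b f) (\<rho> k) x" and ?v = "\<lambda>x. dir_deriv b (\<eta> k) x * conv f (\<rho> k) x"
      have d: "(\<lambda>x. ?u x - weak_deriv b f x) \<in> L2_space" by (rule L2.diff[OF L12(1) L(2)[OF b]])
      have eq: "(\<lambda>x. dir_deriv b (\<phi> k) x - weak_deriv b f x) = (\<lambda>x. (?u x - weak_deriv b f x) + ?v x)"
        by (simp add: d\<phi>[OF b] fun_eq_iff)
      show "\<bar>L2_norm (\<lambda>x. dir_deriv b (\<phi> k) x - weak_deriv b f x)\<bar>
        \<le> L2_norm (\<lambda>x. ?u x - 1 * weak_deriv b f x) + L2_norm (\<lambda>x. ?v x - 0 * f x)"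
        unfolding eq using L2.nrm_triangle[OF d L12(2)] L2.nrm_nonneg[OF L2.add[OF d L12(2)]] by simp
    qed
  qed
qed

end

section \<open>Integration by parts and the H^2 norm\<close>

lemma L2_integral_limit:
  assumes g: "g \<in> L2_space" and f: "f \<in> L2_space" "\<And>k. F k \<in> L2_space"
    and lim: "(\<lambda>k. L2_norm (\<lambda>x. F k x - f x)) \<longlonglongrightarrow> 0"
  shows "(\<lambda>k. \<integral>x. g x * F k x \<partial>lborel) \<longlonglongrightarrow> (\<integral>x. g x * f x \<partial>lborel)"
proof (rule LIM_zero_cancel, rule tendsto_zero_sequentially[OF tendsto_mult_right_zero[OF lim, of "L2_norm g"]])
  fix k
  show "\<bar>(\<integral>x. g x * F k x \<partial>lborel) - (\<integral>x. g x * f x \<partial>lborel)\<bar> \<le> L2_norm g * L2_norm (\<lambda>x. F k x - f x)"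
    using L2.cauchy_schwarz[OF g L2.diff[OF f(2,1)], of k] by (simp add: L2.diff_right[OF f(2,1) g])
qed

context approximate_identity
begin

text \<open>Test the weak derivative of \<open>weak_deriv b f\<close> with test functions converging
  to \<open>f\<close> in H^1; both sides pass to the limit.\<close>

lemma H2_gradient:
  fixes f :: "'a \<Rightarrow> real"
  assumes f: "f \<in> H2_space" and b: "b \<in> Basis"
  shows "(L2_norm (weak_deriv b f))\<^sup>2 = - (\<integral>x. weak_deriv b (weak_deriv b f) x * f x \<partial>lborel)"
proof -
  have H1: "f \<in> H1_space" "weak_deriv b f \<in> H1_space" using f b by (auto simp: H2_space_def)
  obtain \<phi> where \<phi>: "\<And>k. \<phi> k \<in> test_functions" "\<And>k. \<phi> k \<in> L2_space" "\<And>b k. b \<in> Basis \<Longrightarrow> dir_deriv b (\<phi> k) \<in> L2_space"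
    "(\<lambda>k. L2_norm (\<lambda>x. \<phi> k x - f x)) \<longlonglongrightarrow> 0"
    "\<And>b. b \<in> Basis \<Longrightarrow> (\<lambda>k. L2_norm (\<lambda>x. dir_deriv b (\<phi> k) x - weak_deriv b f x)) \<longlonglongrightarrow> 0"
    by (rule H1_test_function_approximation[OF H1(1)]) blast
  have "(\<lambda>k. \<integral>x. weak_deriv b f x * dir_deriv b (\<phi> k) x \<partial>lborel) \<longlonglongrightarrow> (\<integral>x. weak_deriv b f x * weak_deriv b f x \<partial>lborel)"
    by (intro L2_integral_limit H1_D(2)[OF H1(1)] \<phi> b)
  moreover have "(\<integral>x. weak_deriv b f x * dir_deriv b (\<phi> k) x \<partial>lborel) = - (\<integral>x. weak_deriv b (weak_deriv b f) x * \<phi> k x \<partial>lborel)" for k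
    using H1_D(3)[OF H1(2) b] \<phi>(1) by (simp add: has_weak_deriv_def)
  moreover have "(\<lambda>k. - (\<integral>x. weak_deriv b (weak_deriv b f) x * \<phi> k x \<partial>lborel)) \<longlonglongrightarrow> - (\<integral>x. weak_deriv b (weak_deriv b f) x * f x \<partial>lborel)"
    by (intro tendsto_minus L2_integral_limit H1_D(2)[OF H1(2)] H1_D(1)[OF H1(1)] \<phi> b)
  ultimately have "(\<integral>x. weak_deriv b f x * weak_deriv b f x \<partial>lborel) = - (\<integral>x. weak_deriv b (weak_deriv b f) x * f x \<partial>lborel)"
    using LIMSEQ_unique by simp
  then show ?thesis using L2.nrm_square[OF H1_D(2)[OF H1(1) b]] by simp
qed

text \<open>The gradient does not occur in \<open>H2_norm\<close>, but its squared norm is the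
  negative inner product of \<open>f\<close> with its Laplacian, hence at most the square of
  \<open>H2_norm f\<close>. The squared H^1 norm is thus at most twice this square, and the factor 2
  of the statement leaves room.\<close>

lemma H1_norm_le_H2_norm:
  fixes f :: "'a \<Rightarrow> real"
  assumes f: "f \<in> H2_space"
  shows "H1_norm f \<le> 2 * H2_norm f"
proof -
  let ?\<Delta> = "\<lambda>x. \<Sum>b\<in>Basis. weak_deriv b (weak_deriv b f) x"
  have H1: "f \<in> H1_space" "\<And>b. b \<in> Basis \<Longrightarrow> weak_deriv b f \<in> H1_space" using f by (auto simp: H2_space_def)
  have L: "f \<in> L2_space" "\<And>b. b \<in> Basis \<Longrightarrow> weak_deriv b (weak_deriv b f) \<in> L2_space"
    using H1_D(1)[OF H1(1)] H1_D(2)[OF H1(2)] by auto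
  have S: "(\<lambda>x. \<Sum>b\<in>A. g b x) \<in> L2_space" if "finite A" "\<And>b. b \<in> A \<Longrightarrow> g b \<in> L2_space" for A :: "'a set" and g :: "'a \<Rightarrow> 'a \<Rightarrow> real"
    using that by (induction A rule: finite_induct) (auto simp: L2.zero intro: L2.add)
  have \<Delta>: "?\<Delta> \<in> L2_space" by (intro S L) auto
  have "(\<Sum>b\<in>Basis. (L2_norm (weak_deriv b f))\<^sup>2) = (\<Sum>b\<in>Basis. - (\<integral>x. weak_deriv b (weak_deriv b f) x * f x \<partial>lborel))"
    by (intro sum.cong refl H2_gradient f)
  also have "\<dots> = - (\<integral>x. ?\<Delta> x * f x \<partial>lborel)"
    by (simp add: sum_distrib_right sum_negf L2_mult_integrable[OF L(2) L(1)])
  also have "\<dots> \<le> L2_norm ?\<Delta> * L2_norm f" using L2.cauchy_schwarz[OF \<Delta> L(1)] by linarith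
  also have "\<dots> \<le> H2_norm f * H2_norm f"
    by (intro mult_mono) (auto simp: H2_norm_def L2_norm_def)
  finally have grad: "(\<Sum>b\<in>Basis. (L2_norm (weak_deriv b f))\<^sup>2) \<le> (H2_norm f)\<^sup>2" by (simp add: power2_eq_square)
  have nn: "0 \<le> L2_norm g" for g :: "'a \<Rightarrow> real" by (simp add: L2_norm_def)
  have "(L2_norm f)\<^sup>2 \<le> (H2_norm f)\<^sup>2" by (intro power_mono nn) (simp add: H2_norm_def nn)
  moreover have "(2 * H2_norm f)\<^sup>2 = 4 * (H2_norm f)\<^sup>2" by (simp add: power_mult_distrib)
  ultimately have "(L2_norm f)\<^sup>2 + (\<Sum>b\<in>Basis. (L2_norm (weak_deriv b f))\<^sup>2) \<le> (2 * H2_norm f)\<^sup>2"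
    using grad zero_le_power2[of "H2_norm f"] by linarith
  then show ?thesis
    unfolding H1_norm_def by (rule real_le_lsqrt[rotated]) (simp add: H2_norm_def nn)
qed

end

section \<open>Weak solutions of the wave equation\<close>

context semi_inner
begin

lemma C0_curve_diff:
  assumes u: "C0_curve T V nrm u" and v: "C0_curve T V nrm v"
  shows "C0_curve T V nrm (\<lambda>t x. u t x - v t x)"
  unfolding C0_curve_def
proof (intro ballI conjI)
  fix t assume t: "t \<in> {0..T}"
  note V = C0_curveD(1)[OF u] C0_curveD(1)[OF v]
  show "(\<lambda>x. u t x - v t x) \<in> V" using V t by (intro diff)
  show "((\<lambda>s. nrm (\<lambda>x. (u s x - v s x) - (u t x - v t x))) \<longlongrightarrow> 0) (at t within {0..T})"
  proof (rule tendsto_zero_within[OF tendsto_add_zero[OF C0_curveD(2)[OF u t] C0_curveD(2)[OF v t]]])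
    fix s assume s: "s \<in> {0..T}"
    note d = diff[OF V(1)[OF s] V(1)[OF t]] diff[OF V(2)[OF s] V(2)[OF t]]
    have eq: "(\<lambda>x. (u s x - v s x) - (u t x - v t x)) = (\<lambda>x. (u s x - u t x) - (v s x - v t x))"
      by (simp add: fun_eq_iff)
    show "\<bar>nrm (\<lambda>x. (u s x - v s x) - (u t x - v t x))\<bar> \<le> nrm (\<lambda>x. u s x - u t x) + nrm (\<lambda>x. v s x - v t x)"
      unfolding eq using nrm_diff_le[OF d] nrm_nonneg[OF diff[OF d]] by simp
  qed
qed

lemma curve_deriv_diff:
  assumes u: "C0_curve T V nrm u" "C0_curve T V nrm u'" "curve_deriv T nrm u u'"
    and v: "C0_curve T V nrm v" "C0_curve T V nrm v'" "curve_deriv T nrm v v'"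
  shows "curve_deriv T nrm (\<lambda>t x. u t x - v t x) (\<lambda>t x. u' t x - v' t x)"
  unfolding curve_deriv_def
proof
  fix t assume t: "t \<in> {0..T}"
  let ?d = "\<lambda>u u' s x. (u s x - u t x) / (s - t) - u' t x"
  have lim: "((\<lambda>s. nrm (?d u u' s)) \<longlongrightarrow> 0) (at t within {0..T})" "((\<lambda>s. nrm (?d v v' s)) \<longlongrightarrow> 0) (at t within {0..T})"
    using u(3) v(3) t by (auto simp: curve_deriv_def)
  show "((\<lambda>s. nrm (\<lambda>x. ((u s x - v s x) - (u t x - v t x)) / (s - t) - (u' t x - v' t x))) \<longlongrightarrow> 0) (at t within {0..T})"
  proof (rule tendsto_zero_within[OF tendsto_add_zero[OF lim]])
    fix s assume s: "s \<in> {0..T}"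
    note d = diff[OF difference_quotient_closed[OF C0_curveD(1)[OF u(1) s] C0_curveD(1)[OF u(1) t]] C0_curveD(1)[OF u(2) t]]
      diff[OF difference_quotient_closed[OF C0_curveD(1)[OF v(1) s] C0_curveD(1)[OF v(1) t]] C0_curveD(1)[OF v(2) t]]
    have eq: "(\<lambda>x. ((u s x - v s x) - (u t x - v t x)) / (s - t) - (u' t x - v' t x)) = (\<lambda>x. ?d u u' s x - ?d v v' s x)"
      by (simp add: fun_eq_iff diff_divide_distrib)
    show "\<bar>nrm (\<lambda>x. ((u s x - v s x) - (u t x - v t x)) / (s - t) - (u' t x - v' t x))\<bar>
      \<le> nrm (?d u u' s) + nrm (?d v v' s)"
      unfolding eq using nrm_diff_le[OF d] nrm_nonneg[OF diff[OF d]] by simp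
  qed
qed

end

section \<open>The energy form\<close>

lemma sum_Basis_axis: "(\<Sum>b\<in>Basis. f b) = (\<Sum>j\<in>UNIV. f (axis j (1::real) :: real^'n::finite))"
proof -
  have "(Basis :: (real^'n) set) = range (\<lambda>j. axis j 1)" by (auto simp: Basis_vec_def)
  moreover have "inj (\<lambda>j. axis j (1::real) :: real^'n)" by (simp add: inj_on_def axis_eq_axis)
  ultimately show ?thesis using sum.reindex[of "\<lambda>j. axis j (1::real) :: real^'n" UNIV f] by (simp add: comp_def)
qed

lemma axis_Basis: "axis j (1::real) \<in> Basis"
  by simp

text \<open>The bound holds only almost everywhere because it stems from an essential
  supremum.\<close>

definition bounded_coefficients :: "('n \<Rightarrow> real^'n::finite \<Rightarrow> real) \<Rightarrow> real \<Rightarrow> bool" where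
  "bounded_coefficients h H \<longleftrightarrow> (\<forall>j. h j \<in> borel_measurable borel \<and> (AE x in lborel. \<bar>h j x\<bar> \<le> H))"

definition energy_form :: "('n \<Rightarrow> real^'n::finite \<Rightarrow> real) \<Rightarrow> (real^'n \<Rightarrow> real) \<Rightarrow> (real^'n \<Rightarrow> real) \<Rightarrow> real" where
  "energy_form h f g = (\<Sum>j\<in>UNIV. \<integral>x. h j x * weak_deriv (axis j 1) f x * weak_deriv (axis j 1) g x \<partial>lborel)"

lemma L2_norm_weak_deriv_le: "L2_norm (weak_deriv (axis j 1) f) \<le> H1_norm (f :: real^'n::finite \<Rightarrow> real)"
proof -
  have "(L2_norm (weak_deriv (axis j 1) f))\<^sup>2 \<le> (\<Sum>j\<in>UNIV. (L2_norm (weak_deriv (axis j 1) f))\<^sup>2)"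
    by (rule member_le_sum) auto
  then have "sqrt ((L2_norm (weak_deriv (axis j 1) f))\<^sup>2) \<le> H1_norm f"
    unfolding H1_norm_def sum_Basis_axis by (intro real_sqrt_le_mono) (simp add: add_increasing)
  then show ?thesis by (simp add: L2_norm_def)
qed

lemma L2_norm_le_H1_norm: "L2_norm f \<le> H1_norm f"
proof -
  have "sqrt ((L2_norm f)\<^sup>2) \<le> H1_norm f"
    unfolding H1_norm_def by (intro real_sqrt_le_mono) (simp add: sum_nonneg)
  then show ?thesis by (simp add: L2_norm_def)
qed

lemma L2_weighted_product:
  assumes f: "f \<in> L2_space" "g \<in> L2_space" and w: "w \<in> borel_measurable borel" "AE x in lborel. \<bar>w x\<bar> \<le> H"
  shows "\<bar>\<integral>x. w x * f x * g x \<partial>lborel\<bar> \<le> H * (L2_norm f * L2_norm g)"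
  using order_trans[OF L2.cauchy_schwarz[OF L2_weight(1)[OF f(1) w] f(2)]
      mult_right_mono[OF L2_weight(2)[OF f(1) w] L2.nrm_nonneg[OF f(2)]]]
  by (simp add: mult.assoc)

lemma energy_form_bound:
  assumes h: "bounded_coefficients h H" and f: "f \<in> H1_space" "g \<in> H1_space"
  shows "\<bar>energy_form h f g\<bar> \<le> (real CARD('n::finite) * H) * (H1_norm f * H1_norm (g :: real^'n \<Rightarrow> real))"
proof -
  have "\<bar>\<integral>x. h j x * weak_deriv (axis j 1) f x * weak_deriv (axis j 1) g x \<partial>lborel\<bar> \<le> H * (H1_norm f * H1_norm g)" for j
  proof -
    have "\<exists>x. \<bar>h j x\<bar> \<le> H"
      using h eventually_happens[of "\<lambda>x. \<bar>h j x\<bar> \<le> H" "ae_filter lborel"]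
      by (simp add: bounded_coefficients_def ae_filter_eq_bot_iff)
    then have H: "0 \<le> H" by (meson abs_ge_zero order_trans)
    have "\<bar>\<integral>x. h j x * weak_deriv (axis j 1) f x * weak_deriv (axis j 1) g x \<partial>lborel\<bar>
      \<le> H * (L2_norm (weak_deriv (axis j 1) f) * L2_norm (weak_deriv (axis j 1) g))"
      using h by (intro L2_weighted_product H1_D f axis_Basis) (auto simp: bounded_coefficients_def)
    also have "\<dots> \<le> H * (H1_norm f * H1_norm g)"
      using H by (intro mult_left_mono mult_mono L2_norm_weak_deriv_le) (auto simp: L2_norm_def H1_norm_def sum_nonneg)
    finally show ?thesis .
  qed
  then have "\<bar>energy_form h f g\<bar> \<le> (\<Sum>j\<in>(UNIV :: 'n set). H * (H1_norm f * H1_norm g))"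
    unfolding energy_form_def by (intro order_trans[OF sum_abs] sum_mono)
  then show ?thesis by (simp add: mult.assoc)
qed

lemma energy_form_commute: "energy_form h f g = energy_form h g f"
  by (simp add: energy_form_def mult.assoc mult.left_commute mult.commute)

lemma energy_form_coefficient_diff:
  assumes h: "bounded_coefficients h H" "bounded_coefficients k K" and f: "f \<in> H1_space" "g \<in> H1_space"
  shows "energy_form (\<lambda>j x. h j x - k j x) f g = energy_form h f g - energy_form k f g"
proof -
  have "integrable lborel (\<lambda>x. w j x * weak_deriv (axis j 1) f x * weak_deriv (axis j 1) g x)"
    if "bounded_coefficients w W" for w W j
    using that by (intro L2_mult_integrable L2_weight(1)[where D = W] H1_D f axis_Basis) (auto simp: bounded_coefficients_def)
  from this[OF h(1)] this[OF h(2)] show ?thesis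
    by (simp add: energy_form_def left_diff_distrib sum_subtractf)
qed

text \<open>Only the gradient is controlled; the L^2 part of the H^1 norm is recovered later by
  integrating the velocity.\<close>

lemma energy_form_coercive:
  assumes h: "bounded_coefficients h H" "\<And>j x. c \<le> h j x" and f: "f \<in> H1_space"
  shows "c * (\<Sum>b\<in>Basis. (L2_norm (weak_deriv b f))\<^sup>2) \<le> energy_form h f f"
  unfolding sum_Basis_axis sum_distrib_left energy_form_def
proof (rule sum_mono)
  fix j
  let ?g = "weak_deriv (axis j 1) f"
  have g: "?g \<in> L2_space" by (rule H1_D(2)[OF f axis_Basis])
  have "c * (L2_norm ?g)\<^sup>2 = (\<integral>x. c * (?g x * ?g x) \<partial>lborel)" by (simp add: L2.nrm_square[OF g])
  also have "\<dots> \<le> (\<integral>x. h j x * ?g x * ?g x \<partial>lborel)"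
  proof (rule integral_mono)
    show "integrable lborel (\<lambda>x. h j x * ?g x * ?g x)"
      using h(1) by (intro L2_mult_integrable L2_weight(1)[where D = H] g) (auto simp: bounded_coefficients_def)
    show "c * (?g x * ?g x) \<le> h j x * ?g x * ?g x" for x
      unfolding mult.assoc by (rule mult_right_mono[OF h(2)]) simp
  qed (use L2_mult_integrable[OF g g] in simp)
  finally show "c * (L2_norm ?g)\<^sup>2 \<le> (\<integral>x. h j x * ?g x * ?g x \<partial>lborel)" .
qed

locale cartesian_approximate_identity = approximate_identity \<rho> r
  for \<rho> :: "nat \<Rightarrow> real^'n::finite \<Rightarrow> real" and r
begin

lemma energy_form_combine:
  fixes h :: "'n \<Rightarrow> real^'n \<Rightarrow> real"
  assumes h: "bounded_coefficients h H" and "f \<in> H1_space" "g \<in> H1_space" "k \<in> H1_space"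
  shows "energy_form h (\<lambda>x. c * f x + d * g x) k = c * energy_form h f k + d * energy_form h g (k :: real^'n \<Rightarrow> real)"
proof -
  have "(\<lambda>x. h j x * weak_deriv (axis j 1) k x) \<in> L2_space" for j
    using h by (intro L2_weight(1)[where D = H] H1_D assms axis_Basis) (auto simp: bounded_coefficients_def)
  note * = weak_deriv_form_combine[OF assms(2,3) axis_Basis this]
  have eq: "h j x * y * z = y * (h j x * z)" for j x y z by simp
  show ?thesis
    unfolding energy_form_def eq * sum.distrib sum_distrib_left ..
qed

lemma energy_form_diff_left:
  fixes h :: "'n \<Rightarrow> real^'n \<Rightarrow> real"
  assumes h: "bounded_coefficients h H" and "f \<in> H1_space" "g \<in> H1_space" "k \<in> H1_space"
  shows "energy_form h (\<lambda>x. f x - g x) k = energy_form h f k - energy_form h g (k :: real^'n \<Rightarrow> real)"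
  using energy_form_combine[OF assms, of 1 "-1"] by simp

lemma energy_form_semi_inner:
  fixes h :: "'n \<Rightarrow> real^'n \<Rightarrow> real"
  assumes h: "bounded_coefficients h H" "\<And>j x. 0 \<le> h j x"
  shows "semi_inner (H1_space :: (real^'n \<Rightarrow> real) set) (energy_form h)"
proof
  show "energy_form h (\<lambda>x. f x + g x) k = energy_form h f k + energy_form h g k"
    if "f \<in> H1_space" "g \<in> H1_space" "k \<in> H1_space" for f g k
    using energy_form_combine[OF h(1) that, of 1 1] by simp
  show "energy_form h (\<lambda>x. c * f x) k = c * energy_form h f k" if "f \<in> H1_space" "k \<in> H1_space" for f k c
    using energy_form_combine[OF h(1) that(1,1,2), of c 0] by simp
  show "0 \<le> energy_form h f f" for f
    unfolding energy_form_def using h(2)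
    by (intro sum_nonneg integral_nonneg_AE always_eventually allI) (simp add: mult.assoc)
qed (use H1.zero H1.add H1.scale energy_form_commute in auto)

lemma energy_form_curve_continuous:
  fixes T :: real and h :: "'n \<Rightarrow> real^'n \<Rightarrow> real" and u v :: "real \<Rightarrow> real^'n \<Rightarrow> real"
  assumes h: "bounded_coefficients h H" and u: "C0_curve T H1_space H1_norm u" "C0_curve T H1_space H1_norm v"
  shows "continuous_on ({0..T} \<times> {0..T}) (\<lambda>(s, t). energy_form h (u s) (v t))"
proof (rule H1.continuous_on_bilinear[OF u energy_form_bound[OF h] energy_form_diff_left[OF h]])
  show "energy_form h k (\<lambda>x. f x - g x) = energy_form h k f - energy_form h k g"
    if "f \<in> H1_space" "g \<in> H1_space" "k \<in> H1_space" for f g k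
    using energy_form_diff_left[OF h that] by (simp only: energy_form_commute[of h k])
qed


section \<open>Energy and difference estimates for weak solutions\<close>

definition weak_wave_equation ::
    "real \<Rightarrow> ('n \<Rightarrow> real^'n \<Rightarrow> real) \<Rightarrow> (real \<Rightarrow> real^'n \<Rightarrow> real) \<Rightarrow> (real \<Rightarrow> real^'n \<Rightarrow> real) \<Rightarrow> bool" where
  "weak_wave_equation T h u u' \<longleftrightarrow>
     C0_curve T H1_space H1_norm u \<and> C0_curve T L2_space L2_norm u \<and>
     C0_curve T L2_space L2_norm u' \<and> curve_deriv T L2_norm u u' \<and>
     (\<forall>\<phi>\<in>test_functions. \<forall>t\<in>{0..T}.
        ((\<lambda>s. \<integral>x. u' s x * \<phi> x \<partial>lborel) has_real_derivative
           - (\<Sum>j\<in>UNIV. \<integral>x. h j x * weak_deriv (axis j 1) (u t) x * dir_deriv (axis j 1) \<phi> x \<partial>lborel)) (at t within {0..T}))"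

text \<open>Approximate \<open>f\<close> by test functions. To pass to the limit under the time
  derivative, the derivatives must converge uniformly in time, and they do because the solution is
  bounded in H^1 on the compact time interval.\<close>

lemma weak_wave_equation_H1:
  fixes T :: real and h :: "'n \<Rightarrow> real^'n \<Rightarrow> real" and u u' :: "real \<Rightarrow> real^'n \<Rightarrow> real"
  assumes h: "bounded_coefficients h H" and w: "weak_wave_equation T h u u'" and f: "f \<in> H1_space" and t: "t \<in> {0..T}"
  shows "((\<lambda>s. \<integral>x. u' s x * f x \<partial>lborel) has_real_derivative - energy_form h (u t) f) (at t within {0..T})"
proof -
  obtain \<phi> where \<phi>: "\<And>k. \<phi> k \<in> test_functions" "\<And>k. \<phi> k \<in> L2_space" "\<And>b k. b \<in> Basis \<Longrightarrow> dir_deriv b (\<phi> k) \<in> L2_space"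
    "(\<lambda>k. L2_norm (\<lambda>x. \<phi> k x - f x)) \<longlonglongrightarrow> 0"
    "\<And>b. b \<in> Basis \<Longrightarrow> (\<lambda>k. L2_norm (\<lambda>x. dir_deriv b (\<phi> k) x - weak_deriv b f x)) \<longlonglongrightarrow> 0"
    by (rule H1_test_function_approximation[OF f]) blast
  have u: "C0_curve T H1_space H1_norm u" and u': "C0_curve T L2_space L2_norm u'"
    using w by (auto simp: weak_wave_equation_def)
  obtain M where M: "0 \<le> M" "\<And>t. t \<in> {0..T} \<Longrightarrow> H1_norm (u t) \<le> M" by (rule H1.C0_curve_bounded[OF u]) blast
  define d where "d k s = - (\<Sum>j\<in>UNIV. \<integral>x. h j x * weak_deriv (axis j 1) (u s) x * dir_deriv (axis j 1) (\<phi> k) x \<partial>lborel)" for k s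
  \<comment> \<open>Independent of the time: \<open>M\<close> bounds the H^1 norm of the solution
    throughout \<open>{0..T}\<close>.\<close>
  define err where "err k = (\<Sum>j\<in>UNIV. \<bar>H\<bar> * (M * L2_norm (\<lambda>x. dir_deriv (axis j 1) (\<phi> k) x - weak_deriv (axis j 1) f x)))" for k
  have "(\<lambda>k. err k) \<longlonglongrightarrow> (\<Sum>j\<in>(UNIV :: 'n set). \<bar>H\<bar> * (M * 0))"
    unfolding err_def by (intro tendsto_sum tendsto_mult tendsto_const \<phi>(5) axis_Basis)
  then have err: "err \<longlonglongrightarrow> 0" by simp
  have close: "\<bar>d k s - - energy_form h (u s) f\<bar> \<le> err k" if s: "s \<in> {0..T}" for k s
  proof -
    have us: "u s \<in> H1_space" by (rule H1.C0_curveD(1)[OF u s])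
    have summand: "\<bar>(\<integral>x. h j x * weak_deriv (axis j 1) (u s) x * dir_deriv (axis j 1) (\<phi> k) x \<partial>lborel)
        - (\<integral>x. h j x * weak_deriv (axis j 1) (u s) x * weak_deriv (axis j 1) f x \<partial>lborel)\<bar>
        \<le> \<bar>H\<bar> * (M * L2_norm (\<lambda>x. dir_deriv (axis j 1) (\<phi> k) x - weak_deriv (axis j 1) f x))" for j
    proof -
      let ?g = "weak_deriv (axis j 1) (u s)" and ?e = "\<lambda>x. dir_deriv (axis j 1) (\<phi> k) x - weak_deriv (axis j 1) f x"
      have hj: "h j \<in> borel_measurable borel" "AE x in lborel. \<bar>h j x\<bar> \<le> H" using h by (auto simp: bounded_coefficients_def)
      have g: "?g \<in> L2_space" by (rule H1_D(2)[OF us axis_Basis])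
      have p: "dir_deriv (axis j 1) (\<phi> k) \<in> L2_space" "weak_deriv (axis j 1) f \<in> L2_space"
        by (rule \<phi>(3)[OF axis_Basis], rule H1_D(2)[OF f axis_Basis])
      have "\<bar>\<integral>x. h j x * ?g x * ?e x \<partial>lborel\<bar> \<le> H * (L2_norm ?g * L2_norm ?e)"
        by (rule L2_weighted_product[OF g L2.diff[OF p] hj])
      also have "\<dots> \<le> \<bar>H\<bar> * (L2_norm ?g * L2_norm ?e)"
        by (intro mult_right_mono) (auto simp: L2_norm_def)
      also have "\<dots> \<le> \<bar>H\<bar> * (M * L2_norm ?e)"
        using order_trans[OF L2_norm_weak_deriv_le M(2)[OF s]]
        by (intro mult_left_mono mult_right_mono) (auto simp: L2_norm_def)
      finally show ?thesis using L2.diff_right[OF p L2_weight(1)[OF g hj]] by simp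
    qed
    have "\<bar>d k s - - energy_form h (u s) f\<bar> = \<bar>\<Sum>j\<in>UNIV. (\<integral>x. h j x * weak_deriv (axis j 1) (u s) x * dir_deriv (axis j 1) (\<phi> k) x \<partial>lborel)
        - (\<integral>x. h j x * weak_deriv (axis j 1) (u s) x * weak_deriv (axis j 1) f x \<partial>lborel)\<bar>"
      unfolding d_def energy_form_def sum_subtractf by linarith
    then show ?thesis
      unfolding err_def using summand by (metis (no_types, lifting) order_trans sum_abs sum_mono)
  qed
  \<comment> \<open>Uniform convergence of the derivatives yields some limit function
    \<open>g\<close> with the right derivative; it is identified afterwards by uniqueness of
    limits.\<close>
  have "\<exists>g. \<forall>s\<in>{0..T}. (\<lambda>k. \<integral>x. u' s x * \<phi> k x \<partial>lborel) \<longlonglongrightarrow> g s \<and>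
      (g has_derivative (\<lambda>y. - energy_form h (u s) f * y)) (at s within {0..T})"
  proof (rule has_derivative_sequence)
    show "((\<lambda>s. \<integral>x. u' s x * \<phi> k x \<partial>lborel) has_derivative (\<lambda>y. d k s * y)) (at s within {0..T})" if "s \<in> {0..T}" for k s
      using w \<phi>(1)[of k] that unfolding weak_wave_equation_def has_field_derivative_def d_def by blast
    show "\<forall>\<^sub>F k in sequentially. \<forall>s\<in>{0..T}. \<forall>y. norm (d k s * y - - energy_form h (u s) f * y) \<le> e * norm y"
      if "e > 0" for e
      using order_tendstoD(2)[OF err that]
    proof eventually_elim
      case (elim k)
      show ?case
      proof (intro ballI allI)
        fix s y :: real assume "s \<in> {0..T}"
        then have "\<bar>d k s - - energy_form h (u s) f\<bar> \<le> e" using close[of s k] elim by linarith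
        then have "\<bar>d k s - - energy_form h (u s) f\<bar> * \<bar>y\<bar> \<le> e * \<bar>y\<bar>" by (rule mult_right_mono) simp
        then show "norm (d k s * y - - energy_form h (u s) f * y) \<le> e * norm y"
          unfolding real_norm_def left_diff_distrib[symmetric] abs_mult .
      qed
    qed
    show "(\<lambda>k. \<integral>x. u' t x * \<phi> k x \<partial>lborel) \<longlonglongrightarrow> (\<integral>x. u' t x * f x \<partial>lborel)"
      by (rule L2_integral_limit[OF L2.C0_curveD(1)[OF u' t] H1_D(1)[OF f] \<phi>(2,4)])
  qed (use t in auto)
  then obtain g where g: "\<And>s. s \<in> {0..T} \<Longrightarrow> (\<lambda>k. \<integral>x. u' s x * \<phi> k x \<partial>lborel) \<longlonglongrightarrow> g s"
      "\<And>s. s \<in> {0..T} \<Longrightarrow> (g has_derivative (\<lambda>y. - energy_form h (u s) f * y)) (at s within {0..T})" by blast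
  have "g s = (\<integral>x. u' s x * f x \<partial>lborel)" if s: "s \<in> {0..T}" for s
    by (rule LIMSEQ_unique[OF g(1)[OF s] L2_integral_limit[OF L2.C0_curveD(1)[OF u' s] H1_D(1)[OF f] \<phi>(2,4)]])
  then show ?thesis
    unfolding has_field_derivative_def by (intro has_derivative_transform[OF t _ g(2)[OF t]]) auto
qed

text \<open>With F(s,t) = <u'(s), u(t)>, the derivative in s is the equation tested with u(t), which
  lies in H^1, and the derivative in t is that of the curve u paired with the fixed u'(s).\<close>

lemma wave_energy:
  fixes T :: real and h :: "'n \<Rightarrow> real^'n \<Rightarrow> real" and u u' :: "real \<Rightarrow> real^'n \<Rightarrow> real"
  assumes h: "bounded_coefficients h H" and w: "weak_wave_equation T h u u'" and t: "t \<in> {0..T}"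
  shows "energy_form h (u t) (u t) + (L2_norm (u' t))\<^sup>2 = energy_form h (u 0) (u 0) + (L2_norm (u' 0))\<^sup>2"
proof -
  have u: "C0_curve T H1_space H1_norm u" "C0_curve T L2_space L2_norm u" and u': "C0_curve T L2_space L2_norm u'"
    and D: "curve_deriv T L2_norm u u'"
    using w by (auto simp: weak_wave_equation_def)
  have "energy_form h (u t) (u t) + (\<integral>x. u' t x * u' t x \<partial>lborel) = energy_form h (u 0) (u 0) + (\<integral>x. u' 0 x * u' 0 x \<partial>lborel)"
  proof (rule wave_kernel_energy[where A = "\<lambda>s t. energy_form h (u s) (u t)" and G = "\<lambda>s t. \<integral>x. u' s x * u' t x \<partial>lborel"
        and F = "\<lambda>s t. \<integral>x. u' s x * u t x \<partial>lborel", OF _ _ _ _ _ _ t])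
    show "continuous_on ({0..T} \<times> {0..T}) (\<lambda>(s, t). energy_form h (u s) (u t))"
      by (rule energy_form_curve_continuous[OF h u(1) u(1)])
    show "continuous_on ({0..T} \<times> {0..T}) (\<lambda>(s, t). \<integral>x. u' s x * u' t x \<partial>lborel)"
    proof (rule L2.continuous_on_bilinear[OF u' u', of _ 1])
      show "\<bar>\<integral>x. f x * g x \<partial>lborel\<bar> \<le> 1 * (L2_norm f * L2_norm g)" if "f \<in> L2_space" "g \<in> L2_space" for f g :: "real^'n \<Rightarrow> real"
        using L2.cauchy_schwarz[OF that] by simp
    qed (rule L2.diff_left L2.diff_right; assumption)+
    fix s q assume s: "s \<in> {0..T}" and q: "q \<in> {0..T}"
    show "((\<lambda>s. \<integral>x. u' s x * u q x \<partial>lborel) has_real_derivative - energy_form h (u s) (u q)) (at s within {0..T})"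
      by (rule weak_wave_equation_H1[OF h w H1.C0_curveD(1)[OF u(1) q] s])
    show "((\<lambda>q. \<integral>x. u' s x * u q x \<partial>lborel) has_real_derivative (\<integral>x. u' s x * u' q x \<partial>lborel)) (at q within {0..T})"
      using L2.ip_curve_deriv[OF u(2) u' D L2.C0_curveD(1)[OF u' s] q] by (simp add: mult.commute)
  qed (simp_all add: energy_form_commute mult.commute)
  then show ?thesis
    using L2.nrm_square[OF L2.C0_curveD(1)[OF u' t]] L2.nrm_square[OF L2.C0_curveD(1)[OF u', of 0]] t by simp
qed

text \<open>One number \<open>K\<close>, at least 1, bounds coefficients and data, so that lower
  powers of \<open>K\<close> can be absorbed by higher ones. Conservation bounds gradient and
  velocity, and integrating the velocity bounds u(t) in L^2. The two summands under the root come
  from this position bound and, divided by the ellipticity constant \<open>c0\<close>, from the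
  gradient bound.\<close>

lemma wave_a_priori_bound:
  fixes T :: real and h :: "'n \<Rightarrow> real^'n \<Rightarrow> real" and u u' :: "real \<Rightarrow> real^'n \<Rightarrow> real"
  assumes h: "bounded_coefficients h H" "\<And>j x. c0 \<le> h j x" and c0: "0 < c0" and w: "weak_wave_equation T h u u'"
    and K: "1 \<le> K" "H \<le> K" "H1_norm (u 0) \<le> K" "L2_norm (u' 0) \<le> K" and t: "t \<in> {0..T}"
  shows "H1_norm (u t) \<le> sqrt ((1 + T * (real CARD('n) + 1))\<^sup>2 + (real CARD('n) + 1) / c0) * K\<^sup>2"
proof -
  let ?n = "real CARD('n) + 1"
  have u: "C0_curve T H1_space H1_norm u" "C0_curve T L2_space L2_norm u" and u': "C0_curve T L2_space L2_norm u'"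
    and D: "curve_deriv T L2_norm u u'"
    using w by (auto simp: weak_wave_equation_def)
  have T: "0 \<in> {0..T}" "0 \<le> T" using t by auto
  have uH: "u s \<in> H1_space" and uL: "u s \<in> L2_space" and u'L: "u' s \<in> L2_space" if "s \<in> {0..T}" for s
    using H1.C0_curveD(1)[OF u(1) that] L2.C0_curveD(1)[OF u(2) that] L2.C0_curveD(1)[OF u' that] by auto
  have K0: "0 \<le> K" using K(1) by linarith
  have K34: "K ^ 3 \<le> K ^ 4" "K\<^sup>2 \<le> K ^ 3" "K \<le> K\<^sup>2"
    using K(1) power_increasing[of 1 2 K] by (auto intro: power_increasing)
  \<comment> \<open>The form at time 0 is at most n K K^2, with n the dimension, and the velocity
    term at most K^2, which is absorbed by K^3; this explains n + 1.\<close>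
  have energy: "energy_form h (u s) (u s) + (L2_norm (u' s))\<^sup>2 \<le> ?n * K ^ 3" if s: "s \<in> {0..T}" for s
  proof -
    have nn: "0 \<le> H1_norm (u 0)" by (rule H1.nrm_nonneg[OF uH[OF T(1)]])
    have "\<bar>energy_form h (u 0) (u 0)\<bar> \<le> (real CARD('n) * H) * (H1_norm (u 0) * H1_norm (u 0))"
      by (rule energy_form_bound[OF h(1) uH[OF T(1)] uH[OF T(1)]])
    also have "\<dots> \<le> (real CARD('n) * K) * (K * K)"
      using K K0 nn by (intro mult_mono mult_left_mono) auto
    also have "\<dots> = real CARD('n) * K ^ 3" by (simp add: power3_eq_cube)
    finally have "energy_form h (u 0) (u 0) \<le> real CARD('n) * K ^ 3" by linarith
    moreover have "(L2_norm (u' 0))\<^sup>2 \<le> K ^ 3"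
      using power_mono[OF K(4) L2.nrm_nonneg[OF u'L[OF T(1)]], of 2] K34(2) by linarith
    ultimately show ?thesis unfolding wave_energy[OF h(1) w s] by (simp add: distrib_right)
  qed
  have form_lower: "c0 * (\<Sum>b\<in>Basis. (L2_norm (weak_deriv b (u s)))\<^sup>2) \<le> energy_form h (u s) (u s)" if "s \<in> {0..T}" for s
    by (rule energy_form_coercive[OF h uH[OF that]])
  have velocity: "L2_norm (u' s) \<le> ?n * K\<^sup>2" if s: "s \<in> {0..T}" for s
  proof (rule power2_le_imp_le)
    have "0 \<le> c0 * (\<Sum>b\<in>Basis. (L2_norm (weak_deriv b (u s)))\<^sup>2)"
      using c0 by (intro mult_nonneg_nonneg sum_nonneg) auto
    then have "(L2_norm (u' s))\<^sup>2 \<le> ?n * K ^ 3" using energy[OF s] form_lower[OF s] by linarith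
    also have "\<dots> \<le> (?n * ?n) * K ^ 4" using K34(1) K0 by (intro mult_mono) auto
    also have "\<dots> = (?n * K\<^sup>2)\<^sup>2" by (simp add: power2_eq_square power4_eq_xxxx)
    finally show "(L2_norm (u' s))\<^sup>2 \<le> (?n * K\<^sup>2)\<^sup>2" .
  qed simp
  \<comment> \<open>The norm itself is not differentiated: with u(t) fixed, <u(s), u(t)> is followed
    from s = 0 to s = t, where it equals |u(t)|^2, and one factor |u(t)| cancels.\<close>
  have position: "L2_norm (u t) \<le> (1 + T * ?n) * K\<^sup>2"
  proof -
    let ?N = "L2_norm (u t)"
    have N: "0 \<le> ?N" by (rule L2.nrm_nonneg[OF uL[OF t]])
    have "(\<integral>x. u t x * u t x \<partial>lborel) \<le> (\<integral>x. u 0 x * u t x \<partial>lborel) + (?n * K\<^sup>2 * ?N) * (t - 0)"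
    proof (rule derivative_upper_bound[OF L2.ip_curve_deriv[OF u(2) u' D uL[OF t]] _ t])
      fix s assume s: "s \<in> {0..T}"
      have "(\<integral>x. u' s x * u t x \<partial>lborel) \<le> L2_norm (u' s) * ?N"
        using L2.cauchy_schwarz[OF u'L[OF s] uL[OF t]] by linarith
      also have "\<dots> \<le> ?n * K\<^sup>2 * ?N" by (rule mult_right_mono[OF velocity[OF s] N])
      finally show "(\<integral>x. u' s x * u t x \<partial>lborel) \<le> ?n * K\<^sup>2 * ?N" .
    qed
    also have "\<dots> \<le> K\<^sup>2 * ?N + (?n * K\<^sup>2 * ?N) * T"
    proof (rule add_mono)
      have "(\<integral>x. u 0 x * u t x \<partial>lborel) \<le> L2_norm (u 0) * ?N"
        using L2.cauchy_schwarz[OF uL[OF T(1)] uL[OF t]] by linarith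
      also have "\<dots> \<le> K\<^sup>2 * ?N"
        using order_trans[OF L2_norm_le_H1_norm K(3)] K34(3) N by (intro mult_right_mono) auto
      finally show "(\<integral>x. u 0 x * u t x \<partial>lborel) \<le> K\<^sup>2 * ?N" .
      show "(?n * K\<^sup>2 * ?N) * (t - 0) \<le> (?n * K\<^sup>2 * ?N) * T"
        using t N by (intro mult_left_mono) auto
    qed
    finally have "?N * ?N \<le> ((1 + T * ?n) * K\<^sup>2) * ?N"
      using L2.nrm_square[OF uL[OF t]] by (simp add: power2_eq_square algebra_simps)
    then show ?thesis
      using N T(2) by (cases "?N = 0") (auto simp: mult_le_cancel_right)
  qed
  have "(\<Sum>b\<in>Basis. (L2_norm (weak_deriv b (u t)))\<^sup>2) \<le> ?n / c0 * K ^ 4"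
  proof -
    have "c0 * (\<Sum>b\<in>Basis. (L2_norm (weak_deriv b (u t)))\<^sup>2) \<le> ?n * K ^ 3"
      using energy[OF t] form_lower[OF t] zero_le_power2[of "L2_norm (u' t)"] by linarith
    also have "\<dots> \<le> ?n * K ^ 4" using K34(1) by (intro mult_left_mono) auto
    finally show ?thesis using c0 by (simp add: field_simps)
  qed
  moreover have "(L2_norm (u t))\<^sup>2 \<le> (1 + T * ?n)\<^sup>2 * K ^ 4"
    using power_mono[OF position L2.nrm_nonneg[OF uL[OF t]], of 2] by (simp add: power_mult_distrib)
  ultimately have "(L2_norm (u t))\<^sup>2 + (\<Sum>b\<in>Basis. (L2_norm (weak_deriv b (u t)))\<^sup>2)
      \<le> ((1 + T * ?n)\<^sup>2 + ?n / c0) * (K\<^sup>2)\<^sup>2"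
    by (simp add: distrib_right)
  then have "H1_norm (u t) \<le> sqrt (((1 + T * ?n)\<^sup>2 + ?n / c0) * (K\<^sup>2)\<^sup>2)"
    unfolding H1_norm_def by (rule real_sqrt_le_mono)
  moreover have "sqrt ((K\<^sup>2)\<^sup>2) = K\<^sup>2" by (simp only: real_sqrt_abs abs_power2)
  ultimately show ?thesis by (simp only: real_sqrt_mult)
qed

text \<open>\<open>wave_kernel_estimate\<close> for the difference w. Since |w| \<le> 2 M in H^1,
  the bounds are \<open>m1 = 2 * M * \<delta>1\<close> for the initial velocity and
  \<open>m2 = 2 * n * \<delta> * M\<^sup>2\<close>, with n the dimension, for the source. Only a
  bound on \<open>h - k\<close> and H^1 bounds enter, so the source need not be square
  integrable.\<close>

lemma wave_difference_estimate:
  fixes T :: real and h k :: "'n \<Rightarrow> real^'n \<Rightarrow> real" and u u' v v' :: "real \<Rightarrow> real^'n \<Rightarrow> real"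
  assumes h: "bounded_coefficients h H" "\<And>j x. 0 \<le> h j x" and k: "bounded_coefficients k K"
    and hk: "bounded_coefficients (\<lambda>j x. h j x - k j x) \<delta>"
    and wu: "weak_wave_equation T h u u'" and wv: "weak_wave_equation T k v v'"
    and M: "\<And>t. t \<in> {0..T} \<Longrightarrow> H1_norm (u t) \<le> M" "\<And>t. t \<in> {0..T} \<Longrightarrow> H1_norm (v t) \<le> M"
    and \<delta>1: "L2_norm (\<lambda>x. u' 0 x - v' 0 x) \<le> \<delta>1" and \<delta>: "0 \<le> \<delta>" and t: "t \<in> {0..T}"
  shows "(L2_norm (\<lambda>x. u t x - v t x))\<^sup>2 \<le> (L2_norm (\<lambda>x. u 0 x - v 0 x))\<^sup>2
    + 2 * T * (2 * M * \<delta>1 + T * (2 * real CARD('n) * \<delta> * M\<^sup>2))"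
proof -
  have u: "C0_curve T H1_space H1_norm u" "C0_curve T L2_space L2_norm u" "C0_curve T L2_space L2_norm u'" "curve_deriv T L2_norm u u'"
    and v: "C0_curve T H1_space H1_norm v" "C0_curve T L2_space L2_norm v" "C0_curve T L2_space L2_norm v'" "curve_deriv T L2_norm v v'"
    using wu wv by (auto simp: weak_wave_equation_def)
  define w where "w = (\<lambda>t x. u t x - v t x)"
  define w' where "w' = (\<lambda>t x. u' t x - v' t x)"
  have w: "C0_curve T H1_space H1_norm w" "C0_curve T L2_space L2_norm w" "C0_curve T L2_space L2_norm w'" "curve_deriv T L2_norm w w'"
    unfolding w_def w'_def
    by (rule H1.C0_curve_diff[OF u(1) v(1)] L2.C0_curve_diff[OF u(2) v(2)] L2.C0_curve_diff[OF u(3) v(3)]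
        L2.curve_deriv_diff[OF u(2-4) v(2-4)])+
  have T: "0 \<in> {0..T}" using t by auto
  have wH: "w s \<in> H1_space" and vH: "v s \<in> H1_space" and uH: "u s \<in> H1_space" and wL: "w s \<in> L2_space"
    and u'L: "u' s \<in> L2_space" and v'L: "v' s \<in> L2_space" and w'L: "w' s \<in> L2_space" if s: "s \<in> {0..T}" for s
    using H1.C0_curveD(1)[OF _ s] L2.C0_curveD(1)[OF _ s] u v w by auto
  have wM: "H1_norm (w s) \<le> 2 * M" if s: "s \<in> {0..T}" for s
    using H1.nrm_diff_le[OF uH[OF s] vH[OF s]] M[OF s] by (simp add: w_def)
  have M0: "0 \<le> M" using H1.nrm_nonneg[OF uH[OF T]] M(1)[OF T] by linarith
  \<comment> \<open>Nonnegative coefficients make the form of \<open>h\<close> positive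
    semidefinite, which the Gram sums require; the form of \<open>h - k\<close> has no sign and is
    only estimated.\<close>
  interpret E: semi_inner H1_space "energy_form h" by (rule energy_form_semi_inner[OF h])
  have "(\<integral>x. w t x * w t x \<partial>lborel) \<le> (\<integral>x. w 0 x * w 0 x \<partial>lborel)
    + 2 * T * (2 * M * \<delta>1 + T * (2 * real CARD('n) * \<delta> * M\<^sup>2))"
  proof (rule wave_kernel_estimate[where A = "\<lambda>s q. energy_form h (w s) (w q)" and L = "\<lambda>q. \<integral>x. w q x * w q x \<partial>lborel"
        and K = "\<lambda>s q. \<integral>x. w' s x * w q x \<partial>lborel" and B = "\<lambda>s q. energy_form (\<lambda>j x. h j x - k j x) (v s) (w q)", OF _ _ _ _ _ _ _ t])
    show "continuous_on ({0..T} \<times> {0..T}) (\<lambda>(s, q). energy_form h (w s) (w q))"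
      by (rule energy_form_curve_continuous[OF h(1) w(1) w(1)])
    show "0 \<le> (\<Sum>i<n. \<Sum>j<n. energy_form h (w (\<tau> i)) (w (\<tau> j)))" if "\<And>i. i < n \<Longrightarrow> \<tau> i \<in> {0..T}" for n :: nat and \<tau>
      by (rule E.gram_nonneg[where u = "\<lambda>i. w (\<tau> i)"]) (rule wH[OF that])
    show "energy_form h (w p) (w q) = energy_form h (w q) (w p)" for p q by (rule energy_form_commute)
    fix q assume q: "q \<in> {0..T}"
    show "((\<lambda>q. \<integral>x. w q x * w q x \<partial>lborel) has_real_derivative 2 * (\<integral>x. w' q x * w q x \<partial>lborel)) (at q within {0..T})"
      by (rule L2.ip_self_curve_deriv[OF w(2-4) q])
    have "\<bar>\<integral>x. w' 0 x * w q x \<partial>lborel\<bar> \<le> L2_norm (w' 0) * L2_norm (w q)"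
      by (rule L2.cauchy_schwarz[OF w'L[OF T] wL[OF q]])
    also have "\<dots> \<le> \<delta>1 * (2 * M)"
      using \<delta>1 order_trans[OF L2_norm_le_H1_norm wM[OF q]] L2.nrm_nonneg[OF wL[OF q]] L2.nrm_nonneg[OF w'L[OF T]]
      by (intro mult_mono) (auto simp: w'_def)
    finally show "\<bar>\<integral>x. w' 0 x * w q x \<partial>lborel\<bar> \<le> 2 * M * \<delta>1" by (simp add: mult_ac)
    fix s assume s: "s \<in> {0..T}"
    have "\<bar>energy_form (\<lambda>j x. h j x - k j x) (v s) (w q)\<bar> \<le> (real CARD('n) * \<delta>) * (H1_norm (v s) * H1_norm (w q))"
      by (rule energy_form_bound[OF hk vH[OF s] wH[OF q]])
    also have "\<dots> \<le> (real CARD('n) * \<delta>) * (M * (2 * M))"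
      using M(2)[OF s] wM[OF q] M0 \<delta> H1.nrm_nonneg[OF wH[OF q]] by (intro mult_left_mono mult_mono) auto
    finally show "\<bar>energy_form (\<lambda>j x. h j x - k j x) (v s) (w q)\<bar> \<le> 2 * real CARD('n) * \<delta> * M\<^sup>2"
      by (simp add: power2_eq_square mult_ac)
    have "((\<lambda>s. (\<integral>x. u' s x * w q x \<partial>lborel) - (\<integral>x. v' s x * w q x \<partial>lborel)) has_real_derivative
        - energy_form h (u s) (w q) - - energy_form k (v s) (w q)) (at s within {0..T})"
      by (rule DERIV_diff[OF weak_wave_equation_H1[OF h(1) wu wH[OF q] s] weak_wave_equation_H1[OF k wv wH[OF q] s]])
    \<comment> \<open>The principal part keeps the coefficients \<open>h\<close> and acts on w; the
      change of coefficients is thrown onto \<open>v\<close> and becomes the source.\<close>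
    moreover have "- energy_form h (u s) (w q) - - energy_form k (v s) (w q)
        = - (energy_form h (w s) (w q) + energy_form (\<lambda>j x. h j x - k j x) (v s) (w q))"
      using energy_form_coefficient_diff[OF h(1) k vH[OF s] wH[OF q]]
        energy_form_diff_left[OF h(1) uH[OF s] vH[OF s] wH[OF q]] unfolding w_def by linarith
    ultimately have D: "((\<lambda>s. (\<integral>x. u' s x * w q x \<partial>lborel) - (\<integral>x. v' s x * w q x \<partial>lborel)) has_real_derivative
        - (energy_form h (w s) (w q) + energy_form (\<lambda>j x. h j x - k j x) (v s) (w q))) (at s within {0..T})"
      by (simp only:)
    have eq: "(\<integral>x. w' s x * w q x \<partial>lborel) = (\<integral>x. u' s x * w q x \<partial>lborel) - (\<integral>x. v' s x * w q x \<partial>lborel)"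
      if "s \<in> {0..T}" for s
      unfolding w'_def by (rule L2.diff_left[OF u'L[OF that] v'L[OF that] wL[OF q]])
    show "((\<lambda>s. \<integral>x. w' s x * w q x \<partial>lborel) has_real_derivative
        - (energy_form h (w s) (w q) + energy_form (\<lambda>j x. h j x - k j x) (v s) (w q))) (at s within {0..T})"
      unfolding has_field_derivative_def
      by (rule has_derivative_transform[OF s eq D[unfolded has_field_derivative_def]])
  qed
  then show ?thesis
    unfolding L2.nrm_square[OF wL[OF t], symmetric] L2.nrm_square[OF wL[OF T], symmetric] by (simp add: w_def)
qed


end

section \<open>Essential bounds and moderate nets\<close>

lemma Linf_space_bound:
  fixes f :: "'a::euclidean_space \<Rightarrow> real"
  assumes "f \<in> Linf_space"
  shows "AE x in lborel. \<bar>f x\<bar> \<le> Linf_norm f" and "0 \<le> Linf_norm f"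
proof -
  let ?e = "esssup lborel (\<lambda>x. ereal \<bar>f x\<bar>)"
  have AE: "AE x in lborel. ereal \<bar>f x\<bar> \<le> ?e" by (rule esssup_AE)
  \<comment> \<open>\<open>real_of_ereal\<close> sends infinite values to 0, so both infinities must
    be excluded: the positive one by membership in the space, the negative one because some point
    satisfies this bound.\<close>
  have "\<exists>x. ereal \<bar>f x\<bar> \<le> ?e"
    using eventually_happens[OF AE] by (simp add: ae_filter_eq_bot_iff)
  then have e: "0 \<le> ?e" by (meson abs_ge_zero ereal_less_eq(5) order_trans)
  have "?e < \<infinity>" using assms by (simp add: Linf_space_def)
  then have eq: "ereal (Linf_norm f) = ?e"
    using e unfolding Linf_norm_def by (cases ?e) auto
  show "0 \<le> Linf_norm f" using e unfolding eq[symmetric] by simp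
  show "AE x in lborel. \<bar>f x\<bar> \<le> Linf_norm f"
    using AE unfolding eq[symmetric] by simp
qed

lemma W1inf_space_bound:
  fixes f :: "'a::euclidean_space \<Rightarrow> real"
  assumes "f \<in> W1inf_space"
  shows "f \<in> borel_measurable borel" and "AE x in lborel. \<bar>f x\<bar> \<le> W1inf_norm f"
proof -
  have f: "f \<in> Linf_space" and g: "(\<lambda>x. norm (weak_grad f x)) \<in> Linf_space"
    using assms by (auto simp: W1inf_space_def)
  show "f \<in> borel_measurable borel" using f by (simp add: Linf_space_def)
  show "AE x in lborel. \<bar>f x\<bar> \<le> W1inf_norm f"
    using Linf_space_bound(1)[OF f]
    by eventually_elim (use Linf_space_bound(2)[OF g] in \<open>simp add: W1inf_norm_def\<close>)
qed

lemma bounded_coefficientsI: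
  assumes "\<And>j. h j \<in> W1inf_space" "\<And>j. W1inf_norm (h j) \<le> H"
  shows "bounded_coefficients h H"
  unfolding bounded_coefficients_def
proof (intro allI conjI)
  fix j
  show "h j \<in> borel_measurable borel" by (rule W1inf_space_bound(1)[OF assms(1)])
  show "AE x in lborel. \<bar>h j x\<bar> \<le> H"
    using W1inf_space_bound(2)[OF assms(1)[of j]] by eventually_elim (use assms(2)[of j] in linarith)
qed

lemma bounded_coefficients_mono: "bounded_coefficients h H \<Longrightarrow> H \<le> K \<Longrightarrow> bounded_coefficients h K"
  unfolding bounded_coefficients_def by (meson eventually_mono order_trans)

lemma moderate_bound_weaken:
  fixes c d \<epsilon> :: real
  assumes "0 < \<epsilon>" "\<epsilon> \<le> 1" "N \<le> P" "c \<le> d" "0 \<le> d"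
  shows "c / \<epsilon> ^ N \<le> d / \<epsilon> ^ P"
  using assms by (intro frac_le power_decreasing) auto

context cartesian_approximate_identity
begin

text \<open>For \<epsilon> \<le> 1 a larger exponent only weakens a bound, so the three orders and
  all constants can be merged into one pair \<open>c\<close>, \<open>P\<close>.\<close>

lemma moderate_data:
  fixes h :: "'n \<Rightarrow> 'n net" and v0 v1 :: "'n net"
  assumes h: "\<And>i. moderate_of_order N0 W1inf_space W1inf_norm (h i)"
    and v0: "moderate_of_order N1 H2_space H2_norm v0" and v1: "moderate_of_order N2 H1_space H1_norm v1"
  obtains c P where "1 \<le> c"
    "\<And>\<epsilon>. \<epsilon> \<in> {0<..1} \<Longrightarrow> bounded_coefficients (\<lambda>i. h i \<epsilon>) (c / \<epsilon> ^ P)"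
    "\<And>\<epsilon>. \<epsilon> \<in> {0<..1} \<Longrightarrow> v0 \<epsilon> \<in> H1_space \<and> H1_norm (v0 \<epsilon>) \<le> c / \<epsilon> ^ P"
    "\<And>\<epsilon>. \<epsilon> \<in> {0<..1} \<Longrightarrow> v1 \<epsilon> \<in> L2_space \<and> L2_norm (v1 \<epsilon>) \<le> c / \<epsilon> ^ P"
proof -
  obtain ch where ch: "\<And>i. 0 < ch i" "\<And>i \<epsilon>. \<epsilon> \<in> {0<..1} \<Longrightarrow> h i \<epsilon> \<in> W1inf_space \<and> W1inf_norm (h i \<epsilon>) \<le> ch i / \<epsilon> ^ N0"
    using h unfolding moderate_of_order_def by metis
  obtain c0 where c0: "0 < c0" "\<And>\<epsilon>. \<epsilon> \<in> {0<..1} \<Longrightarrow> v0 \<epsilon> \<in> H2_space \<and> H2_norm (v0 \<epsilon>) \<le> c0 / \<epsilon> ^ N1"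
    using v0 unfolding moderate_of_order_def by metis
  obtain c1 where c1: "0 < c1" "\<And>\<epsilon>. \<epsilon> \<in> {0<..1} \<Longrightarrow> v1 \<epsilon> \<in> H1_space \<and> H1_norm (v1 \<epsilon>) \<le> c1 / \<epsilon> ^ N2"
    using v1 unfolding moderate_of_order_def by metis
  \<comment> \<open>The factor 2 is the one lost in passing from the H^2 to the H^1 norm; the
    summand 1 ensures \<open>1 \<le> c\<close>.\<close>
  define c where "c = 1 + (\<Sum>i\<in>UNIV. ch i) + 2 * c0 + c1"
  define P where "P = N0 + N1 + N2"
  have s: "ch i \<le> (\<Sum>i\<in>UNIV. ch i)" for i using ch(1) by (intro member_le_sum) (auto simp: less_imp_le)
  have s0: "0 \<le> (\<Sum>i\<in>UNIV. ch i)" using ch(1) by (intro sum_nonneg) (simp add: less_imp_le)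
  have c: "1 \<le> c" "2 * c0 \<le> c" "c1 \<le> c" "\<And>i. ch i \<le> c"
    using s s0 c0(1) c1(1) unfolding c_def by (auto intro: order_trans[OF s])
  show ?thesis
  proof (rule that[OF c(1)])
    fix \<epsilon> :: real assume \<epsilon>: "\<epsilon> \<in> {0<..1}"
    then have e: "0 < \<epsilon>" "\<epsilon> \<le> 1" by auto
    show "bounded_coefficients (\<lambda>i. h i \<epsilon>) (c / \<epsilon> ^ P)"
    proof (rule bounded_coefficientsI)
      show "h j \<epsilon> \<in> W1inf_space" for j using ch(2)[OF \<epsilon>] by blast
      show "W1inf_norm (h j \<epsilon>) \<le> c / \<epsilon> ^ P" for j
        using ch(2)[OF \<epsilon>, of j] moderate_bound_weaken[OF e, of N0 P "ch j" c] c(1) c(4)[of j] by (simp add: P_def)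
    qed
    have "H1_norm (v0 \<epsilon>) \<le> 2 * (c0 / \<epsilon> ^ N1)"
      using H1_norm_le_H2_norm[of "v0 \<epsilon>"] c0(2)[OF \<epsilon>] by linarith
    also have "\<dots> = (2 * c0) / \<epsilon> ^ N1" by simp
    also have "\<dots> \<le> c / \<epsilon> ^ P"
      using moderate_bound_weaken[OF e, of N1 P "2 * c0" c] c by (simp add: P_def)
    finally show "v0 \<epsilon> \<in> H1_space \<and> H1_norm (v0 \<epsilon>) \<le> c / \<epsilon> ^ P"
      using c0(2)[OF \<epsilon>] by (simp add: H2_space_def)
    have "L2_norm (v1 \<epsilon>) \<le> c1 / \<epsilon> ^ N2"
      using L2_norm_le_H1_norm[of "v1 \<epsilon>"] c1(2)[OF \<epsilon>] by linarith
    also have "\<dots> \<le> c / \<epsilon> ^ P"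
      using moderate_bound_weaken[OF e, of N2 P c1 c] c by (simp add: P_def)
    finally show "v1 \<epsilon> \<in> L2_space \<and> L2_norm (v1 \<epsilon>) \<le> c / \<epsilon> ^ P"
      using c1(2)[OF \<epsilon>] H1_D(1) by blast
  qed
qed

text \<open>The initial conditions hold only almost everywhere, so norms of the data are transferred
  to the solution at time 0 through the insensitivity of weak derivatives to null sets.\<close>

lemma solves_wave_bound:
  fixes T :: real and h :: "'n \<Rightarrow> real^'n \<Rightarrow> real" and u :: "real \<Rightarrow> real^'n \<Rightarrow> real"
  assumes sol: "solves_wave T h v0 v1 u" and T: "0 < T" and h: "bounded_coefficients h K" "\<And>j x. c0 \<le> h j x" and c0: "0 < c0"
    and v: "v0 \<in> H1_space" "H1_norm v0 \<le> K" "v1 \<in> L2_space" "L2_norm v1 \<le> K" and K: "1 \<le> K"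
  obtains u' where "weak_wave_equation T h u u'" "AE x in lborel. u 0 x = v0 x" "AE x in lborel. u' 0 x = v1 x"
    "\<And>t. t \<in> {0..T} \<Longrightarrow> H1_norm (u t) \<le> sqrt ((1 + T * (real CARD('n) + 1))\<^sup>2 + (real CARD('n) + 1) / c0) * K\<^sup>2"
proof -
  \<comment> \<open>\<open>weak_wave_equation\<close> is \<open>solves_wave\<close> with the
    velocity named and the initial conditions split off.\<close>
  obtain u' where w: "weak_wave_equation T h u u'" and init: "AE x in lborel. u 0 x = v0 x" "AE x in lborel. u' 0 x = v1 x"
    using sol unfolding solves_wave_def weak_wave_equation_def by blast
  have 0: "0 \<in> {0..T}" using T by simp
  have uH: "u 0 \<in> H1_space" and u'L: "u' 0 \<in> L2_space"
    using w H1.C0_curveD(1)[OF _ 0] L2.C0_curveD(1)[OF _ 0] by (auto simp: weak_wave_equation_def)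
  have "L2_norm (u 0) = L2_norm v0"
    by (rule L2_norm_cong_AE[OF _ _ init(1)]) (use uH v H1_D(1) L2_measurable in blast)+
  moreover have "L2_norm (weak_deriv b (u 0)) = L2_norm (weak_deriv b v0)" if "b \<in> Basis" for b
    by (rule L2_norm_cong_AE[OF _ _ H1_cong_AE[OF uH _ init(1) that]]) (use uH v H1_D(1,2) that L2_measurable in blast)+
  ultimately have "H1_norm (u 0) = H1_norm v0" by (simp add: H1_norm_def)
  then have 1: "H1_norm (u 0) \<le> K" using v by simp
  have "L2_norm (u' 0) = L2_norm v1"
    by (rule L2_norm_cong_AE[OF _ _ init(2)]) (use u'L v L2_measurable in blast)+
  then have 2: "L2_norm (u' 0) \<le> K" using v by simp
  show ?thesis
    by (rule that[OF w init wave_a_priori_bound[OF h c0 w K order_refl 1 2]])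
qed

end

theorem theorem2p5:
  fixes T :: real
    and hs :: "'n::finite \<Rightarrow> 'n functional" and h u0 u1 :: "'n functional"
    and \<R> :: "(('n \<Rightarrow> 'n net) \<times> 'n net \<times> 'n net) set"
  assumes "T > 0"
    and "\<And>i. distribution (hs i)" and "distribution u0" and "distribution u1"
    and "\<exists>u. very_weak_solution T hs u0 u1 u"
    and "\<And>i. hs i = h"
    and "\<And>h\<epsilon> u0\<epsilon> u1\<epsilon>. (h\<epsilon>, u0\<epsilon>, u1\<epsilon>) \<in> regularisations hs u0 u1 \<inter> \<R> \<Longrightarrow>
           \<exists>N0 N1 N2. (\<forall>i. moderate_of_order N0 W1inf_space W1inf_norm (h\<epsilon> i)) \<and>
             moderate_of_order N1 H2_space H2_norm u0\<epsilon> \<and>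
             moderate_of_order N2 H1_space H1_norm u1\<epsilon>"
  shows "unique_very_weak_solution \<R> T hs u0 u1"
  unfolding unique_very_weak_solution_def
proof (intro allI impI)
  fix a a' :: "'n \<Rightarrow> 'n net" and p q p' q' :: "'n net" and u v :: "real \<Rightarrow> real \<Rightarrow> real^'n \<Rightarrow> real" and N :: nat
  assume reg: "(a, p, q) \<in> regularisations hs u0 u1 \<inter> \<R>" "(a', p', q') \<in> regularisations hs u0 u1 \<inter> \<R>"
    and neg_a: "\<forall>i. negligible_net W1inf_space W1inf_norm (\<lambda>\<epsilon> x. a i \<epsilon> x - a' i \<epsilon> x)"
    and neg_p: "negligible_net H1_space H1_norm (\<lambda>\<epsilon> x. p \<epsilon> x - p' \<epsilon> x)"
    and neg_q: "negligible_net L2_space L2_norm (\<lambda>\<epsilon> x. q \<epsilon> x - q' \<epsilon> x)"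
    and sol: "solution_family T (a, p, q) u" "solution_family T (a', p', q') v" and N: "0 < N"
  \<comment> \<open>The mollifier that produced the regularisation also generates the approximate
    identity on which the whole H^1 theory depends.\<close>
  obtain \<psi> :: "real^'n \<Rightarrow> real" where "mollifier \<psi>"
    using reg(1) by (auto simp: regularisations_def regularises_def)
  then obtain \<rho> :: "nat \<Rightarrow> real^'n \<Rightarrow> real" and r where "approximate_identity \<rho> r"
    by (rule mollifier_approximate_identity)
  then interpret cartesian_approximate_identity \<rho> r by (simp add: cartesian_approximate_identity_def)
  obtain ca where ca: "0 < ca" "\<And>i \<epsilon> x. \<epsilon> \<in> {0<..1} \<Longrightarrow> ca \<le> a i \<epsilon> x"
    using reg(1) by (auto simp: regularisations_def)
  obtain ca' where ca': "0 < ca'" "\<And>i \<epsilon> x. \<epsilon> \<in> {0<..1} \<Longrightarrow> ca' \<le> a' i \<epsilon> x"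
    using reg(2) by (auto simp: regularisations_def)
  \<comment> \<open>Each family comes with its own lower bound; a common one gives both solutions
    the same constant \<open>D\<close>.\<close>
  define c0 where "c0 = min ca ca'"
  have c0: "0 < c0" "\<And>i \<epsilon> x. \<epsilon> \<in> {0<..1} \<Longrightarrow> c0 \<le> a i \<epsilon> x" "\<And>i \<epsilon> x. \<epsilon> \<in> {0<..1} \<Longrightarrow> c0 \<le> a' i \<epsilon> x"
  proof -
    have "c0 \<le> ca" "c0 \<le> ca'" by (simp_all add: c0_def)
    then show "c0 \<le> a i \<epsilon> x" "c0 \<le> a' i \<epsilon> x" if "\<epsilon> \<in> {0<..1}" for i \<epsilon> x
      using ca(2)[OF that, of i x] ca'(2)[OF that, of i x] by linarith+
    show "0 < c0" using ca(1) ca'(1) by (simp add: c0_def)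
  qed
  obtain N0 N1 N2 where mod: "\<And>i. moderate_of_order N0 W1inf_space W1inf_norm (a i)"
    "moderate_of_order N1 H2_space H2_norm p" "moderate_of_order N2 H1_space H1_norm q"
    using assms(7)[OF reg(1)] by blast
  obtain N0' N1' N2' where mod': "\<And>i. moderate_of_order N0' W1inf_space W1inf_norm (a' i)"
    "moderate_of_order N1' H2_space H2_norm p'" "moderate_of_order N2' H1_space H1_norm q'"
    using assms(7)[OF reg(2)] by blast
  obtain c1 P1 where data: "1 \<le> c1" "\<And>\<epsilon>. \<epsilon> \<in> {0<..1} \<Longrightarrow> bounded_coefficients (\<lambda>i. a i \<epsilon>) (c1 / \<epsilon> ^ P1)"
    "\<And>\<epsilon>. \<epsilon> \<in> {0<..1} \<Longrightarrow> p \<epsilon> \<in> H1_space \<and> H1_norm (p \<epsilon>) \<le> c1 / \<epsilon> ^ P1"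
    "\<And>\<epsilon>. \<epsilon> \<in> {0<..1} \<Longrightarrow> q \<epsilon> \<in> L2_space \<and> L2_norm (q \<epsilon>) \<le> c1 / \<epsilon> ^ P1"
    by (rule moderate_data[where h = a, OF mod]) blast
  obtain c2 P2 where data': "1 \<le> c2" "\<And>\<epsilon>. \<epsilon> \<in> {0<..1} \<Longrightarrow> bounded_coefficients (\<lambda>i. a' i \<epsilon>) (c2 / \<epsilon> ^ P2)"
    "\<And>\<epsilon>. \<epsilon> \<in> {0<..1} \<Longrightarrow> p' \<epsilon> \<in> H1_space \<and> H1_norm (p' \<epsilon>) \<le> c2 / \<epsilon> ^ P2"
    "\<And>\<epsilon>. \<epsilon> \<in> {0<..1} \<Longrightarrow> q' \<epsilon> \<in> L2_space \<and> L2_norm (q' \<epsilon>) \<le> c2 / \<epsilon> ^ P2"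
    by (rule moderate_data[where h = a', OF mod']) blast
  define c where "c = max c1 c2"
  define P where "P = max P1 P2"
  define n where "n = real CARD('n)"
  define D where "D = sqrt ((1 + T * (n + 1))\<^sup>2 + (n + 1) / c0)"
  \<comment> \<open>The estimate is for the squared norm, so \<epsilon>^(2N) is wanted, while the
    squared a priori bound \<open>M\<^sup>2\<close> grows like \<epsilon>^(-4P).\<close>
  define k where "k = 2 * N + 4 * P"
  have c: "1 \<le> c" using data(1) by (simp add: c_def)
  have n: "0 \<le> n" by (simp add: n_def)
  have "1\<^sup>2 \<le> (1 + T * (n + 1))\<^sup>2" using \<open>T > 0\<close> n by (intro power_mono) auto
  moreover have "0 \<le> (n + 1) / c0" using n c0(1) by simp
  ultimately have D: "1 \<le> D" unfolding D_def by (intro real_le_rsqrt) linarith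
  have k: "0 < k" using N by (simp add: k_def)
  \<comment> \<open>The constant depends on the coordinate \<open>i\<close>; the constants are
    chosen for all coordinates at once and later summed.\<close>
  have "\<exists>C. \<forall>\<epsilon>\<in>{0<..1}. (\<lambda>x. a i \<epsilon> x - a' i \<epsilon> x) \<in> W1inf_space \<and> W1inf_norm (\<lambda>x. a i \<epsilon> x - a' i \<epsilon> x) \<le> C * \<epsilon> ^ k" for i
    using neg_a k unfolding negligible_net_def by blast
  then have "\<exists>Ca. \<forall>i. \<forall>\<epsilon>\<in>{0<..1}. (\<lambda>x. a i \<epsilon> x - a' i \<epsilon> x) \<in> W1inf_space \<and> W1inf_norm (\<lambda>x. a i \<epsilon> x - a' i \<epsilon> x) \<le> Ca i * \<epsilon> ^ k"
    by (intro choice allI)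
  then obtain Ca where Ca: "\<And>i \<epsilon>. \<epsilon> \<in> {0<..1} \<Longrightarrow> (\<lambda>x. a i \<epsilon> x - a' i \<epsilon> x) \<in> W1inf_space \<and> W1inf_norm (\<lambda>x. a i \<epsilon> x - a' i \<epsilon> x) \<le> Ca i * \<epsilon> ^ k"
    by blast
  obtain Cp where Cp: "\<And>\<epsilon>. \<epsilon> \<in> {0<..1} \<Longrightarrow> H1_norm (\<lambda>x. p \<epsilon> x - p' \<epsilon> x) \<le> Cp * \<epsilon> ^ k"
    using neg_p k unfolding negligible_net_def by blast
  obtain Cq where Cq: "\<And>\<epsilon>. \<epsilon> \<in> {0<..1} \<Longrightarrow> L2_norm (\<lambda>x. q \<epsilon> x - q' \<epsilon> x) \<le> Cq * \<epsilon> ^ k"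
    using neg_q k unfolding negligible_net_def by blast
  define C where "C = (\<Sum>i\<in>UNIV. \<bar>Ca i\<bar>) + \<bar>Cp\<bar> + \<bar>Cq\<bar>"
  have Ca_le: "\<bar>Ca i\<bar> \<le> (\<Sum>i\<in>UNIV. \<bar>Ca i\<bar>)" for i by (rule member_le_sum) auto
  have sum0: "0 \<le> (\<Sum>i\<in>UNIV. \<bar>Ca i\<bar>)" by (intro sum_nonneg) simp
  have C: "0 \<le> C" "\<And>i. Ca i \<le> C" "Cp \<le> C" "Cq \<le> C"
  proof -
    show "0 \<le> C" "Cp \<le> C" "Cq \<le> C" using sum0 unfolding C_def by linarith+
    show "Ca i \<le> C" for i using Ca_le[of i] unfolding C_def by linarith
  qed
  \<comment> \<open>The bracket collects initial position, initial velocity and source; the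
    remaining factors are what is left of the product of the negligible size and
    \<open>M\<^sup>2\<close> after the powers of \<epsilon> have been extracted.\<close>
  define E where "E = (C + 4 * T + 4 * T\<^sup>2 * n) * C * D\<^sup>2 * c ^ 4"
  have "L2_norm (\<lambda>x. u \<epsilon> t x - v \<epsilon> t x) \<le> sqrt E * \<epsilon> ^ N" if \<epsilon>: "\<epsilon> \<in> {0<..1}" and t: "t \<in> {0..T}" for \<epsilon> t
  proof -
    have e: "0 < \<epsilon>" "\<epsilon> \<le> 1" using \<epsilon> by auto
    define K where "K = c / \<epsilon> ^ P"
    define M where "M = D * K\<^sup>2"
    define \<kappa> where "\<kappa> = C * \<epsilon> ^ k"
    have K: "1 \<le> K" "c1 / \<epsilon> ^ P1 \<le> K" "c2 / \<epsilon> ^ P2 \<le> K"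
    proof -
      have le: "P1 \<le> P" "P2 \<le> P" "c1 \<le> c" "c2 \<le> c" "0 \<le> c" using c by (auto simp: c_def P_def)
      show "1 \<le> K" using moderate_bound_weaken[OF e, of 0 P 1 c] c by (simp add: K_def)
      show "c1 / \<epsilon> ^ P1 \<le> K" "c2 / \<epsilon> ^ P2 \<le> K"
        unfolding K_def by (rule moderate_bound_weaken[OF e le(1,3,5)], rule moderate_bound_weaken[OF e le(2,4,5)])
    qed
    have bd: "bounded_coefficients (\<lambda>i. a i \<epsilon>) K" "bounded_coefficients (\<lambda>i. a' i \<epsilon>) K"
      using bounded_coefficients_mono data(2)[OF \<epsilon>] data'(2)[OF \<epsilon>] K by blast+
    have init: "p \<epsilon> \<in> H1_space" "H1_norm (p \<epsilon>) \<le> K" "q \<epsilon> \<in> L2_space" "L2_norm (q \<epsilon>) \<le> K"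
      "p' \<epsilon> \<in> H1_space" "H1_norm (p' \<epsilon>) \<le> K" "q' \<epsilon> \<in> L2_space" "L2_norm (q' \<epsilon>) \<le> K"
      using data(3,4)[OF \<epsilon>] data'(3,4)[OF \<epsilon>] K by auto
    have solves: "solves_wave T (\<lambda>i. a i \<epsilon>) (p \<epsilon>) (q \<epsilon>) (u \<epsilon>)" "solves_wave T (\<lambda>i. a' i \<epsilon>) (p' \<epsilon>) (q' \<epsilon>) (v \<epsilon>)"
      using sol \<epsilon> by (auto simp: solution_family_def)
    obtain u' where u': "weak_wave_equation T (\<lambda>i. a i \<epsilon>) (u \<epsilon>) u'" "AE x in lborel. u \<epsilon> 0 x = p \<epsilon> x" "AE x in lborel. u' 0 x = q \<epsilon> x"
      "\<And>t. t \<in> {0..T} \<Longrightarrow> H1_norm (u \<epsilon> t) \<le> M"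
      unfolding M_def D_def n_def
      by (rule solves_wave_bound[OF solves(1) \<open>T > 0\<close> bd(1) c0(2)[OF \<epsilon>] c0(1) init(1-4) K(1)]) blast
    obtain v' where v': "weak_wave_equation T (\<lambda>i. a' i \<epsilon>) (v \<epsilon>) v'" "AE x in lborel. v \<epsilon> 0 x = p' \<epsilon> x" "AE x in lborel. v' 0 x = q' \<epsilon> x"
      "\<And>t. t \<in> {0..T} \<Longrightarrow> H1_norm (v \<epsilon> t) \<le> M"
      unfolding M_def D_def n_def
      by (rule solves_wave_bound[OF solves(2) \<open>T > 0\<close> bd(2) c0(3)[OF \<epsilon>] c0(1) init(5-8) K(1)]) blast
    have ek: "0 \<le> \<epsilon> ^ k" using e by simp
    have scale: "y * \<epsilon> ^ k \<le> \<kappa>" if "y \<le> C" for y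
      unfolding \<kappa>_def using that ek by (rule mult_right_mono)
    have \<kappa>0: "0 \<le> \<kappa>" unfolding \<kappa>_def using C(1) ek by simp
    have diff_coeff: "bounded_coefficients (\<lambda>i x. a i \<epsilon> x - a' i \<epsilon> x) \<kappa>"
    proof (rule bounded_coefficientsI)
      show "(\<lambda>x. a i \<epsilon> x - a' i \<epsilon> x) \<in> W1inf_space" for i using Ca[OF \<epsilon>] by blast
      show "W1inf_norm (\<lambda>x. a i \<epsilon> x - a' i \<epsilon> x) \<le> \<kappa>" for i
        using Ca[OF \<epsilon>, of i] scale[OF C(2)[of i]] by linarith
    qed
    have 0: "0 \<in> {0..T}" using \<open>T > 0\<close> by simp
    have L0: "u \<epsilon> 0 \<in> L2_space" "v \<epsilon> 0 \<in> L2_space" "u' 0 \<in> L2_space" "v' 0 \<in> L2_space"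
      using u'(1) v'(1) L2.C0_curveD(1)[OF _ 0] by (auto simp: weak_wave_equation_def)
    note meas[measurable] = L0[THEN L2_measurable] init(3)[THEN L2_measurable] init(7)[THEN L2_measurable]
      init(1)[THEN H1_D(1), THEN L2_measurable] init(5)[THEN H1_D(1), THEN L2_measurable]
    have "L2_norm (\<lambda>x. u \<epsilon> 0 x - v \<epsilon> 0 x) = L2_norm (\<lambda>x. p \<epsilon> x - p' \<epsilon> x)"
    proof (rule L2_norm_cong_AE)
      show "AE x in lborel. u \<epsilon> 0 x - v \<epsilon> 0 x = p \<epsilon> x - p' \<epsilon> x"
        using u'(2) v'(2) by eventually_elim simp
    qed measurable
    also have "\<dots> \<le> \<kappa>"
      using L2_norm_le_H1_norm[of "\<lambda>x. p \<epsilon> x - p' \<epsilon> x"] Cp[OF \<epsilon>] scale[OF C(3)] by linarith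
    finally have w0: "L2_norm (\<lambda>x. u \<epsilon> 0 x - v \<epsilon> 0 x) \<le> \<kappa>" .
    have "L2_norm (\<lambda>x. u' 0 x - v' 0 x) = L2_norm (\<lambda>x. q \<epsilon> x - q' \<epsilon> x)"
    proof (rule L2_norm_cong_AE)
      show "AE x in lborel. u' 0 x - v' 0 x = q \<epsilon> x - q' \<epsilon> x"
        using u'(3) v'(3) by eventually_elim simp
    qed measurable
    also have "\<dots> \<le> \<kappa>" using Cq[OF \<epsilon>] scale[OF C(4)] by linarith
    finally have w1: "L2_norm (\<lambda>x. u' 0 x - v' 0 x) \<le> \<kappa>" .
    have pos: "0 \<le> a i \<epsilon> x" for i x using c0(2)[OF \<epsilon>, of i x] c0(1) by linarith
    have "(L2_norm (\<lambda>x. u \<epsilon> t x - v \<epsilon> t x))\<^sup>2 \<le> (L2_norm (\<lambda>x. u \<epsilon> 0 x - v \<epsilon> 0 x))\<^sup>2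
        + 2 * T * (2 * M * \<kappa> + T * (2 * n * \<kappa> * M\<^sup>2))"
      unfolding n_def
      by (rule wave_difference_estimate[OF bd(1) pos bd(2) diff_coeff u'(1) v'(1) u'(4) v'(4) w1 \<kappa>0 t])
    \<comment> \<open>All terms are brought to multiples of \<open>\<kappa> * M\<^sup>2\<close>,
      which is possible because \<open>1 \<le> M\<close>.\<close>
    also have "\<dots> \<le> C * (\<kappa> * M\<^sup>2) + 2 * T * (2 * (\<kappa> * M\<^sup>2) + T * (2 * n * \<kappa> * M\<^sup>2))"
    proof -
      have "1 * 1\<^sup>2 \<le> D * K\<^sup>2" using D K(1) by (intro mult_mono power_mono) auto
      then have M1: "1 \<le> M" by (simp add: M_def)
      then have M2: "M \<le> M\<^sup>2" "1 \<le> M\<^sup>2" using power_increasing[of 1 2 M] by (auto simp: one_le_power)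
      have "(L2_norm (\<lambda>x. u \<epsilon> 0 x - v \<epsilon> 0 x))\<^sup>2 \<le> \<kappa>\<^sup>2"
        using w0 by (rule power_mono) (simp add: L2_norm_def)
      also have "\<dots> \<le> C * (\<kappa> * M\<^sup>2)"
      proof -
        \<comment> \<open>The initial difference enters quadratically; one of its two factors is
          spent on the constant since \<epsilon>^k \<le> 1.\<close>
        have "\<kappa> \<le> C" unfolding \<kappa>_def using C(1) e by (simp add: mult_left_le power_le_one)
        then have "\<kappa> * \<kappa> \<le> C * \<kappa>" using \<kappa>0 by (rule mult_right_mono)
        also have "\<dots> \<le> C * (\<kappa> * M\<^sup>2)"
          using C(1) \<kappa>0 M2(2) mult_left_mono[of 1 "M\<^sup>2" \<kappa>] by (intro mult_left_mono) auto
        finally show ?thesis by (simp add: power2_eq_square)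
      qed
      finally have 1: "(L2_norm (\<lambda>x. u \<epsilon> 0 x - v \<epsilon> 0 x))\<^sup>2 \<le> C * (\<kappa> * M\<^sup>2)" .
      have "\<kappa> * M \<le> \<kappa> * M\<^sup>2" using M2(1) \<kappa>0 by (rule mult_left_mono)
      then have "2 * M * \<kappa> \<le> 2 * (\<kappa> * M\<^sup>2)" by (simp add: mult.commute)
      then show ?thesis
        using 1 \<open>T > 0\<close> mult_nonneg_nonneg[OF \<kappa>0 n] by (intro add_mono mult_left_mono) auto
    qed
    also have "\<dots> = (C + 4 * T + 4 * T\<^sup>2 * n) * (\<kappa> * M\<^sup>2)"
      by (simp add: algebra_simps power2_eq_square)
    \<comment> \<open>Here \<open>k\<close> takes effect: four powers of \<open>K\<close> consume
      \<epsilon>^(4P), leaving exactly the square of \<epsilon>^N.\<close>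
    also have "\<kappa> * M\<^sup>2 = C * D\<^sup>2 * c ^ 4 * (\<epsilon> ^ N)\<^sup>2"
    proof -
      have "K * \<epsilon> ^ P = c" using e by (simp add: K_def)
      then have "K ^ 4 * (\<epsilon> ^ P) ^ 4 = c ^ 4" by (simp flip: power_mult_distrib)
      moreover have "\<kappa> * M\<^sup>2 = C * D\<^sup>2 * (K ^ 4 * (\<epsilon> ^ P) ^ 4) * (\<epsilon> ^ N)\<^sup>2"
      proof -
        have "\<epsilon> ^ k = (\<epsilon> ^ N)\<^sup>2 * (\<epsilon> ^ P) ^ 4"
          by (simp add: k_def power_add mult.commute flip: power_mult)
        moreover have "M\<^sup>2 = D\<^sup>2 * K ^ 4" by (simp add: M_def power_mult_distrib flip: power_mult)
        ultimately show ?thesis unfolding \<kappa>_def by (simp only: mult_ac)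
      qed
      ultimately show ?thesis by simp
    qed
    finally have "(L2_norm (\<lambda>x. u \<epsilon> t x - v \<epsilon> t x))\<^sup>2 \<le> E * (\<epsilon> ^ N)\<^sup>2"
      by (simp add: E_def mult.assoc)
    then have "sqrt ((L2_norm (\<lambda>x. u \<epsilon> t x - v \<epsilon> t x))\<^sup>2) \<le> sqrt (E * (\<epsilon> ^ N)\<^sup>2)"
      by (rule real_sqrt_le_mono)
    then show ?thesis
      using e by (simp add: L2_norm_def real_sqrt_mult)
  qed
  then show "\<exists>C. \<forall>\<epsilon>\<in>{0<..1}. \<forall>t\<in>{0..T}. L2_norm (\<lambda>x. u \<epsilon> t x - v \<epsilon> t x) \<le> C * \<epsilon> ^ N" by blast
qed

end
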